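(* The following problem is NP-complete: given a binary matrix $M$ and an integer $k\ge0$, decide whether there exists a set of at most $k$ $0$-entries of $M$ such that flipping them (changing them to $1$) yields a matrix with the simultaneous consecutive ones property.
   Context: A binary matrix has the consecutive ones property (C1P) for rows if its columns can be permuted so that in every row the $1$-entries occur consecutively; it has the C1P for columns if its rows can be permuted so that in every column the $1$-entries occur consecutively. It has the simultaneous consecutive ones property (SC1P) if it has both. *)

theory Defs
  imports
    "HOL-Library.Log_Nat"
    "HOL-Combinatorics.Permutations"
    "HOL-Computational_Algebra.Polynomial"
    "Jordan_Normal_Form.Matrix"
begin

section \<open>Polynomial time and NP\<close>

subsection \<open>Deterministic multi-tape Turing machines\<close>

text \<open>
  States and tape symbols are natural numbers below a bound that belongs to the machine. Symbol 0 is
  the blank; 1 and 2 represent the bits \<open>False\<close> and \<open>True\<close>; a machine may use further symbols.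
  Tapes are infinite in both directions. Tape 0 is the input tape and the last tape is the output
  tape, so that they coincide for a machine with a single tape.
\<close>

datatype move = Move_Left | Stay | Move_Right

type_synonym action = "nat \<times> move"
type_synonym tape = "(int \<Rightarrow> nat) \<times> int"
type_synonym config = "nat \<times> tape list"

record turing_machine =
  num_tapes :: nat
  num_symbols :: nat
  num_states :: nat
  start_state :: nat
  halt_state :: nat
  transition :: "nat \<Rightarrow> nat list \<Rightarrow> nat \<times> action list"

definition wf_tm :: "turing_machine \<Rightarrow> bool" where
  "wf_tm T \<longleftrightarrow>
     num_tapes T \<ge> 1 \<and> num_symbols T \<ge> 3 \<and>
     start_state T < num_states T \<and> halt_state T < num_states T \<and>
     (\<forall>q ss q' as. q < num_states T \<longrightarrow> length ss = num_tapes T \<longrightarrow> set ss \<subseteq> {..<num_symbols T} \<longrightarrow>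
        transition T q ss = (q', as) \<longrightarrow>
        q' < num_states T \<and> length as = num_tapes T \<and> fst ` set as \<subseteq> {..<num_symbols T})"

definition read_tape :: "tape \<Rightarrow> nat" where
  "read_tape t = fst t (snd t)"

fun move_offset :: "move \<Rightarrow> int" where
  "move_offset Move_Left = - 1"
| "move_offset Stay = 0"
| "move_offset Move_Right = 1"

definition apply_action :: "action \<Rightarrow> tape \<Rightarrow> tape" where
  "apply_action a t = ((fst t)(snd t := fst a), snd t + move_offset (snd a))"

text \<open>A configuration in the halting state is left unchanged.\<close>

definition tm_step :: "turing_machine \<Rightarrow> config \<Rightarrow> config" where
  "tm_step T c =
     (if fst c = halt_state T then c
      else let (q, as) = transition T (fst c) (map read_tape (snd c))
           in (q, map2 apply_action as (snd c)))"

definition bits_on_tape :: "bool list \<Rightarrow> int \<Rightarrow> nat" where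
  "bits_on_tape xs p =
     (if 0 \<le> p \<and> p < int (length xs) then (if xs ! nat p then 2 else 1) else 0)"

definition initial_config :: "turing_machine \<Rightarrow> bool list \<Rightarrow> config" where
  "initial_config T xs =
     (start_state T, (bits_on_tape xs, 0) # replicate (num_tapes T - 1) (\<lambda>_. 0, 0))"

text \<open>
  Since the halting state is stationary, the following says that the machine halts after at most \<open>t\<close>
  steps. The output tape must then be blank outside the output; its head may be anywhere.
\<close>

definition outputs_within :: "turing_machine \<Rightarrow> bool list \<Rightarrow> bool list \<Rightarrow> nat \<Rightarrow> bool" where
  "outputs_within T xs ys t \<longleftrightarrow>
     (let c = (tm_step T ^^ t) (initial_config T xs)
      in fst c = halt_state T \<and> fst (last (snd c)) = bits_on_tape ys)"

definition poly_time_computable :: "(bool list \<Rightarrow> bool list) \<Rightarrow> bool" where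
  "poly_time_computable f \<longleftrightarrow>
     (\<exists>T. \<exists>p :: nat poly. wf_tm T \<and> (\<forall>xs. outputs_within T xs (f xs) (poly p (length xs))))"

subsection \<open>Languages, reductions and NP-completeness\<close>

type_synonym language = "bool list set"

definition poly_time_decidable :: "language \<Rightarrow> bool" where
  "poly_time_decidable L \<longleftrightarrow> poly_time_computable (\<lambda>xs. [xs \<in> L])"

text \<open>
  Self-delimiting pairing: every bit of the first component is preceded by \<open>True\<close>, and a single
  \<open>False\<close> marks its end.
\<close>

definition pair_bits :: "bool list \<Rightarrow> bool list \<Rightarrow> bool list" where
  "pair_bits xs us = concat (map (\<lambda>b. [True, b]) xs) @ False # us"

definition NP :: "language set" where
  "NP = {L. \<exists>V. \<exists>p :: nat poly. poly_time_decidable V \<and>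
              (\<forall>xs. xs \<in> L \<longleftrightarrow> (\<exists>us. length us \<le> poly p (length xs) \<and> pair_bits xs us \<in> V))}"

definition poly_time_reducible :: "language \<Rightarrow> language \<Rightarrow> bool" where
  "poly_time_reducible L L' \<longleftrightarrow> (\<exists>f. poly_time_computable f \<and> (\<forall>xs. xs \<in> L \<longleftrightarrow> f xs \<in> L'))"

definition NP_complete :: "language \<Rightarrow> bool" where
  "NP_complete L \<longleftrightarrow> L \<in> NP \<and> (\<forall>L'\<in>NP. poly_time_reducible L' L)"

section \<open>The simultaneous consecutive ones property\<close>

text \<open>Binary matrices are Boolean matrices, with \<open>True\<close> for the entry 1 and \<open>False\<close> for 0.\<close>

type_synonym binary_matrix = "bool mat"

definition consecutive :: "nat set \<Rightarrow> bool" where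
  "consecutive S \<longleftrightarrow> (\<forall>a\<in>S. \<forall>c\<in>S. \<forall>b. a < b \<and> b < c \<longrightarrow> b \<in> S)"

text \<open>The permutation \<open>\<pi>\<close> puts column (respectively row) \<open>\<pi> j\<close> at position \<open>j\<close>.\<close>

definition C1P_rows :: "binary_matrix \<Rightarrow> bool" where
  "C1P_rows M \<longleftrightarrow>
     (\<exists>\<pi>. \<pi> permutes {..<dim_col M} \<and>
          (\<forall>i<dim_row M. consecutive {j. j < dim_col M \<and> M $$ (i, \<pi> j)}))"

definition C1P_cols :: "binary_matrix \<Rightarrow> bool" where
  "C1P_cols M \<longleftrightarrow>
     (\<exists>\<pi>. \<pi> permutes {..<dim_row M} \<and>
          (\<forall>j<dim_col M. consecutive {i. i < dim_row M \<and> M $$ (\<pi> i, j)}))"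

definition SC1P :: "binary_matrix \<Rightarrow> bool" where
  "SC1P M \<longleftrightarrow> C1P_rows M \<and> C1P_cols M"

definition zero_entries :: "binary_matrix \<Rightarrow> (nat \<times> nat) set" where
  "zero_entries M = {(i, j). i < dim_row M \<and> j < dim_col M \<and> \<not> M $$ (i, j)}"

definition flip_zeros :: "binary_matrix \<Rightarrow> (nat \<times> nat) set \<Rightarrow> binary_matrix" where
  "flip_zeros M F = mat (dim_row M) (dim_col M) (\<lambda>e. if e \<in> F then True else M $$ e)"

definition SC1P_by_zero_flips :: "binary_matrix \<Rightarrow> nat \<Rightarrow> bool" where
  "SC1P_by_zero_flips M k \<longleftrightarrow>
     (\<exists>F. F \<subseteq> zero_entries M \<and> card F \<le> k \<and> SC1P (flip_zeros M F))"

text \<open>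
  An instance is written as the two dimensions in unary, then the entries row by row, then \<open>k\<close> in
  binary with the least significant bit first and without leading zeros.
\<close>

definition unary :: "nat \<Rightarrow> bool list" where
  "unary n = replicate n True @ [False]"

definition binary :: "nat \<Rightarrow> bool list" where
  "binary k = map (bit k) [0..<floorlog 2 k]"

definition entry_list :: "binary_matrix \<Rightarrow> bool list" where
  "entry_list M = concat (map (\<lambda>i. map (\<lambda>j. M $$ (i, j)) [0..<dim_col M]) [0..<dim_row M])"

definition encode_instance :: "binary_matrix \<Rightarrow> nat \<Rightarrow> bool list" where
  "encode_instance M k = unary (dim_row M) @ unary (dim_col M) @ entry_list M @ binary k"

definition SC1P_zero_flipping :: language where
  "SC1P_zero_flipping = {encode_instance M k | M k. SC1P_by_zero_flips M k}"

lemma unary_append_inject: "unary m @ xs = unary n @ ys \<longleftrightarrow> m = n \<and> xs = ys"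
proof (induction m arbitrary: n)
  case 0
  show ?case by (cases n) (auto simp: unary_def)
next
  case (Suc m)
  show ?case
    using Suc[of "n - 1"] by (cases n) (auto simp: unary_def)
qed

lemma binary_inject: "binary k = binary l \<longleftrightarrow> k = l"
proof
  assume eq: "binary k = binary l"
  have bit_binary: "bit m n \<longleftrightarrow> n < length (binary m) \<and> binary m ! n" for m n
  proof (cases "n < floorlog 2 m")
    case True
    then show ?thesis by (simp add: binary_def)
  next
    case False
    have "m < 2 ^ floorlog 2 m"
      using floorlog_bounds[of m 2] by (cases "m = 0") auto
    also have "\<dots> \<le> 2 ^ n" using False by (intro power_increasing) auto
    finally show ?thesis using False by (simp add: binary_def bit_iff_odd)
  qed
  show "k = l" by (rule bit_eqI) (simp only: bit_binary eq)
qed simp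

lemma entry_list_inject:
  assumes "dim_row M = dim_row N" "dim_col M = dim_col N" "entry_list M = entry_list N"
  shows "M = N"
proof (rule eq_matI)
  let ?row = "\<lambda>A :: binary_matrix. \<lambda>i. map (\<lambda>j. A $$ (i, j)) [0..<dim_col A]"
  have "map (?row M) [0..<dim_row M] = map (?row N) [0..<dim_row N]"
    using assms(3) unfolding entry_list_def
    by (rule concat_injective) (auto simp: assms(1,2) set_zip)
  then show "M $$ (i, j) = N $$ (i, j)" if "i < dim_row N" "j < dim_col N" for i j
    using that by (auto simp: assms(1,2))
qed (use assms in auto)

text \<open>No two instances share an encoding.\<close>

lemma encode_instance_inject: "encode_instance M k = encode_instance N l \<longleftrightarrow> M = N \<and> k = l"
proof
  assume "encode_instance M k = encode_instance N l"
  then have dims: "dim_row M = dim_row N" "dim_col M = dim_col N"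
    and rest: "entry_list M @ binary k = entry_list N @ binary l"
    by (auto simp: encode_instance_def unary_append_inject)
  have "length (entry_list M) = length (entry_list N)"
    by (simp add: entry_list_def length_concat o_def dims)
  with rest show "M = N \<and> k = l"
    using entry_list_inject[OF dims] by (simp add: binary_inject)
qed simp

end

theory Submission
  imports Defs
begin

text \<open>
  Polynomial time. A counter is a tape on which only the head position matters. Programs with counters, a
  two-way input head and an output tape are compiled to Turing machines, and a language of natural number
  expressions with bounded sums, in which every value is polynomially bounded, is compiled to such programs.
  Hence a function is computable in polynomial time as soon as its output bits are given by such expressions.

  Membership. A certificate consists of two permutation matrices and of the flipped matrix with its rows and
  columns permuted. To compare a count with a budget given in binary, one only has to exclude that the bits
  of the budget are those of a smaller number.

  Hardness. An accepting run of a verifier is an independent set in a graph of local records, one for each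
  time and tape; a record contains the time of the previous visit to the cell under the head, so that all
  consistency conditions relate two records only. Given a graph, add many dummy vertices and take a column
  with ones at \<open>u\<close> and \<open>v\<close> for each ordered pair of vertices that are not adjacent, where \<open>u = v\<close> is allowed
  unless \<open>u\<close> is a dummy. Extending these columns to a nested family costs the number of pairs \<open>(q, i)\<close> such
  that column \<open>q\<close> is not contained in the \<open>i\<close>-th set of a chain. A set of size \<open>i\<close> contains
  \<open>i\<^sup>2 - i + |S| - e(S)\<close> columns, where \<open>S\<close> is its part in the graph and \<open>e(S)\<close> the number of ordered adjacent
  pairs in \<open>S\<close>; the dummies let the chain keep the best \<open>S\<close> almost all the time, and the maximum of
  \<open>|S| - e(S)\<close> is the independence number. Finally, \<open>k + 1\<close> copies of a row and of a column that prevent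
  two-sided extension turn the simultaneous consecutive ones property into nestedness.
\<close>

subsection \<open>Structured programs on tapes\<close>

text \<open>The obstacle in the hardness proof is that a nested family sees the graph only through a
  sum over a whole chain of sets, whereas independence concerns a single set. If an independent set
  of size \<open>c\<close> exists, the chain that collects it, then the dummies, then the remaining
  vertices gains \<open>c\<close> on \<open>N\<close> levels, at least 0 on the levels before, and
  loses at most \<open>n * n\<close> on each of the at most \<open>n\<close> levels after. Otherwise
  no level gains more than \<open>c - 1\<close>. The two totals are separated as soon as
  \<open>N + n > n ^ 3 + n * c\<close>, which explains the value of \<open>N\<close>. Everything
  produced by the reduction, the budget included, is polynomial in the input length; hence
  expressions can hold it as plain values and the matrix has room for \<open>k + 1\<close> copies.
  The budget of a given instance may be exponential, so the verifier cannot hold it as a value: it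
  is only compared with numbers below a difference of two counts of matrix entries. A condition on a
  single record becomes a conflict of the record with itself, so the conflict relation may contain
  loops, and independence forbids them.\<close>

datatype com =
    Basic "nat list \<Rightarrow> nat \<Rightarrow> action"
  | Seq com com
  | While "nat list \<Rightarrow> bool" com

abbreviation reads :: "tape list \<Rightarrow> nat list" where
  "reads ts \<equiv> map read_tape ts"

definition perform :: "(nat list \<Rightarrow> nat \<Rightarrow> action) \<Rightarrow> tape list \<Rightarrow> tape list" where
  "perform a ts = map2 apply_action (map (a (reads ts)) [0..<length ts]) ts"

fun cstep :: "com list \<times> tape list \<Rightarrow> com list \<times> tape list" where
  "cstep ([], ts) = ([], ts)"
| "cstep (Basic a # k, ts) = (k, perform a ts)"
| "cstep (Seq c1 c2 # k, ts) = (c1 # c2 # k, ts)"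
| "cstep (While p c # k, ts) = (if p (reads ts) then c # While p c # k else k, ts)"

text \<open>Covers all stacks that occur while \<open>c\<close> runs on top of \<open>k\<close>,
  except the final \<open>k\<close>. The body of a loop always runs on top of the same stack
  \<open>While p c # k\<close>, so stacks do not grow with the number of rounds and the set is
  finite.\<close>

fun stacks :: "com \<Rightarrow> com list \<Rightarrow> com list set" where
  "stacks (Basic a) k = {Basic a # k}"
| "stacks (Seq c1 c2) k = insert (Seq c1 c2 # k) (stacks c1 (c2 # k) \<union> stacks c2 k)"
| "stacks (While p c) k = insert (While p c # k) (stacks c (While p c # k))"

fun wf_com :: "com \<Rightarrow> bool" where
  "wf_com (Basic a) \<longleftrightarrow> (\<forall>ss i. set ss \<subseteq> {..<3} \<longrightarrow> i < length ss \<longrightarrow> fst (a ss i) < 3)"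
| "wf_com (Seq c1 c2) \<longleftrightarrow> wf_com c1 \<and> wf_com c2"
| "wf_com (While p c) \<longleftrightarrow> wf_com c"

lemma finite_stacks: "finite (stacks c k)"
  by (induction c arbitrary: k) auto

lemma stacks_self: "c # k \<in> stacks c k"
  by (cases c) auto

lemma stacks_closed:
  "st \<in> stacks c k \<Longrightarrow> fst (cstep (st, ts)) \<in> insert k (stacks c k)"
proof (induction c arbitrary: k)
  case (Seq c1 c2)
  from Seq.prems consider "st = Seq c1 c2 # k" | "st \<in> stacks c1 (c2 # k)" | "st \<in> stacks c2 k"
    by auto
  then show ?case
    using Seq.IH(1)[of "c2 # k"] Seq.IH(2)[of k] stacks_self[of c2 k] stacks_self[of c1 "c2 # k"]
    by cases auto
next
  case (While p c)
  from While.prems consider "st = While p c # k" | "st \<in> stacks c (While p c # k)"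
    by auto
  then show ?case
    using While.IH[of "While p c # k"] stacks_self[of c "While p c # k"]
    by cases auto
qed auto

lemma stacks_wf: "st \<in> stacks c k \<Longrightarrow> wf_com c \<Longrightarrow> list_all wf_com k \<Longrightarrow> list_all wf_com st"
  by (induction c arbitrary: k) auto

lemma perform_id: "perform (\<lambda>ss i. (ss ! i, Stay)) ts = ts"
proof -
  have "apply_action (read_tape t, Stay) t = t" for t
    by (simp add: apply_action_def read_tape_def)
  then show ?thesis
    unfolding perform_def by (intro nth_equalityI) auto
qed

lemma length_perform [simp]: "length (perform a ts) = length ts"
  by (simp add: perform_def)

text \<open>The states of the machine are the finitely many stacks of commands still to be executed.\<close>

lemma poly_time_computableI:
  assumes wf: "wf_com c" and n: "n \<ge> 1"
    and run: "\<And>xs. \<exists>ts. (cstep ^^ poly p (length xs))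
        ([c], (bits_on_tape xs, 0) # replicate (n - 1) (\<lambda>_. 0, 0)) = ([], ts) \<and>
        fst (last ts) = bits_on_tape (f xs)"
  shows "poly_time_computable f"
proof -
  define St where "St = insert [] (stacks c [])"
  have fin: "finite St" by (simp add: St_def finite_stacks)
  obtain idx where idx: "bij_betw idx St {0..<card St}"
    using ex_bij_betw_finite_nat[OF fin] by blast
  have closed: "fst (cstep (st, ts)) \<in> St" if "st \<in> St" for st ts
  proof (cases "st = []")
    case False
    then have "st \<in> stacks c []" using that by (simp add: St_def)
    from stacks_closed[OF this] show ?thesis by (simp add: St_def)
  qed (simp add: St_def)
  have cSt: "[c] \<in> St" using stacks_self[of c "[]"] by (simp add: St_def)
  have lt: "idx st < card St" if "st \<in> St" for st
    using bij_betwE[OF idx] that by auto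
  define dec where "dec = inv_into St idx"
  have dec: "dec (idx st) = st" if "st \<in> St" for st
    using idx that by (simp add: dec_def bij_betw_def)
  have decSt: "dec q \<in> St" if "q < card St" for q
    using idx that by (metis atLeastLessThan_iff bij_betw_def dec_def inv_into_into zero_le)
  \<comment> \<open>Commands that only rearrange the stack must leave the tapes alone; writing back
    the symbols just read is the idle action.\<close>
  define act where "act st = (case st of Basic a # k \<Rightarrow> a | _ \<Rightarrow> \<lambda>ss i. (ss ! i, Stay))" for st :: "com list"
  define nxt where "nxt st ss = (case st of [] \<Rightarrow> [] | Basic a # k \<Rightarrow> k | Seq c1 c2 # k \<Rightarrow> c1 # c2 # k
      | While p c # k \<Rightarrow> (if p ss then c # While p c # k else k))" for st and ss :: "nat list"
  have cs: "cstep (st, ts) = (nxt st (reads ts), perform (act st) ts)" for st ts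
    by (cases "(st, ts)" rule: cstep.cases) (auto simp: nxt_def act_def perform_id)
  define T where "T = \<lparr>num_tapes = n, num_symbols = 3, num_states = card St,
     start_state = idx [c], halt_state = idx [],
     transition = (\<lambda>q ss. (idx (nxt (dec q) ss), map (act (dec q) ss) [0..<length ss]))\<rparr>"
  have nxtSt: "nxt st ss \<in> St" if "st \<in> St" for st ss
  proof -
    \<comment> \<open>\<open>closed\<close> speaks about tapes, but the next stack depends only on
      the symbols read, and constant tapes realise every list of symbols.\<close>
    have "reads (map (\<lambda>s. (\<lambda>_. s, 0)) ss) = ss"
      by (simp add: read_tape_def o_def)
    then show ?thesis using closed[OF that] cs by (metis fst_conv)
  qed
  have "wf_tm T"
  proof -
    have wfst: "list_all wf_com st" if "st \<in> St" for st
      using that stacks_wf[of st c "[]"] wf by (auto simp: St_def)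
    have "fst (act st ss i) < 3" if "st \<in> St" "set ss \<subseteq> {..<3}" "i < length ss" for st ss i
    proof -
      have "ss ! i < 3" using that(2) nth_mem[OF that(3)] by auto
      then show ?thesis
        using wfst[OF that(1)] that(2,3) by (auto simp: act_def split: list.split com.split)
    qed
    then show ?thesis
      using n lt[OF cSt] lt[of "[]"] lt[OF nxtSt[OF decSt]] decSt
      by (auto simp: wf_tm_def T_def St_def)
  qed
  have idx_inj: "idx a = idx b \<longleftrightarrow> a = b" if "a \<in> St" "b \<in> St" for a b
    using that dec by metis
  have sim: "tm_step T (idx st, ts) = (idx (fst (cstep (st, ts))), snd (cstep (st, ts)))" if "st \<in> St" for st ts
  proof (cases "st = []")
    case True
    then show ?thesis by (simp add: tm_step_def T_def)
  next
    case False
    then have "idx st \<noteq> idx []" using that idx_inj by (simp add: St_def)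
    then show ?thesis
      by (simp add: tm_step_def T_def dec[OF that] cs perform_def)
  qed
  have sims: "(tm_step T ^^ t) (idx st, ts) = (idx (fst ((cstep ^^ t) (st, ts))), snd ((cstep ^^ t) (st, ts)))
      \<and> fst ((cstep ^^ t) (st, ts)) \<in> St" if "st \<in> St" for st ts t
  proof (induction t)
    case 0
    then show ?case using that by simp
  next
    case (Suc t)
    then show ?case using sim closed by simp (metis prod.collapse)
  qed
  have "outputs_within T xs (f xs) (poly p (length xs))" for xs
    using run[of xs] sims[OF cSt, of "poly p (length xs)" "(bits_on_tape xs, 0) # replicate (n - 1) (\<lambda>_. 0, 0)"]
    by (auto simp: outputs_within_def initial_config_def T_def Let_def)
  with \<open>wf_tm T\<close> show ?thesis
    unfolding poly_time_computable_def by blast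
qed

text \<open>The step count \<open>t\<close> is chosen before the continuation \<open>k\<close>: an
  execution takes the same course whatever waits below it on the stack, which is what makes it
  usable inside sequences and loops. \<open>T\<close> is only an upper bound for
  \<open>t\<close>.\<close>

definition exec :: "com \<Rightarrow> nat \<Rightarrow> tape list \<Rightarrow> tape list \<Rightarrow> bool" where
  "exec c T ts ts' \<longleftrightarrow> (\<exists>t\<le>T. \<forall>k. (cstep ^^ t) (c # k, ts) = (k, ts'))"

lemma exec_mono: "exec c T ts ts' \<Longrightarrow> T \<le> T' \<Longrightarrow> exec c T' ts ts'"
  unfolding exec_def by (meson le_trans)

lemma exec_Basic: "perform a ts = ts' \<Longrightarrow> exec (Basic a) 1 ts ts'"
  unfolding exec_def by (intro exI[of _ 1]) auto

lemma funpow_trans: "(f ^^ a) x = y \<Longrightarrow> (f ^^ b) y = z \<Longrightarrow> (f ^^ (a + b)) x = z"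
  by (subst add.commute) (simp add: funpow_add)

lemma exec_Seq:
  assumes "exec c1 T1 ts ts1" "exec c2 T2 ts1 ts2"
  shows "exec (Seq c1 c2) (T1 + T2 + 1) ts ts2"
proof -
  obtain t1 t2 where t: "t1 \<le> T1" "t2 \<le> T2" and
    1: "\<And>k. (cstep ^^ t1) (c1 # k, ts) = (k, ts1)" and 2: "\<And>k. (cstep ^^ t2) (c2 # k, ts1) = (k, ts2)"
    using assms unfolding exec_def by blast
  have "(cstep ^^ (1 + t1 + t2)) (Seq c1 c2 # k, ts) = (k, ts2)" for k
    by (rule funpow_trans[OF funpow_trans[OF _ 1] 2]) simp
  then show ?thesis
    unfolding exec_def using t by (intro exI[of _ "1 + t1 + t2"]) auto
qed

lemma exec_While_False: "\<not> p (reads ts) \<Longrightarrow> exec (While p c) 1 ts ts"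
  unfolding exec_def by (intro exI[of _ 1]) auto

lemma exec_While_True:
  assumes "p (reads ts)" "exec c T1 ts ts1" "exec (While p c) T2 ts1 ts2"
  shows "exec (While p c) (T1 + T2 + 1) ts ts2"
proof -
  obtain t1 t2 where t: "t1 \<le> T1" "t2 \<le> T2" and
    1: "\<And>k. (cstep ^^ t1) (c # k, ts) = (k, ts1)" and
    2: "\<And>k. (cstep ^^ t2) (While p c # k, ts1) = (k, ts2)"
    using assms unfolding exec_def by blast
  have "(cstep ^^ (1 + t1 + t2)) (While p c # k, ts) = (k, ts2)" for k
    by (rule funpow_trans[OF funpow_trans[OF _ 1] 2]) (simp add: assms(1))
  then show ?thesis
    unfolding exec_def using t by (intro exI[of _ "1 + t1 + t2"]) auto
qed

lemma exec_While_iterate: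
  assumes "\<And>i. i < n \<Longrightarrow> p (reads (\<sigma> i))" "\<not> p (reads (\<sigma> n))"
    and "\<And>i. i < n \<Longrightarrow> exec c T (\<sigma> i) (\<sigma> (Suc i))"
  shows "exec (While p c) (n * (T + 1) + 1) (\<sigma> 0) (\<sigma> n)"
  using assms
proof (induction n arbitrary: \<sigma>)
  case 0
  then show ?case using exec_While_False[of p "\<sigma> 0" c] by simp
next
  case (Suc n)
  have "exec (While p c) (n * (T + 1) + 1) (\<sigma> (Suc 0)) (\<sigma> (Suc n))"
    using Suc.prems by (intro Suc.IH[of "\<lambda>i. \<sigma> (Suc i)"]) auto
  from exec_While_True[OF Suc.prems(1)[of 0] Suc.prems(3)[of 0] this] show ?case
    by (simp add: algebra_simps)
qed

subsection \<open>Counters\<close>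

text \<open>A counter is a tape whose only nonblank cell is cell 0; its value is the position of the head.\<close>

definition cfg :: "nat \<Rightarrow> bool list \<Rightarrow> int \<Rightarrow> (nat \<Rightarrow> nat) \<Rightarrow> bool list \<Rightarrow> tape list" where
  "cfg r x p R out = (bits_on_tape x, p) #
     map (\<lambda>i. (\<lambda>q. if q = 0 then 1 else 0, int (R i))) [0..<r] @ [(bits_on_tape out, int (length out))]"

definition move_head :: "nat \<Rightarrow> (nat list \<Rightarrow> move) \<Rightarrow> com" where
  "move_head j m = Basic (\<lambda>ss i. (ss ! i, if i = j then m ss else Stay))"

text \<open>Tape 0 is the input, so counter \<open>j\<close> is tape \<open>Suc j\<close>.\<close>

definition inc :: "nat \<Rightarrow> com" where
  "inc j = move_head (Suc j) (\<lambda>_. Move_Right)"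

text \<open>Away from its marked cell a counter tape is blank, so reading 0 means that the value is
  positive. At value 0 the head stays, which makes the decrement truncated.\<close>

definition dec :: "nat \<Rightarrow> com" where
  "dec j = move_head (Suc j) (\<lambda>ss. if ss ! Suc j = 0 then Move_Left else Stay)"

definition inc_if_bit :: "nat \<Rightarrow> com" where
  "inc_if_bit j = move_head (Suc j) (\<lambda>ss. if ss ! 0 = 2 then Move_Right else Stay)"

definition input_left :: com where
  "input_left = move_head 0 (\<lambda>_. Move_Left)"

definition input_right :: com where
  "input_right = move_head 0 (\<lambda>_. Move_Right)"

definition write_nonzero :: "nat \<Rightarrow> com" where
  "write_nonzero j = Basic (\<lambda>ss i. if Suc i = length ss then (if ss ! Suc j = 0 then 2 else 1, Move_Right)
     else (ss ! i, Stay))"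

text \<open>A counter at zero has to see a nonblank symbol, but the tapes start out blank; this
  command runs once before everything else.\<close>

definition mark_counters :: com where
  "mark_counters = Basic (\<lambda>ss i. (if 0 < i \<and> Suc i < length ss then 1 else ss ! i, Stay))"

text \<open>The loop consumes its counter. The decrement precedes the body, so in round
  \<open>i\<close> of \<open>n\<close> the body finds the value \<open>n - Suc i\<close>
  there.\<close>

definition repeat_reg :: "nat \<Rightarrow> com \<Rightarrow> com" where
  "repeat_reg j c = While (\<lambda>ss. ss ! Suc j = 0) (Seq (dec j) c)"

definition clear :: "nat \<Rightarrow> com" where
  "clear j = While (\<lambda>ss. ss ! Suc j = 0) (dec j)"

lemma length_cfg [simp]: "length (cfg r x p R out) = Suc (Suc r)"
  by (simp add: cfg_def)

lemma cfg_nth_0: "cfg r x p R out ! 0 = (bits_on_tape x, p)"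
  by (simp add: cfg_def)

lemma cfg_nth_counter: "j < r \<Longrightarrow> cfg r x p R out ! Suc j = (\<lambda>q. if q = 0 then 1 else 0, int (R j))"
  by (simp add: cfg_def nth_append)

lemma cfg_nth_last: "cfg r x p R out ! Suc r = (bits_on_tape out, int (length out))"
  by (simp add: cfg_def nth_append)

lemmas cfg_nth = cfg_nth_0 cfg_nth_counter cfg_nth_last

lemma read_cfg_counter [simp]:
  "j < r \<Longrightarrow> read_tape (cfg r x p R out ! Suc j) = (if R j = 0 then 1 else 0)"
  by (simp add: cfg_nth read_tape_def)

lemma read_cfg_input [simp]: "read_tape (cfg r x p R out ! 0) = bits_on_tape x p"
  by (simp add: cfg_nth_0 read_tape_def)

lemma nth_perform: "i < length ts \<Longrightarrow> perform a ts ! i = apply_action (a (reads ts) i) (ts ! i)"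
  by (simp add: perform_def)

lemma cfg_eqI:
  assumes "length ts = Suc (Suc r)" "ts ! 0 = (bits_on_tape x, p)"
    and "\<And>j. j < r \<Longrightarrow> ts ! Suc j = (\<lambda>q. if q = 0 then 1 else 0, int (R j))"
    and "ts ! Suc r = (bits_on_tape out, int (length out))"
  shows "ts = cfg r x p R out"
proof (rule nth_equalityI)
  fix i assume i: "i < length ts"
  show "ts ! i = cfg r x p R out ! i"
  proof (cases i)
    case (Suc j)
    then show ?thesis using assms i by (cases "j = r") (auto simp: cfg_nth)
  qed (simp add: assms cfg_nth)
qed (simp add: assms)

lemma apply_rewrite: "s = read_tape t \<Longrightarrow> apply_action (s, m) t = (fst t, snd t + move_offset m)"
  by (simp add: apply_action_def read_tape_def)

lemma perform_move_counter:
  assumes "j < r" "int n = int (R j) + move_offset (m (reads (cfg r x p R out)))"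
  shows "perform (\<lambda>ss i. (ss ! i, if i = Suc j then m ss else Stay)) (cfg r x p R out) = cfg r x p (R(j := n)) out"
  using assms by (intro cfg_eqI) (auto simp: nth_perform apply_rewrite, auto simp: cfg_nth)

lemma perform_move_input:
  "perform (\<lambda>ss i. (ss ! i, if i = 0 then m ss else Stay)) (cfg r x p R out) =
     cfg r x (p + move_offset (m (reads (cfg r x p R out)))) R out"
  by (intro cfg_eqI) (auto simp: nth_perform apply_rewrite, auto simp: cfg_nth)

lemma exec_inc: "j < r \<Longrightarrow> exec (inc j) 1 (cfg r x p R out) (cfg r x p (R(j := Suc (R j))) out)"
  unfolding inc_def move_head_def by (intro exec_Basic perform_move_counter) auto

lemma exec_dec: "j < r \<Longrightarrow> exec (dec j) 1 (cfg r x p R out) (cfg r x p (R(j := R j - 1)) out)"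
  unfolding dec_def move_head_def by (intro exec_Basic perform_move_counter) auto

lemma exec_inc_if_bit:
  "j < r \<Longrightarrow> exec (inc_if_bit j) 1 (cfg r x (int p) R out)
     (cfg r x (int p) (R(j := R j + of_bool (p < length x \<and> x ! p))) out)"
  unfolding inc_if_bit_def move_head_def
  by (intro exec_Basic perform_move_counter) (auto simp: bits_on_tape_def)

lemma exec_input_left: "exec input_left 1 (cfg r x p R out) (cfg r x (p - 1) R out)"
  unfolding input_left_def move_head_def by (intro exec_Basic) (simp add: perform_move_input)

lemma exec_input_right: "exec input_right 1 (cfg r x p R out) (cfg r x (p + 1) R out)"
  unfolding input_right_def move_head_def by (intro exec_Basic) (simp add: perform_move_input)

lemma bits_on_tape_snoc:
  "(bits_on_tape out)(int (length out) := if b then 2 else 1) = bits_on_tape (out @ [b])"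
proof
  fix q
  show "((bits_on_tape out)(int (length out) := if b then 2 else 1)) q = bits_on_tape (out @ [b]) q"
  proof (cases "0 \<le> q \<and> q < int (length out)")
    case True
    then have "nat q < length out" by linarith
    with True show ?thesis by (simp add: bits_on_tape_def nth_append)
  qed (auto simp: bits_on_tape_def nth_append)
qed

lemma exec_write_nonzero:
  assumes "j < r"
  shows "exec (write_nonzero j) 1 (cfg r x p R out) (cfg r x p R (out @ [R j \<noteq> 0]))"
proof -
  have "apply_action (if R j \<noteq> 0 then 2 else 1, Move_Right) (cfg r x p R out ! Suc r) =
      (bits_on_tape (out @ [R j \<noteq> 0]), int (length (out @ [R j \<noteq> 0])))"
    unfolding cfg_nth_last apply_action_def by (simp add: bits_on_tape_snoc[symmetric])
  with assms show ?thesis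
    unfolding write_nonzero_def
    by (intro exec_Basic cfg_eqI) (auto simp: nth_perform apply_rewrite, auto simp: cfg_nth)
qed

text \<open>\<open>p\<close>, \<open>Rs\<close> and \<open>out\<close> give the input head, the
  counters and the output before each round. The entry of \<open>Rs i\<close> at \<open>j\<close> is
  overridden, because counter \<open>j\<close> itself is counting down.\<close>

lemma exec_repeat_reg:
  assumes "j < r"
    and "\<And>i. i < n \<Longrightarrow> exec c T (cfg r x (p i) ((Rs i)(j := n - Suc i)) (out i))
           (cfg r x (p (Suc i)) ((Rs (Suc i))(j := n - Suc i)) (out (Suc i)))"
  shows "exec (repeat_reg j c) (n * (T + 3) + 1) (cfg r x (p 0) ((Rs 0)(j := n)) (out 0))
    (cfg r x (p n) ((Rs n)(j := 0)) (out n))"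
proof -
  define \<sigma> where "\<sigma> i = cfg r x (p i) ((Rs i)(j := n - i)) (out i)" for i
  have body: "exec (Seq (dec j) c) (1 + T + 1) (\<sigma> i) (\<sigma> (Suc i))" if "i < n" for i
  proof -
    have "exec (dec j) 1 (\<sigma> i) (cfg r x (p i) ((Rs i)(j := n - Suc i)) (out i))"
      using exec_dec[OF assms(1), of x "p i" "(Rs i)(j := n - i)" "out i"] by (simp add: \<sigma>_def)
    from exec_Seq[OF this assms(2)[OF that]] show ?thesis by (simp add: \<sigma>_def)
  qed
  have "exec (While (\<lambda>ss. ss ! Suc j = 0) (Seq (dec j) c)) (n * ((1 + T + 1) + 1) + 1) (\<sigma> 0) (\<sigma> n)"
    by (rule exec_While_iterate) (use assms(1) body in \<open>auto simp: \<sigma>_def\<close>)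
  from exec_mono[OF this, of "n * (T + 3) + 1"] show ?thesis
    by (simp add: repeat_reg_def \<sigma>_def algebra_simps)
qed

lemma exec_clear:
  assumes "j < r"
  shows "exec (clear j) (R j * 2 + 1) (cfg r x p R out) (cfg r x p (R(j := 0)) out)"
proof -
  define \<sigma> where "\<sigma> i = cfg r x p (R(j := R j - i)) out" for i
  have body: "exec (dec j) 1 (\<sigma> i) (\<sigma> (Suc i))" for i
    using exec_dec[OF assms, of x p "R(j := R j - i)" out] by (simp add: \<sigma>_def)
  have "exec (While (\<lambda>ss. ss ! Suc j = 0) (dec j)) (R j * (1 + 1) + 1) (\<sigma> 0) (\<sigma> (R j))"
    by (rule exec_While_iterate) (use assms body in \<open>auto simp: \<sigma>_def\<close>)
  from exec_mono[OF this, of "R j * 2 + 1"] show ?thesis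
    by (simp add: clear_def \<sigma>_def)
qed

lemma exec_transfer:
  assumes "j < r" "k < r" "j \<noteq> k"
  shows "exec (repeat_reg j (inc k)) (R j * 4 + 1) (cfg r x p R out) (cfg r x p (R(j := 0, k := R k + R j)) out)"
proof -
  have "exec (repeat_reg j (inc k)) (R j * (1 + 3) + 1)
     (cfg r x p ((R(k := R k + 0))(j := R j)) out) (cfg r x p ((R(k := R k + R j))(j := 0)) out)"
  proof (rule exec_repeat_reg[where Rs = "\<lambda>i. R(k := R k + i)" and p = "\<lambda>_. p" and out = "\<lambda>_. out"])
    fix i
    have "(R(k := R k + i, j := R j - Suc i))(k := Suc ((R(k := R k + i, j := R j - Suc i)) k)) =
        R(k := R k + Suc i, j := R j - Suc i)"
      using assms(3) by (auto simp: fun_eq_iff)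
    with exec_inc[OF assms(2), of x p "R(k := R k + i, j := R j - Suc i)" out]
    show "exec (inc k) 1 (cfg r x p (R(k := R k + i, j := R j - Suc i)) out)
        (cfg r x p (R(k := R k + Suc i, j := R j - Suc i)) out)" by simp
  qed (rule assms(1))
  then show ?thesis using assms(3) by (simp add: fun_upd_twist)
qed

subsection \<open>Polynomially bounded functions\<close>

text \<open>The powers of \<open>B + 2\<close> replace polynomials: a base of at least 2 absorbs
  constants and sums into the exponent, and no coefficients have to be tracked under products and
  compositions.\<close>

definition pbounded :: "(nat \<Rightarrow> nat) \<Rightarrow> bool" where
  "pbounded f \<longleftrightarrow> (\<exists>D. \<forall>B. f B \<le> (B + 2) ^ D)"

lemma pboundedI: "(\<And>B. f B \<le> (B + 2) ^ D) \<Longrightarrow> pbounded f"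
  unfolding pbounded_def by blast

lemma pbounded_const: "pbounded (\<lambda>_. c)"
proof (rule pboundedI)
  show "c \<le> (B + 2) ^ c" for B
    using less_exp[of c] power_mono[of 2 "B + 2" c] by simp
qed

lemma pbounded_id: "pbounded (\<lambda>B. B)"
  by (rule pboundedI[of _ 1]) simp

lemma pbounded_add:
  assumes "pbounded f" "pbounded g" shows "pbounded (\<lambda>B. f B + g B)"
proof -
  obtain D E where D: "\<And>B. f B \<le> (B + 2) ^ D" and E: "\<And>B. g B \<le> (B + 2) ^ E"
    using assms unfolding pbounded_def by blast
  show ?thesis
  proof (rule pboundedI)
    fix B :: nat
    have "(B + 2) ^ D \<le> (B + 2) ^ (D + E)" "(B + 2) ^ E \<le> (B + 2) ^ (D + E)"
      by (intro power_increasing; simp)+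
    then have "f B + g B \<le> 2 * (B + 2) ^ (D + E)"
      using D[of B] E[of B] by linarith
    also have "\<dots> \<le> (B + 2) ^ (D + E + 1)" by simp
    finally show "f B + g B \<le> (B + 2) ^ (D + E + 1)" .
  qed
qed

lemma pbounded_mult:
  assumes "pbounded f" "pbounded g" shows "pbounded (\<lambda>B. f B * g B)"
proof -
  obtain D E where D: "\<And>B. f B \<le> (B + 2) ^ D" and E: "\<And>B. g B \<le> (B + 2) ^ E"
    using assms unfolding pbounded_def by blast
  show ?thesis
    by (rule pboundedI[of _ "D + E"]) (simp only: power_add, intro mult_mono D E; simp)
qed

lemma pbounded_compose:
  assumes "pbounded f" "pbounded g" shows "pbounded (\<lambda>B. f (g B))"
proof -
  obtain D E where D: "\<And>B. f B \<le> (B + 2) ^ D" and E: "\<And>B. g B \<le> (B + 2) ^ E"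
    using assms pbounded_add[OF assms(2) pbounded_const[of 2]] unfolding pbounded_def
    by blast
  obtain E' where E': "\<And>B. g B + 2 \<le> (B + 2) ^ E'"
    using pbounded_add[OF assms(2) pbounded_const[of 2]] unfolding pbounded_def by blast
  show ?thesis
  proof (rule pboundedI[of _ "E' * D"])
    fix B
    have "f (g B) \<le> (g B + 2) ^ D" by (rule D)
    also have "\<dots> \<le> ((B + 2) ^ E') ^ D" by (rule power_mono[OF E']) simp
    finally show "f (g B) \<le> (B + 2) ^ (E' * D)" by (simp add: power_mult)
  qed
qed

lemmas pbounded_intros = pbounded_const pbounded_id pbounded_add pbounded_mult pbounded_compose

subsection \<open>A language of bounded sums\<close>

text \<open>\<open>Call\<close> evaluates its body in a fresh environment that contains only the two
  arguments. Derived operations can therefore bind variables without capturing those of their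
  arguments.\<close>

datatype exp =
    Var nat
  | One
  | Len
  | Bit exp
  | Add exp exp
  | Sub exp exp
  | Sum nat exp exp
  | Call exp exp exp

fun eval :: "bool list \<Rightarrow> (nat \<Rightarrow> nat) \<Rightarrow> exp \<Rightarrow> nat" where
  "eval x s (Var v) = s v"
| "eval x s One = 1"
| "eval x s Len = length x"
| "eval x s (Bit e) = of_bool (eval x s e < length x \<and> x ! eval x s e)"
| "eval x s (Add a b) = eval x s a + eval x s b"
| "eval x s (Sub a b) = eval x s a - eval x s b"
| "eval x s (Sum v a b) = (\<Sum>i<eval x s a. eval x (s(v := i)) b)"
| "eval x s (Call f a b) = eval x (\<lambda>v. if v = 0 then eval x s a else if v = 1 then eval x s b else 0) f"

datatype gen = GOut exp | GSeq gen gen | GFor nat exp gen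

fun gout :: "bool list \<Rightarrow> (nat \<Rightarrow> nat) \<Rightarrow> gen \<Rightarrow> bool list" where
  "gout x s (GOut e) = [eval x s e \<noteq> 0]"
| "gout x s (GSeq g h) = gout x s g @ gout x s h"
| "gout x s (GFor v e g) = concat (map (\<lambda>i. gout x (s(v := i)) g) [0..<eval x s e])"

text \<open>
  In \<open>comp e \<rho> d\<close> the variable \<open>v\<close> is held by counter \<open>\<rho> v\<close>, the counters from \<open>d\<close> on are free and
  zero, and counter \<open>d\<close> receives the value.
\<close>

fun comp :: "exp \<Rightarrow> (nat \<Rightarrow> nat) \<Rightarrow> nat \<Rightarrow> com" where
  "comp (Var v) \<rho> d = Seq (repeat_reg (\<rho> v) (Seq (inc d) (inc (Suc d)))) (repeat_reg (Suc d) (inc (\<rho> v)))"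
| "comp One \<rho> d = inc d"
| "comp Len \<rho> d = Seq (While (\<lambda>ss. ss ! 0 \<noteq> 0) (Seq input_right (Seq (inc d) (inc (Suc d)))))
     (repeat_reg (Suc d) input_left)"
| "comp (Bit e) \<rho> d = Seq (comp e \<rho> (d + 1)) (Seq (repeat_reg (d + 1) (Seq input_right (inc (d + 2))))
     (Seq (inc_if_bit d) (repeat_reg (d + 2) input_left)))"
| "comp (Add a b) \<rho> d = Seq (comp a \<rho> d) (Seq (comp b \<rho> (d + 1)) (repeat_reg (d + 1) (inc d)))"
| "comp (Sub a b) \<rho> d = Seq (comp a \<rho> d) (Seq (comp b \<rho> (d + 1)) (repeat_reg (d + 1) (dec d)))"
| "comp (Sum v a b) \<rho> d = Seq (comp a \<rho> (d + 1)) (Seq (repeat_reg (d + 1)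
     (Seq (comp b (\<rho>(v := d + 2)) (d + 3)) (Seq (repeat_reg (d + 3) (inc d)) (inc (d + 2))))) (clear (d + 2)))"
| "comp (Call f a b) \<rho> d = Seq (comp a \<rho> (d + 1)) (Seq (comp b \<rho> (d + 2))
     (Seq (comp f (\<lambda>v. if v = 0 then d + 1 else if v = 1 then d + 2 else d + 3) (d + 4))
     (Seq (repeat_reg (d + 4) (inc d)) (Seq (clear (d + 1)) (clear (d + 2))))))"

text \<open>Bounds how many counters from \<open>d\<close> on the compiled code touches. Sums are
  taken where maxima would do, which keeps the side conditions linear.\<close>

fun width :: "exp \<Rightarrow> nat" where
  "width (Var v) = 2"
| "width One = 1"
| "width Len = 2"
| "width (Bit e) = width e + 3"
| "width (Add a b) = width a + width b + 2"
| "width (Sub a b) = width a + width b + 2"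
| "width (Sum v a b) = width a + width b + 4"
| "width (Call f a b) = width f + width a + width b + 5"

definition value_bound :: "exp \<Rightarrow> (nat \<Rightarrow> nat) \<Rightarrow> bool" where
  "value_bound e V \<longleftrightarrow> (\<forall>x s B. length x \<le> B \<longrightarrow> (\<forall>v. s v \<le> B) \<longrightarrow> eval x s e \<le> V B)"

lemma value_boundD:
  "value_bound e V \<Longrightarrow> length x \<le> B \<Longrightarrow> (\<And>v. s v \<le> B) \<Longrightarrow> eval x s e \<le> V B"
  by (simp add: value_bound_def)

lemma value_boundI:
  "(\<And>x s B. length x \<le> B \<Longrightarrow> (\<And>v. s v \<le> B) \<Longrightarrow> eval x s e \<le> V B) \<Longrightarrow> value_bound e V"
  by (simp add: value_bound_def)

lemma ex_value_bound: "\<exists>V. pbounded V \<and> value_bound e V"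
proof (induction e)
  case (Var v)
  have "value_bound (Var v) (\<lambda>B. B)" by (simp add: value_bound_def)
  then show ?case using pbounded_id by blast
next
  case One
  have "value_bound One (\<lambda>B. 1)" by (simp add: value_bound_def)
  then show ?case using pbounded_const by blast
next
  case Len
  have "value_bound Len (\<lambda>B. B)" by (simp add: value_bound_def)
  then show ?case using pbounded_id by blast
next
  case (Bit e)
  have "value_bound (Bit e) (\<lambda>B. 1)" by (simp add: value_bound_def)
  then show ?case using pbounded_const by blast
next
  case (Add a b)
  then obtain V W where p: "pbounded V" "pbounded W" and V: "value_bound a V" and W: "value_bound b W" by blast
  have "value_bound (Add a b) (\<lambda>B. V B + W B)"
    using V W by (simp add: value_bound_def add_mono)
  then show ?case using pbounded_add[OF p] by blast
next
  case (Sub a b)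
  then obtain V where p: "pbounded V" and V: "value_bound a V" by blast
  have "value_bound (Sub a b) V"
  proof (rule value_boundI)
    fix x :: "bool list" and s :: "nat \<Rightarrow> nat" and B
    assume *: "length x \<le> B" "\<And>v. s v \<le> B"
    have "eval x s (Sub a b) \<le> eval x s a" by simp
    also have "\<dots> \<le> V B" using * by (intro value_boundD[OF V])
    finally show "eval x s (Sub a b) \<le> V B" .
  qed
  then show ?case using p by blast
next
  case (Sum v a b)
  then obtain V W where p: "pbounded V" "pbounded W" and V: "value_bound a V" and W: "value_bound b W" by blast
  \<comment> \<open>The bound variable stays below \<open>V B\<close>, so the body is evaluated in
    an environment bounded by \<open>V B + B\<close>.\<close>
  have "value_bound (Sum v a b) (\<lambda>B. V B * W (V B + B))"
  proof (rule value_boundI)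
    fix x :: "bool list" and s :: "nat \<Rightarrow> nat" and B
    assume *: "length x \<le> B" "\<And>v. s v \<le> B"
    have V': "eval x s a \<le> V B" using * by (intro value_boundD[OF V])
    have "eval x (s(v := i)) b \<le> W (V B + B)" if "i < eval x s a" for i
      using * V' that by (intro value_boundD[OF W]) (auto intro: trans_le_add2)
    then have "eval x s (Sum v a b) \<le> eval x s a * W (V B + B)"
      using sum_bounded_above[of "{..<eval x s a}" "\<lambda>i. eval x (s(v := i)) b" "W (V B + B)"] by simp
    also have "\<dots> \<le> V B * W (V B + B)" using V' by simp
    finally show "eval x s (Sum v a b) \<le> V B * W (V B + B)" .
  qed
  moreover have "pbounded (\<lambda>B. V B * W (V B + B))"
    by (intro pbounded_mult p pbounded_compose[OF p(2)] pbounded_add pbounded_id)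
  ultimately show ?case by blast
next
  case (Call f a b)
  then obtain U V W where p: "pbounded U" "pbounded V" "pbounded W" and
    U: "value_bound f U" and V: "value_bound a V" and W: "value_bound b W" by blast
  have "value_bound (Call f a b) (\<lambda>B. U (V B + W B + B))"
  proof (rule value_boundI)
    fix x :: "bool list" and s :: "nat \<Rightarrow> nat" and B
    assume *: "length x \<le> B" "\<And>v. s v \<le> B"
    show "eval x s (Call f a b) \<le> U (V B + W B + B)"
      using * value_boundD[OF V, of x B s] value_boundD[OF W, of x B s]
      unfolding eval.simps by (intro value_boundD[OF U]) auto
  qed
  moreover have "pbounded (\<lambda>B. U (V B + W B + B))"
    by (intro pbounded_compose[OF p(1)] pbounded_add p pbounded_id)
  ultimately show ?case by blast
qed

section \<open>Correctness and running time of compiled expressions\<close>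

definition holds_env :: "(nat \<Rightarrow> nat) \<Rightarrow> (nat \<Rightarrow> nat) \<Rightarrow> (nat \<Rightarrow> nat) \<Rightarrow> nat \<Rightarrow> bool" where
  "holds_env s R \<rho> d \<longleftrightarrow> (\<forall>v. R (\<rho> v) = s v \<and> \<rho> v < d) \<and> (\<forall>j\<ge>d. R j = 0)"

text \<open>Only counter \<open>d\<close> differs at the end: the input head is back at cell 0 and
  all scratch counters are zero again. This is what allows evaluations to be nested. A single number
  \<open>B\<close> bounds the input length and all variables, so the time is a function of
  \<open>B\<close> alone.\<close>

definition computes :: "exp \<Rightarrow> (nat \<Rightarrow> nat) \<Rightarrow> bool" where
  "computes e T \<longleftrightarrow> (\<forall>x s R out \<rho> d r B. length x \<le> B \<longrightarrow> (\<forall>v. s v \<le> B) \<longrightarrow> holds_env s R \<rho> d \<longrightarrow>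
     d + width e \<le> r \<longrightarrow> exec (comp e \<rho> d) (T B) (cfg r x 0 R out) (cfg r x 0 (R(d := eval x s e)) out))"

lemma computesD:
  "computes e T \<Longrightarrow> length x \<le> B \<Longrightarrow> (\<And>v. s v \<le> B) \<Longrightarrow> holds_env s R \<rho> d \<Longrightarrow> d + width e \<le> r \<Longrightarrow>
     R' = R(d := eval x s e) \<Longrightarrow> exec (comp e \<rho> d) (T B) (cfg r x 0 R out) (cfg r x 0 R' out)"
  unfolding computes_def by simp

lemma exec_transfer':
  assumes "j < r" "k < r" "j \<noteq> k" "R j \<le> n" "R' = R(j := 0, k := R k + R j)"
  shows "exec (repeat_reg j (inc k)) (n * 4 + 1) (cfg r x p R out) (cfg r x p R' out)"
  unfolding assms(5) by (rule exec_mono[OF exec_transfer[OF assms(1-3)]]) (use assms(4) in simp)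

lemma exec_clear':
  assumes "j < r" "R j \<le> n" "R' = R(j := 0)"
  shows "exec (clear j) (n * 2 + 1) (cfg r x p R out) (cfg r x p R' out)"
  unfolding assms(3) by (rule exec_mono[OF exec_clear[OF assms(1)]]) (use assms(2) in simp)

lemma exec_inc':
  assumes "j < r" "R' = R(j := Suc (R j))"
  shows "exec (inc j) 1 (cfg r x p R out) (cfg r x p R' out)"
  unfolding assms(2) by (rule exec_inc[OF assms(1)])

lemma exec_dec':
  assumes "j < r" "R' = R(j := R j - 1)"
  shows "exec (dec j) 1 (cfg r x p R out) (cfg r x p R' out)"
  unfolding assms(2) by (rule exec_dec[OF assms(1)])

lemma exec_input_right': "q = p + 1 \<Longrightarrow> exec input_right 1 (cfg r x p R out) (cfg r x q R out)"
  using exec_input_right by simp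

lemma exec_input_left': "q = p - 1 \<Longrightarrow> exec input_left 1 (cfg r x p R out) (cfg r x q R out)"
  using exec_input_left by simp

lemma exec_repeat_reg':
  assumes "j < r" "n \<le> N" "R = (Rs 0)(j := n)" "R' = (Rs n)(j := 0)" "q = p 0" "q' = p n"
    and "o1 = out 0" "o2 = out n"
    and "\<And>i. i < n \<Longrightarrow> exec c T (cfg r x (p i) ((Rs i)(j := n - Suc i)) (out i))
           (cfg r x (p (Suc i)) ((Rs (Suc i))(j := n - Suc i)) (out (Suc i)))"
  shows "exec (repeat_reg j c) (N * (T + 3) + 1) (cfg r x q R o1) (cfg r x q' R' o2)"
proof -
  have "n * (T + 3) + 1 \<le> N * (T + 3) + 1" using assms(2) by simp
  from exec_mono[OF exec_repeat_reg[OF assms(1,9)] this] show ?thesis unfolding assms(3-8) .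
qed

text \<open>Reading a counter destroys it. The value is moved to \<open>d\<close> and
  \<open>d + 1\<close> simultaneously, and then restored from \<open>d + 1\<close>.\<close>

lemma computes_Var: "computes (Var v) (\<lambda>B. (B * ((1 + 1 + 1) + 3) + 1) + (B * 4 + 1) + 1)"
  unfolding computes_def comp.simps
proof (intro allI impI exec_Seq)
  fix x s R out \<rho> d r B
  assume B: "\<forall>v. s v \<le> B" and R: "holds_env s R \<rho> d" and r: "d + width (Var v) \<le> r"
  have \<rho>: "R (\<rho> v) = s v" "\<rho> v < d" "R d = 0" "R (Suc d) = 0" using R by (auto simp: holds_env_def)
  let ?Rs = "\<lambda>i. R(d := i, Suc d := i)"
  show "exec (repeat_reg (\<rho> v) (Seq (inc d) (inc (Suc d)))) (B * ((1 + 1 + 1) + 3) + 1)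
     (cfg r x 0 R out) (cfg r x 0 ((?Rs (s v))(\<rho> v := 0)) out)"
  proof (rule exec_repeat_reg'[where n = "s v" and Rs = ?Rs and p = "\<lambda>_. 0" and out = "\<lambda>_. out"])
    fix i
    show "exec (Seq (inc d) (inc (Suc d))) (1 + 1 + 1) (cfg r x 0 ((?Rs i)(\<rho> v := s v - Suc i)) out)
       (cfg r x 0 ((?Rs (Suc i))(\<rho> v := s v - Suc i)) out)"
      by (rule exec_Seq[OF exec_inc exec_inc']) (use r \<rho> in \<open>auto simp: fun_eq_iff\<close>)
  qed (use B r \<rho> in \<open>auto simp: fun_eq_iff\<close>)
  show "exec (repeat_reg (Suc d) (inc (\<rho> v))) (B * 4 + 1) (cfg r x 0 ((?Rs (s v))(\<rho> v := 0)) out)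
     (cfg r x 0 (R(d := eval x s (Var v))) out)"
    by (rule exec_transfer') (use B r \<rho> in \<open>auto simp: fun_eq_iff\<close>)
qed

lemma computes_One: "computes One (\<lambda>B. 1)"
  unfolding computes_def comp.simps
  by (auto intro!: exec_inc'[simplified] simp: holds_env_def)

text \<open>The head walks to the first blank while two counters count the steps; one is the result,
  the other drives the head back to cell 0.\<close>

lemma computes_Len: "computes Len (\<lambda>B. (B * ((1 + (1 + 1 + 1) + 1) + 1) + 1) + (B * (1 + 3) + 1) + 1)"
  unfolding computes_def comp.simps
proof (intro allI impI exec_Seq)
  fix x s R out \<rho> d r B
  assume B: "length (x :: bool list) \<le> B" and R: "holds_env s R \<rho> d" and r: "d + width Len \<le> r"
  have R0: "R d = 0" "R (Suc d) = 0" using R by (auto simp: holds_env_def)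
  let ?Rs = "\<lambda>i. R(d := i, Suc d := i)"
  define \<sigma> where "\<sigma> i = cfg r x (int i) (?Rs i) out" for i
  have "exec (While (\<lambda>ss. ss ! 0 \<noteq> 0) (Seq input_right (Seq (inc d) (inc (Suc d)))))
     (length x * ((1 + (1 + 1 + 1) + 1) + 1) + 1) (\<sigma> 0) (\<sigma> (length x))"
  proof (rule exec_While_iterate)
    fix i
    show "exec (Seq input_right (Seq (inc d) (inc (Suc d)))) (1 + (1 + 1 + 1) + 1) (\<sigma> i) (\<sigma> (Suc i))"
      unfolding \<sigma>_def
    proof (intro exec_Seq)
      show "exec input_right 1 (cfg r x (int i) (?Rs i) out) (cfg r x (int (Suc i)) (?Rs i) out)"
        by (rule exec_input_right') simp
      show "exec (inc d) 1 (cfg r x (int (Suc i)) (?Rs i) out)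
          (cfg r x (int (Suc i)) (R(d := Suc i, Suc d := i)) out)"
        by (rule exec_inc') (use r in \<open>simp_all add: fun_eq_iff\<close>)
      show "exec (inc (Suc d)) 1 (cfg r x (int (Suc i)) (R(d := Suc i, Suc d := i)) out)
          (cfg r x (int (Suc i)) (?Rs (Suc i)) out)"
        by (rule exec_inc') (use r in simp_all)
    qed
  qed (simp_all add: \<sigma>_def bits_on_tape_def)
  then have "exec (While (\<lambda>ss. ss ! 0 \<noteq> 0) (Seq input_right (Seq (inc d) (inc (Suc d)))))
     (B * ((1 + (1 + 1 + 1) + 1) + 1) + 1) (\<sigma> 0) (\<sigma> (length x))"
    by (rule exec_mono) (use B in simp)
  moreover have "R(d := 0, Suc d := 0) = R"
    using R0 by (simp add: fun_eq_iff)
  then have "\<sigma> 0 = cfg r x 0 R out"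
    by (simp add: \<sigma>_def)
  ultimately show "exec (While (\<lambda>ss. ss ! 0 \<noteq> 0) (Seq input_right (Seq (inc d) (inc (Suc d)))))
     (B * ((1 + (1 + 1 + 1) + 1) + 1) + 1) (cfg r x 0 R out)
     (cfg r x (int (length x)) (?Rs (length x)) out)" by (simp add: \<sigma>_def)
  show "exec (repeat_reg (Suc d) input_left) (B * (1 + 3) + 1) (cfg r x (int (length x)) (?Rs (length x)) out)
     (cfg r x 0 (R(d := eval x s Len)) out)"
  proof (rule exec_repeat_reg'[where n = "length x" and Rs = "\<lambda>_. R(d := length x)"
      and p = "\<lambda>i. int (length x) - int i" and out = "\<lambda>_. out"])
    fix i
    show "exec input_left 1 (cfg r x (int (length x) - int i) (R(d := length x, Suc d := length x - Suc i)) out)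
       (cfg r x (int (length x) - int (Suc i)) (R(d := length x, Suc d := length x - Suc i)) out)"
      using exec_input_left[of r x "int (length x) - int i"] by (simp add: algebra_simps)
  qed (use B r R0 in \<open>auto simp: fun_eq_iff\<close>)
qed

lemma exec_inc_if_bit':
  assumes "j < r" "R' = R(j := R j + of_bool (p < length x \<and> x ! p))" "q = int p"
  shows "exec (inc_if_bit j) 1 (cfg r x q R out) (cfg r x q R' out)"
  unfolding assms(2,3) by (rule exec_inc_if_bit[OF assms(1)])

lemma holds_envI:
  assumes "holds_env s R \<rho> d" "d \<le> d'" "\<And>j. j < d \<Longrightarrow> R' j = R j" "\<And>j. d' \<le> j \<Longrightarrow> R' j = 0"
  shows "holds_env s R' \<rho> d'"
  using assms unfolding holds_env_def by (metis order_less_le_trans)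

lemma holds_env_bind:
  assumes "holds_env s R \<rho> d" "R' k = i" "k < d'" "d \<le> d'" "\<And>j. j < d \<Longrightarrow> R' j = R j" "\<And>j. d' \<le> j \<Longrightarrow> R' j = 0"
  shows "holds_env (s(v := i)) R' (\<rho>(v := k)) d'"
  using assms unfolding holds_env_def by (auto intro: order_less_le_trans)

text \<open>The index drives the head to the right while \<open>d + 2\<close> remembers the way
  back. Beyond the input the head reads a blank, which gives the value 0 demanded by
  \<open>eval\<close>.\<close>

lemma computes_Bit:
  assumes "computes e T" and V': "value_bound e V"
  shows "computes (Bit e) (\<lambda>B. T B + ((V B * ((1 + 1 + 1) + 3) + 1) + (1 + (V B * (1 + 3) + 1) + 1) + 1) + 1)"
  unfolding computes_def comp.simps
proof (intro allI impI exec_Seq)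
  note V = value_boundD[OF V']
  fix x :: "bool list" and s R out \<rho> d r B
  assume B: "length x \<le> B" "\<forall>v. s v \<le> B" and R: "holds_env s R \<rho> d" and r: "d + width (Bit e) \<le> r"
  have Rd: "R d = 0" "R (d + 1) = 0" "R (d + 2) = 0" using R by (auto simp: holds_env_def)
  define n where "n = eval x s e"
  have n: "n \<le> V B" using V[of x B s] B by (simp add: n_def)
  show "exec (comp e \<rho> (d + 1)) (T B) (cfg r x 0 R out) (cfg r x 0 (R(d + 1 := n)) out)"
    by (rule computesD[OF assms(1) B(1)]) (use B r R in \<open>auto simp: n_def holds_env_def less_SucI\<close>)
  show "exec (repeat_reg (d + 1) (Seq input_right (inc (d + 2)))) (V B * ((1 + 1 + 1) + 3) + 1)
     (cfg r x 0 (R(d + 1 := n)) out) (cfg r x (int n) (R(d + 2 := n)) out)"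
  proof (rule exec_repeat_reg'[where n = n and Rs = "\<lambda>i. R(d + 2 := i)" and p = int and out = "\<lambda>_. out"])
    fix i
    show "exec (Seq input_right (inc (d + 2))) (1 + 1 + 1)
      (cfg r x (int i) (R(d + 2 := i, d + 1 := n - Suc i)) out)
      (cfg r x (int (Suc i)) (R(d + 2 := Suc i, d + 1 := n - Suc i)) out)"
      by (rule exec_Seq[OF exec_input_right' exec_inc']) (use r Rd in \<open>simp_all add: fun_eq_iff\<close>)
  qed (use r Rd n in \<open>simp_all add: fun_eq_iff\<close>)
  show "exec (inc_if_bit d) 1 (cfg r x (int n) (R(d + 2 := n)) out)
     (cfg r x (int n) (R(d := eval x s (Bit e), d + 2 := n)) out)"
    by (rule exec_inc_if_bit'[where p = n]) (use r Rd in \<open>simp_all add: fun_eq_iff n_def\<close>)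
  show "exec (repeat_reg (d + 2) input_left) (V B * (1 + 3) + 1)
     (cfg r x (int n) (R(d := eval x s (Bit e), d + 2 := n)) out) (cfg r x 0 (R(d := eval x s (Bit e))) out)"
  proof (rule exec_repeat_reg'[where n = n and Rs = "\<lambda>i. R(d := eval x s (Bit e))" and p = "\<lambda>i. int n - int i"
        and out = "\<lambda>_. out"])
    fix i
    show "exec input_left 1 (cfg r x (int n - int i) (R(d := eval x s (Bit e), d + 2 := n - Suc i)) out)
      (cfg r x (int n - int (Suc i)) (R(d := eval x s (Bit e), d + 2 := n - Suc i)) out)"
      by (rule exec_input_left') simp
  qed (use r Rd n in \<open>simp_all add: fun_eq_iff\<close>)
qed

lemma computes_Add:
  assumes "computes a T" "computes b U"
    and V': "value_bound b V"
  shows "computes (Add a b) (\<lambda>B. T B + (U B + (V B * 4 + 1) + 1) + 1)"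
  unfolding computes_def comp.simps
proof (intro allI impI exec_Seq)
  note V = value_boundD[OF V']
  fix x :: "bool list" and s R out \<rho> d r B
  assume B: "length x \<le> B" "\<forall>v. s v \<le> B" and R: "holds_env s R \<rho> d" and r: "d + width (Add a b) \<le> r"
  have Rd: "R d = 0" "R (d + 1) = 0" using R by (auto simp: holds_env_def)
  show "exec (comp a \<rho> d) (T B) (cfg r x 0 R out) (cfg r x 0 (R(d := eval x s a)) out)"
    by (rule computesD[OF assms(1) B(1)]) (use B r R in auto)
  show "exec (comp b \<rho> (d + 1)) (U B) (cfg r x 0 (R(d := eval x s a)) out)
     (cfg r x 0 (R(d := eval x s a, d + 1 := eval x s b)) out)"
  proof (rule computesD[OF assms(2) B(1)])
    show "holds_env s (R(d := eval x s a)) \<rho> (d + 1)"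
      by (rule holds_envI[OF R]) (use R in \<open>auto simp: holds_env_def\<close>)
  qed (use B r in auto)
  show "exec (repeat_reg (d + 1) (inc d)) (V B * 4 + 1)
     (cfg r x 0 (R(d := eval x s a, d + 1 := eval x s b)) out) (cfg r x 0 (R(d := eval x s (Add a b))) out)"
    by (rule exec_transfer') (use V[OF B(1)] B(2) r Rd in \<open>auto simp: fun_eq_iff\<close>)
qed

text \<open>Repeated decrements stop at zero, so they implement the truncated subtraction of natural
  numbers.\<close>

lemma computes_Sub:
  assumes "computes a T" "computes b U"
    and V': "value_bound b V"
  shows "computes (Sub a b) (\<lambda>B. T B + (U B + (V B * (1 + 3) + 1) + 1) + 1)"
  unfolding computes_def comp.simps
proof (intro allI impI exec_Seq)
  note V = value_boundD[OF V']
  fix x :: "bool list" and s R out \<rho> d r B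
  assume B: "length x \<le> B" "\<forall>v. s v \<le> B" and R: "holds_env s R \<rho> d" and r: "d + width (Sub a b) \<le> r"
  have Rd: "R d = 0" "R (d + 1) = 0" using R by (auto simp: holds_env_def)
  define n where "n = eval x s b"
  have n: "n \<le> V B" using V[of x B s] B by (simp add: n_def)
  show "exec (comp a \<rho> d) (T B) (cfg r x 0 R out) (cfg r x 0 (R(d := eval x s a)) out)"
    by (rule computesD[OF assms(1) B(1)]) (use B r R in auto)
  show "exec (comp b \<rho> (d + 1)) (U B) (cfg r x 0 (R(d := eval x s a)) out)
     (cfg r x 0 (R(d := eval x s a, d + 1 := n)) out)"
    unfolding n_def
  proof (rule computesD[OF assms(2) B(1)])
    show "holds_env s (R(d := eval x s a)) \<rho> (d + 1)"
      by (rule holds_envI[OF R]) (use R in \<open>auto simp: holds_env_def\<close>)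
  qed (use B r in auto)
  show "exec (repeat_reg (d + 1) (dec d)) (V B * (1 + 3) + 1)
     (cfg r x 0 (R(d := eval x s a, d + 1 := n)) out) (cfg r x 0 (R(d := eval x s (Sub a b))) out)"
  proof (rule exec_repeat_reg'[where n = n and Rs = "\<lambda>i. R(d := eval x s a - i)" and p = "\<lambda>i. 0"
        and out = "\<lambda>_. out"])
    fix i
    show "exec (dec d) 1 (cfg r x 0 (R(d := eval x s a - i, d + 1 := n - Suc i)) out)
      (cfg r x 0 (R(d := eval x s a - Suc i, d + 1 := n - Suc i)) out)"
      by (rule exec_dec') (use r in \<open>simp_all add: fun_eq_iff\<close>)
  qed (use r Rd n in \<open>simp_all add: fun_eq_iff n_def\<close>)
qed

text \<open>Counter \<open>d\<close> accumulates, \<open>d + 1\<close> counts the remaining rounds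
  down, and \<open>d + 2\<close> counts up and serves as the bound variable; the body is evaluated
  in \<open>d + 3\<close>.\<close>

lemma computes_Sum:
  assumes "computes a T" "computes b U"
    and V': "value_bound a V"
    and W': "value_bound b W"
  shows "computes (Sum v a b) (\<lambda>B. T B + ((V B * ((U (V B + B) + ((W (V B + B) * 4 + 1) + 1 + 1) + 1) + 3) + 1)
    + (V B * 2 + 1) + 1) + 1)"
  unfolding computes_def comp.simps
proof (intro allI impI exec_Seq)
  note V = value_boundD[OF V']
  note W = value_boundD[OF W']
  fix x :: "bool list" and s R out \<rho> d r B
  assume B: "length x \<le> B" "\<forall>v. s v \<le> B" and R: "holds_env s R \<rho> d" and r: "d + width (Sum v a b) \<le> r"
  have Rd: "R d = 0" "R (d + 1) = 0" "R (d + 2) = 0" "R (d + 3) = 0" using R by (auto simp: holds_env_def)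
  define n where "n = eval x s a"
  have n: "n \<le> V B" using V[of x B s] B by (simp add: n_def)
  define S where "S m = (\<Sum>i<m. eval x (s(v := i)) b)" for m
  show "exec (comp a \<rho> (d + 1)) (T B) (cfg r x 0 R out) (cfg r x 0 (R(d + 1 := n)) out)"
    by (rule computesD[OF assms(1) B(1)]) (use B r R in \<open>auto simp: n_def holds_env_def less_SucI\<close>)
  show "exec (repeat_reg (d + 1) (Seq (comp b (\<rho>(v := d + 2)) (d + 3)) (Seq (repeat_reg (d + 3) (inc d)) (inc (d + 2)))))
     (V B * ((U (V B + B) + ((W (V B + B) * 4 + 1) + 1 + 1) + 1) + 3) + 1)
     (cfg r x 0 (R(d + 1 := n)) out) (cfg r x 0 (R(d := S n, d + 2 := n)) out)"
  proof (rule exec_repeat_reg'[where n = n and Rs = "\<lambda>i. R(d := S i, d + 2 := i)" and p = "\<lambda>i. 0"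
        and out = "\<lambda>_. out"])
    fix i assume i: "i < n"
    let ?R = "R(d := S i, d + 2 := i, d + 1 := n - Suc i)"
    let ?y = "eval x (s(v := i)) b"
    have B': "length x \<le> V B + B" "(s(v := i)) w \<le> V B + B" for w :: nat
      using B i n by (auto intro: trans_le_add2)
    show "exec (Seq (comp b (\<rho>(v := d + 2)) (d + 3)) (Seq (repeat_reg (d + 3) (inc d)) (inc (d + 2))))
       (U (V B + B) + ((W (V B + B) * 4 + 1) + 1 + 1) + 1)
       (cfg r x 0 ?R out) (cfg r x 0 (R(d := S (Suc i), d + 2 := Suc i, d + 1 := n - Suc i)) out)"
    proof (intro exec_Seq)
      show "exec (comp b (\<rho>(v := d + 2)) (d + 3)) (U (V B + B)) (cfg r x 0 ?R out) (cfg r x 0 (?R(d + 3 := ?y)) out)"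
      proof (rule computesD[where s = "s(v := i)", OF assms(2) B'])
        show "holds_env (s(v := i)) ?R (\<rho>(v := d + 2)) (d + 3)"
          by (rule holds_env_bind[OF R]) (use R in \<open>auto simp: holds_env_def\<close>)
      qed (use r in auto)
      show "exec (repeat_reg (d + 3) (inc d)) (W (V B + B) * 4 + 1) (cfg r x 0 (?R(d + 3 := ?y)) out)
        (cfg r x 0 (?R(d := S (Suc i))) out)"
        by (rule exec_transfer') (use W[where s = "s(v := i)", OF B'] r Rd in \<open>simp_all add: fun_eq_iff S_def\<close>)
      show "exec (inc (d + 2)) 1 (cfg r x 0 (?R(d := S (Suc i))) out)
        (cfg r x 0 (R(d := S (Suc i), d + 2 := Suc i, d + 1 := n - Suc i)) out)"
        by (rule exec_inc') (use r in \<open>simp_all add: fun_eq_iff\<close>)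
    qed
  qed (use r Rd n in \<open>simp_all add: fun_eq_iff S_def\<close>)
  show "exec (clear (d + 2)) (V B * 2 + 1) (cfg r x 0 (R(d := S n, d + 2 := n)) out)
     (cfg r x 0 (R(d := eval x s (Sum v a b))) out)"
    by (rule exec_clear') (use r Rd n in \<open>simp_all add: fun_eq_iff S_def n_def\<close>)
qed

text \<open>The arguments are placed in \<open>d + 1\<close> and \<open>d + 2\<close>, and
  \<open>d + 3\<close>, which stays zero, represents all other variables of the fresh
  environment.\<close>

lemma computes_Call:
  assumes "computes f S" "computes a T" "computes b U"
    and V': "value_bound a V"
    and W': "value_bound b W"
    and Y': "value_bound f Y"
  shows "computes (Call f a b) (\<lambda>B. T B + (U B + (S (V B + W B + B) + ((Y (V B + W B + B) * 4 + 1) +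
     ((V B * 2 + 1) + (W B * 2 + 1) + 1) + 1) + 1) + 1) + 1)"
  unfolding computes_def comp.simps
proof (intro allI impI exec_Seq)
  note V = value_boundD[OF V']
  note W = value_boundD[OF W']
  note Y = value_boundD[OF Y']
  fix x :: "bool list" and s R out \<rho> d r B
  assume B: "length x \<le> B" "\<forall>v. s v \<le> B" and R: "holds_env s R \<rho> d" and r: "d + width (Call f a b) \<le> r"
  have Rd: "R d = 0" "R (d + 1) = 0" "R (d + 2) = 0" "R (d + 3) = 0" "R (d + 4) = 0"
    using R by (auto simp: holds_env_def)
  define m n where "m = eval x s a" and "n = eval x s b"
  have mn: "m \<le> V B" "n \<le> W B" using V[of x B s] W[of x B s] B by (auto simp: m_def n_def)
  let ?s = "\<lambda>v. if v = 0 then m else if v = 1 then n else 0"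
  let ?y = "eval x ?s f"
  have B': "length x \<le> V B + W B + B" "?s w \<le> V B + W B + B" for w :: nat
    using B mn by auto
  show "exec (comp a \<rho> (d + 1)) (T B) (cfg r x 0 R out) (cfg r x 0 (R(d + 1 := m)) out)"
    by (rule computesD[OF assms(2) B(1)]) (use B r R in \<open>auto simp: m_def holds_env_def less_SucI\<close>)
  show "exec (comp b \<rho> (d + 2)) (U B) (cfg r x 0 (R(d + 1 := m)) out) (cfg r x 0 (R(d + 1 := m, d + 2 := n)) out)"
    unfolding n_def
  proof (rule computesD[OF assms(3) B(1)])
    show "holds_env s (R(d + 1 := m)) \<rho> (d + 2)"
      by (rule holds_envI[OF R]) (use R in \<open>auto simp: holds_env_def\<close>)
  qed (use B r in auto)
  show "exec (comp f (\<lambda>v. if v = 0 then d + 1 else if v = 1 then d + 2 else d + 3) (d + 4)) (S (V B + W B + B))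
     (cfg r x 0 (R(d + 1 := m, d + 2 := n)) out) (cfg r x 0 (R(d + 1 := m, d + 2 := n, d + 4 := ?y)) out)"
  proof (rule computesD[OF assms(1) B'])
    show "holds_env ?s (R(d + 1 := m, d + 2 := n)) (\<lambda>v. if v = 0 then d + 1 else if v = 1 then d + 2 else d + 3) (d + 4)"
      using R by (auto simp: holds_env_def)
  qed (use r in auto)
  show "exec (repeat_reg (d + 4) (inc d)) (Y (V B + W B + B) * 4 + 1)
     (cfg r x 0 (R(d + 1 := m, d + 2 := n, d + 4 := ?y)) out)
     (cfg r x 0 (R(d + 1 := m, d + 2 := n, d := ?y)) out)"
    by (rule exec_transfer') (use Y[OF B'] r Rd in \<open>simp_all add: fun_eq_iff\<close>)
  show "exec (clear (d + 1)) (V B * 2 + 1) (cfg r x 0 (R(d + 1 := m, d + 2 := n, d := ?y)) out)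
     (cfg r x 0 (R(d + 2 := n, d := ?y)) out)"
    by (rule exec_clear') (use mn r Rd in \<open>simp_all add: fun_eq_iff\<close>)
  show "exec (clear (d + 2)) (W B * 2 + 1) (cfg r x 0 (R(d + 2 := n, d := ?y)) out)
     (cfg r x 0 (R(d := eval x s (Call f a b))) out)"
    unfolding eval.simps m_def[symmetric] n_def[symmetric]
    by (rule exec_clear') (use mn r Rd in \<open>simp_all add: fun_eq_iff\<close>)
qed

lemma ex_computes: "\<exists>T. pbounded T \<and> computes e T"
proof (induction e)
  case (Var v)
  show ?case by (rule exI, rule conjI, rule_tac[2] computes_Var) (intro pbounded_intros)
next
  case One
  show ?case by (rule exI, rule conjI, rule_tac[2] computes_One) (intro pbounded_intros)
next
  case Len
  show ?case by (rule exI, rule conjI, rule_tac[2] computes_Len) (intro pbounded_intros)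
next
  case (Bit e)
  obtain T where T: "pbounded T" "computes e T" using Bit by blast
  obtain V where V: "pbounded V" "value_bound e V" using ex_value_bound by blast
  show ?case by (intro exI conjI, rule_tac[2] computes_Bit[OF T(2) V(2)])
    (intro pbounded_const pbounded_add pbounded_mult T V; assumption)
next
  case (Add a b)
  obtain T U where T: "pbounded T" "computes a T" "pbounded U" "computes b U" using Add by blast
  obtain V where V: "pbounded V" "value_bound b V" using ex_value_bound by blast
  show ?case by (intro exI conjI, rule_tac[2] computes_Add[OF T(2,4) V(2)])
    (intro pbounded_const pbounded_add pbounded_mult T V; assumption)
next
  case (Sub a b)
  obtain T U where T: "pbounded T" "computes a T" "pbounded U" "computes b U" using Sub by blast
  obtain V where V: "pbounded V" "value_bound b V" using ex_value_bound by blast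
  show ?case by (intro exI conjI, rule_tac[2] computes_Sub[OF T(2,4) V(2)])
    (intro pbounded_const pbounded_add pbounded_mult T V; assumption)
next
  case (Sum v a b)
  obtain T U where T: "pbounded T" "computes a T" "pbounded U" "computes b U" using Sum by blast
  obtain V where V: "pbounded V" "value_bound a V" using ex_value_bound by blast
  obtain W where W: "pbounded W" "value_bound b W" using ex_value_bound by blast
  show ?case by (intro exI conjI, rule_tac[2] computes_Sum[OF T(2,4) V(2) W(2)])
    (intro pbounded_const pbounded_add pbounded_mult T V pbounded_id pbounded_compose[OF T(3)]
      pbounded_compose[OF W(1)]; assumption)
next
  case (Call f a b)
  obtain S T U where T: "pbounded S" "computes f S" "pbounded T" "computes a T" "pbounded U" "computes b U"
    using Call by blast
  obtain V where V: "pbounded V" "value_bound a V" using ex_value_bound by blast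
  obtain W where W: "pbounded W" "value_bound b W" using ex_value_bound by blast
  obtain Y where Y: "pbounded Y" "value_bound f Y" using ex_value_bound by blast
  show ?case by (intro exI conjI, rule_tac[2] computes_Call[OF T(2,4,6) V(2) W(2) Y(2)])
    (intro pbounded_const pbounded_add pbounded_mult T V W pbounded_id pbounded_compose[OF T(1)]
      pbounded_compose[OF Y(1)]; assumption)
qed

lemma nth_less_3: "set ss \<subseteq> {..<3} \<Longrightarrow> i < length ss \<Longrightarrow> ss ! i < (3 :: nat)"
  by (meson lessThan_iff nth_mem subsetD)

lemma wf_basic [simp]:
  "wf_com (inc j)" "wf_com (dec j)" "wf_com (inc_if_bit j)" "wf_com input_left" "wf_com input_right"
  "wf_com (write_nonzero j)" "wf_com mark_counters" "wf_com (clear j)"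
  by (simp_all add: inc_def dec_def inc_if_bit_def input_left_def input_right_def move_head_def
      write_nonzero_def mark_counters_def clear_def nth_less_3)

lemma wf_repeat_reg [simp]: "wf_com (repeat_reg j c) \<longleftrightarrow> wf_com c"
  by (simp add: repeat_reg_def)

lemma wf_comp [simp]: "wf_com (comp e \<rho> d)"
  by (induction e arbitrary: \<rho> d) auto

section \<open>Programs that write a list of output bits\<close>

fun gcomp :: "gen \<Rightarrow> (nat \<Rightarrow> nat) \<Rightarrow> nat \<Rightarrow> com" where
  "gcomp (GOut e) \<rho> d = Seq (comp e \<rho> d) (Seq (write_nonzero d) (clear d))"
| "gcomp (GSeq g h) \<rho> d = Seq (gcomp g \<rho> d) (gcomp h \<rho> d)"
| "gcomp (GFor v e g) \<rho> d = Seq (comp e \<rho> d) (Seq (repeat_reg d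
     (Seq (gcomp g (\<rho>(v := d + 1)) (d + 2)) (inc (d + 1)))) (clear (d + 1)))"

fun gwidth :: "gen \<Rightarrow> nat" where
  "gwidth (GOut e) = width e + 1"
| "gwidth (GSeq g h) = gwidth g + gwidth h"
| "gwidth (GFor v e g) = width e + gwidth g + 2"

lemma wf_gcomp [simp]: "wf_com (gcomp g \<rho> d)"
  by (induction g arbitrary: \<rho> d) auto

definition generates :: "gen \<Rightarrow> (nat \<Rightarrow> nat) \<Rightarrow> bool" where
  "generates g T \<longleftrightarrow> (\<forall>x s R out \<rho> d r B. length x \<le> B \<longrightarrow> (\<forall>v. s v \<le> B) \<longrightarrow> holds_env s R \<rho> d \<longrightarrow>
     d + gwidth g \<le> r \<longrightarrow> exec (gcomp g \<rho> d) (T B) (cfg r x 0 R out) (cfg r x 0 R (out @ gout x s g)))"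

lemma generatesD:
  "generates g T \<Longrightarrow> length x \<le> B \<Longrightarrow> (\<And>v. s v \<le> B) \<Longrightarrow> holds_env s R \<rho> d \<Longrightarrow> d + gwidth g \<le> r \<Longrightarrow>
     out' = out @ gout x s g \<Longrightarrow> exec (gcomp g \<rho> d) (T B) (cfg r x 0 R out) (cfg r x 0 R out')"
  unfolding generates_def by simp

lemma exec_write_nonzero':
  assumes "j < r" "out' = out @ [R j \<noteq> 0]"
  shows "exec (write_nonzero j) 1 (cfg r x p R out) (cfg r x p R out')"
  unfolding assms(2) by (rule exec_write_nonzero[OF assms(1)])

lemma generates_GOut:
  assumes "computes e T" and V': "value_bound e V"
  shows "generates (GOut e) (\<lambda>B. T B + (1 + (V B * 2 + 1) + 1) + 1)"
  unfolding generates_def gcomp.simps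
proof (intro allI impI exec_Seq)
  note V = value_boundD[OF V']
  fix x :: "bool list" and s R out \<rho> d r B
  assume B: "length x \<le> B" "\<forall>v. s v \<le> B" and R: "holds_env s R \<rho> d" and r: "d + gwidth (GOut e) \<le> r"
  have R0: "R d = 0" using R by (simp add: holds_env_def)
  show "exec (comp e \<rho> d) (T B) (cfg r x 0 R out) (cfg r x 0 (R(d := eval x s e)) out)"
    by (rule computesD[OF assms(1) B(1)]) (use B r R in auto)
  show "exec (write_nonzero d) 1 (cfg r x 0 (R(d := eval x s e)) out)
     (cfg r x 0 (R(d := eval x s e)) (out @ gout x s (GOut e)))"
    by (rule exec_write_nonzero') (use r in auto)
  show "exec (clear d) (V B * 2 + 1) (cfg r x 0 (R(d := eval x s e)) (out @ gout x s (GOut e)))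
     (cfg r x 0 R (out @ gout x s (GOut e)))"
    by (rule exec_clear') (use V[OF B(1)] B(2) r R0 in auto)
qed

lemma generates_GSeq:
  assumes "generates g T" "generates h U"
  shows "generates (GSeq g h) (\<lambda>B. T B + U B + 1)"
  unfolding generates_def gcomp.simps
proof (intro allI impI exec_Seq)
  fix x :: "bool list" and s R out \<rho> d r B
  assume B: "length x \<le> B" "\<forall>v. s v \<le> B" and R: "holds_env s R \<rho> d" and r: "d + gwidth (GSeq g h) \<le> r"
  show "exec (gcomp g \<rho> d) (T B) (cfg r x 0 R out) (cfg r x 0 R (out @ gout x s g))"
    by (rule generatesD[OF assms(1) B(1)]) (use B r R in auto)
  show "exec (gcomp h \<rho> d) (U B) (cfg r x 0 R (out @ gout x s g)) (cfg r x 0 R (out @ gout x s (GSeq g h)))"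
    by (rule generatesD[OF assms(2) B(1)]) (use B r R in auto)
qed

lemma generates_GFor:
  assumes "computes a T" "generates g U"
    and V': "value_bound a V"
  shows "generates (GFor v a g) (\<lambda>B. T B + ((V B * ((U (V B + B) + 1 + 1) + 3) + 1) + (V B * 2 + 1) + 1) + 1)"
  unfolding generates_def gcomp.simps
proof (intro allI impI exec_Seq)
  note V = value_boundD[OF V']
  fix x :: "bool list" and s R out \<rho> d r B
  assume B: "length x \<le> B" "\<forall>v. s v \<le> B" and R: "holds_env s R \<rho> d" and r: "d + gwidth (GFor v a g) \<le> r"
  have Rd: "R d = 0" "R (d + 1) = 0" "R (d + 2) = 0" using R by (auto simp: holds_env_def)
  define n where "n = eval x s a"
  have n: "n \<le> V B" using V[of x B s] B by (simp add: n_def)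
  define out' where "out' m = out @ concat (map (\<lambda>i. gout x (s(v := i)) g) [0..<m])" for m
  show "exec (comp a \<rho> d) (T B) (cfg r x 0 R out) (cfg r x 0 (R(d := n)) out)"
    by (rule computesD[OF assms(1) B(1)]) (use B r R in \<open>auto simp: n_def\<close>)
  show "exec (repeat_reg d (Seq (gcomp g (\<rho>(v := d + 1)) (d + 2)) (inc (d + 1))))
     (V B * ((U (V B + B) + 1 + 1) + 3) + 1)
     (cfg r x 0 (R(d := n)) out) (cfg r x 0 (R(d + 1 := n)) (out' n))"
  proof (rule exec_repeat_reg'[where n = n and Rs = "\<lambda>i. R(d + 1 := i)" and p = "\<lambda>i. 0"
        and out = out'])
    fix i assume i: "i < n"
    let ?R = "R(d + 1 := i, d := n - Suc i)"
    have B': "length x \<le> V B + B" "(s(v := i)) w \<le> V B + B" for w :: nat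
      using B i n by (auto intro: trans_le_add2)
    show "exec (Seq (gcomp g (\<rho>(v := d + 1)) (d + 2)) (inc (d + 1))) (U (V B + B) + 1 + 1)
       (cfg r x 0 ?R (out' i)) (cfg r x 0 (R(d + 1 := Suc i, d := n - Suc i)) (out' (Suc i)))"
    proof (intro exec_Seq)
      show "exec (gcomp g (\<rho>(v := d + 1)) (d + 2)) (U (V B + B)) (cfg r x 0 ?R (out' i))
        (cfg r x 0 ?R (out' (Suc i)))"
      proof (rule generatesD[where s = "s(v := i)", OF assms(2) B'])
        show "holds_env (s(v := i)) ?R (\<rho>(v := d + 1)) (d + 2)"
          by (rule holds_env_bind[OF R]) (use R in \<open>auto simp: holds_env_def\<close>)
      qed (use r in \<open>auto simp: out'_def\<close>)
      show "exec (inc (d + 1)) 1 (cfg r x 0 ?R (out' (Suc i)))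
        (cfg r x 0 (R(d + 1 := Suc i, d := n - Suc i)) (out' (Suc i)))"
        by (rule exec_inc') (use r in \<open>simp_all add: fun_eq_iff\<close>)
    qed
  qed (use r Rd n in \<open>simp_all add: fun_eq_iff out'_def\<close>)
  show "exec (clear (d + 1)) (V B * 2 + 1) (cfg r x 0 (R(d + 1 := n)) (out' n))
     (cfg r x 0 R (out @ gout x s (GFor v a g)))"
    unfolding gout.simps n_def[symmetric] out'_def[symmetric]
    by (rule exec_clear') (use r Rd n in \<open>simp_all add: fun_eq_iff\<close>)
qed

lemma ex_generates: "\<exists>T. pbounded T \<and> generates g T"
proof (induction g)
  case (GOut e)
  obtain T where T: "pbounded T" "computes e T" using ex_computes by blast
  obtain V where V: "pbounded V" "value_bound e V" using ex_value_bound by blast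
  show ?case by (intro exI conjI, rule_tac[2] generates_GOut[OF T(2) V(2)])
    (intro pbounded_const pbounded_add pbounded_mult T V; assumption)
next
  case (GSeq g h)
  obtain T U where T: "pbounded T" "generates g T" "pbounded U" "generates h U" using GSeq by blast
  show ?case by (intro exI conjI, rule_tac[2] generates_GSeq[OF T(2,4)])
    (intro pbounded_const pbounded_add T)
next
  case (GFor v a g)
  obtain U where U: "pbounded U" "generates g U" using GFor by blast
  obtain T where T: "pbounded T" "computes a T" using ex_computes by blast
  obtain V where V: "pbounded V" "value_bound a V" using ex_value_bound by blast
  show ?case by (intro exI conjI, rule_tac[2] generates_GFor[OF T(2) U(2) V(2)])
    (intro pbounded_const pbounded_add pbounded_mult T V pbounded_id pbounded_compose[OF U(1)]; assumption)
qed

lemma exec_mark_counters: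
  "exec mark_counters 1 ((bits_on_tape x, 0) # replicate (Suc r) (\<lambda>_. 0, 0)) (cfg r x 0 (\<lambda>_. 0) [])"
  unfolding mark_counters_def
proof (rule exec_Basic, rule cfg_eqI)
  let ?ts = "(bits_on_tape x, 0) # replicate (Suc r) (\<lambda>_. 0, 0)"
  let ?a = "\<lambda>ss i. (if 0 < i \<and> Suc i < length ss then 1 else ss ! i, Stay)"
  show "perform ?a ?ts ! 0 = (bits_on_tape x, 0)"
    by (simp add: nth_perform apply_action_def read_tape_def)
  show "perform ?a ?ts ! Suc j = (\<lambda>q. if q = 0 then 1 else 0, int 0)" if "j < r" for j
    using that by (auto simp: nth_perform apply_action_def read_tape_def fun_eq_iff simp del: replicate_Suc)
  show "perform ?a ?ts ! Suc r = (bits_on_tape [], int (length []))"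
    by (auto simp: nth_perform apply_action_def read_tape_def fun_eq_iff bits_on_tape_def simp del: replicate_Suc)
qed simp

theorem poly_time_computable_gout: "poly_time_computable (\<lambda>x. gout x (\<lambda>_. 0) g)"
proof -
  obtain T where T: "pbounded T" "generates g T" using ex_generates by blast
  obtain D where D: "1 + T B + 1 \<le> (B + 2) ^ D" for B
    using pbounded_add[OF pbounded_add[OF pbounded_const[of 1] T(1)] pbounded_const[of 1]]
    unfolding pbounded_def by blast
  \<comment> \<open>The initial environment is constantly 0, so counter 0, which stays zero, can
    hold every variable; the working counters begin at 1.\<close>
  define r where "r = 1 + gwidth g"
  define c where "c = Seq mark_counters (gcomp g (\<lambda>_. 0) 1)"
  show ?thesis
  proof (rule poly_time_computableI[where c = c and n = "r + 2" and p = "[:2, 1:] ^ D"])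
    show "wf_com c" by (simp add: c_def)
    fix x
    have "exec (gcomp g (\<lambda>_. 0) 1) (T (length x)) (cfg r x 0 (\<lambda>_. 0) [])
        (cfg r x 0 (\<lambda>_. 0) (gout x (\<lambda>_. 0) g))"
      by (rule generatesD[OF T(2)]) (auto simp: holds_env_def r_def)
    from exec_Seq[OF exec_mark_counters this]
    have "exec c (1 + T (length x) + 1) ((bits_on_tape x, 0) # replicate (Suc r) (\<lambda>_. 0, 0))
      (cfg r x 0 (\<lambda>_. 0) (gout x (\<lambda>_. 0) g))" unfolding c_def .
    then obtain t where t: "t \<le> 1 + T (length x) + 1"
      "(cstep ^^ t) ([c], (bits_on_tape x, 0) # replicate (Suc r) (\<lambda>_. 0, 0)) =
        ([], cfg r x 0 (\<lambda>_. 0) (gout x (\<lambda>_. 0) g))" unfolding exec_def by blast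
    have "t \<le> poly ([:2, 1:] ^ D) (length x)"
      using t(1) D[of "length x"] by (simp add: add.commute)
    then obtain t' where t': "poly ([:2, 1:] ^ D) (length x) = t + t'" using le_Suc_ex by blast
    \<comment> \<open>The empty stack is stationary, so the actual number of steps can be padded to
      the value of the polynomial.\<close>
    have "(cstep ^^ t') ([], ts) = ([], ts)" for ts by (induction t') auto
    then have "(cstep ^^ (t + t')) ([c], (bits_on_tape x, 0) # replicate (Suc r) (\<lambda>_. 0, 0)) =
        ([], cfg r x 0 (\<lambda>_. 0) (gout x (\<lambda>_. 0) g))"
      using t(2) by (intro funpow_trans) auto
    then show "\<exists>ts. (cstep ^^ poly ([:2, 1:] ^ D) (length x))
        ([c], (bits_on_tape x, 0) # replicate (r + 2 - 1) (\<lambda>_. 0, 0)) = ([], ts) \<and>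
        fst (last ts) = bits_on_tape (gout x (\<lambda>_. 0) g)"
      unfolding t' by (auto simp: cfg_def)
  qed simp
qed

subsection \<open>Derived expressions\<close>

definition Mul :: "exp \<Rightarrow> exp \<Rightarrow> exp" where
  "Mul a b = Call (Sum 2 (Var 0) (Var 1)) a b"

fun Num :: "nat \<Rightarrow> exp" where
  "Num 0 = Sub One One"
| "Num (Suc n) = Add (Num n) One"

definition Neg :: "exp \<Rightarrow> exp" where "Neg a = Sub One a"
definition Disj :: "exp \<Rightarrow> exp \<Rightarrow> exp" where "Disj a b = Neg (Neg (Add a b))"
definition Conj :: "exp \<Rightarrow> exp \<Rightarrow> exp" where "Conj a b = Neg (Disj (Neg a) (Neg b))"
definition Imp :: "exp \<Rightarrow> exp \<Rightarrow> exp" where "Imp a b = Disj (Neg a) b"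
definition Le :: "exp \<Rightarrow> exp \<Rightarrow> exp" where "Le a b = Neg (Sub a b)"
definition Lt :: "exp \<Rightarrow> exp \<Rightarrow> exp" where "Lt a b = Neg (Le b a)"
definition Eq :: "exp \<Rightarrow> exp \<Rightarrow> exp" where "Eq a b = Conj (Le a b) (Le b a)"
definition Ex :: "nat \<Rightarrow> exp \<Rightarrow> exp \<Rightarrow> exp" where "Ex v a b = Neg (Neg (Sum v a b))"
definition All :: "nat \<Rightarrow> exp \<Rightarrow> exp \<Rightarrow> exp" where "All v a b = Neg (Sum v a (Neg b))"
definition Count :: "nat \<Rightarrow> exp \<Rightarrow> exp \<Rightarrow> exp" where "Count v a b = Sum v a (Neg (Neg b))"
definition Cond :: "exp \<Rightarrow> exp \<Rightarrow> exp \<Rightarrow> exp" where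
  "Cond c a b = Add (Mul (Neg (Neg c)) a) (Mul (Neg c) b)"

text \<open>The quotient counts the positive multiples of the divisor up to the dividend. Without
  the conjunct \<open>Var 1\<close> a zero divisor would make every \<open>i\<close> count; with it
  the result is 0, as for \<open>div\<close>.\<close>

definition Div :: "exp \<Rightarrow> exp \<Rightarrow> exp" where
  "Div a b = Call (Count 2 (Var 0) (Conj (Var 1) (Le (Mul (Add (Var 2) One) (Var 1)) (Var 0)))) a b"

definition Mod :: "exp \<Rightarrow> exp \<Rightarrow> exp" where "Mod a b = Sub a (Mul b (Div a b))"

lemma eval_Mul [simp]: "eval x s (Mul a b) = eval x s a * eval x s b"
  by (simp add: Mul_def)

lemma eval_Num [simp]: "eval x s (Num n) = n"
  by (induction n) auto

lemma eval_Neg [simp]: "eval x s (Neg a) = of_bool (eval x s a = 0)"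
  by (auto simp: Neg_def)

lemma eval_Disj [simp]: "eval x s (Disj a b) = of_bool (eval x s a \<noteq> 0 \<or> eval x s b \<noteq> 0)"
  by (simp add: Disj_def)

lemma eval_Conj [simp]: "eval x s (Conj a b) = of_bool (eval x s a \<noteq> 0 \<and> eval x s b \<noteq> 0)"
  by (simp add: Conj_def)

lemma eval_Imp [simp]: "eval x s (Imp a b) = of_bool (eval x s a \<noteq> 0 \<longrightarrow> eval x s b \<noteq> 0)"
  by (auto simp: Imp_def)

lemma eval_Le [simp]: "eval x s (Le a b) = of_bool (eval x s a \<le> eval x s b)"
  by (simp add: Le_def)

lemma eval_Lt [simp]: "eval x s (Lt a b) = of_bool (eval x s a < eval x s b)"
  by (simp add: Lt_def not_le)

lemma eval_Eq [simp]: "eval x s (Eq a b) = of_bool (eval x s a = eval x s b)"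
  by (auto simp: Eq_def)

lemma eval_Ex [simp]: "eval x s (Ex v a b) = of_bool (\<exists>i<eval x s a. eval x (s(v := i)) b \<noteq> 0)"
  by (auto simp: Ex_def)

lemma eval_All [simp]: "eval x s (All v a b) = of_bool (\<forall>i<eval x s a. eval x (s(v := i)) b \<noteq> 0)"
  by (auto simp: All_def)

lemma eval_Count [simp]: "eval x s (Count v a b) = card {i. i < eval x s a \<and> eval x (s(v := i)) b \<noteq> 0}"
  by (simp add: Count_def Collect_conj_eq lessThan_def flip: lessThan_def)

lemma eval_Cond [simp]: "eval x s (Cond c a b) = (if eval x s c \<noteq> 0 then eval x s a else eval x s b)"
  by (simp add: Cond_def)

lemma eval_Div [simp]: "eval x s (Div a b) = eval x s a div eval x s b"
proof (cases "eval x s b = 0")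
  case False
  let ?a = "eval x s a" and ?b = "eval x s b"
  have "{i. i < ?a \<and> (i + 1) * ?b \<le> ?a} = {..<?a div ?b}"
  proof -
    have "i < ?a div ?b \<longleftrightarrow> (i + 1) * ?b \<le> ?a" for i
      using False less_eq_div_iff_mult_less_eq[of ?b "i + 1" ?a] by (simp add: Suc_le_eq)
    moreover have "i < ?a" if "i < ?a div ?b" for i
      using that div_le_dividend[of ?a ?b] by linarith
    ultimately show ?thesis by auto
  qed
  then show ?thesis using False by (simp add: Div_def)
qed (simp add: Div_def)

lemma eval_Mod [simp]: "eval x s (Mod a b) = eval x s a mod eval x s b"
  by (simp add: Mod_def minus_mult_div_eq_mod)

declare eval.simps(8) [simp del]

lemma ex_Poly: "\<exists>e. \<forall>x s. eval x s e = poly p (eval x s a)"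
proof (induction p)
  case 0
  show ?case by (rule exI[of _ "Num 0"]) simp
next
  case (pCons c p)
  then obtain e where "\<And>x s. eval x s e = poly p (eval x s a)" by blast
  then show ?case by (intro exI[of _ "Add (Num c) (Mul a e)"]) simp
qed

text \<open>A function on finitely many arguments, hard-wired as a case distinction. In this way the
  transition function of a fixed machine enters an expression.\<close>

fun Tab :: "(nat \<Rightarrow> nat) \<Rightarrow> nat \<Rightarrow> exp \<Rightarrow> exp" where
  "Tab f 0 a = Num 0"
| "Tab f (Suc k) a = Cond (Eq a (Num k)) (Num (f k)) (Tab f k a)"

lemma eval_Tab: "eval x s a < k \<Longrightarrow> eval x s (Tab f k a) = f (eval x s a)"
  by (induction k) (auto simp: less_Suc_eq)

subsection \<open>Powers of two and binary representations\<close>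

text \<open>Bit \<open>i\<close> is addressed by the power \<open>p = 2 ^ i\<close>, since being a
  power of two is a bounded property of \<open>p\<close>, whereas \<open>2 ^ i\<close> as a function
  of \<open>i\<close> is not polynomially bounded. The index is recovered as
  \<open>card (powers_below p)\<close>.\<close>

definition powers_below :: "nat \<Rightarrow> nat set" where
  "powers_below n = {p. p < n \<and> (\<exists>i. p = 2 ^ i)}"

lemma powers_below_eq: "powers_below (Suc k) = (\<lambda>i. 2 ^ i) ` {..<floorlog 2 k}"
proof -
  have "2 ^ i < Suc k \<longleftrightarrow> i < floorlog 2 k" for i
    using floorlog_le_iff[of 2 k i] by (simp add: less_Suc_eq_le) (metis not_less)
  then show ?thesis by (auto simp: powers_below_def)
qed

lemma inj_power_2: "inj_on (\<lambda>i. 2 ^ i :: nat) A"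
  by (rule inj_onI) simp

lemma card_powers_below: "card (powers_below (Suc k)) = floorlog 2 k"
  by (simp add: powers_below_eq card_image inj_power_2)

lemma card_powers_below_power: "card (powers_below (2 ^ i)) = i"
proof -
  have "powers_below (2 ^ i) = (\<lambda>j. 2 ^ j) ` {..<i}"
    by (auto simp: powers_below_def)
  then show ?thesis by (simp add: card_image inj_power_2)
qed

lemma binary_iff:
  "bs = binary k \<longleftrightarrow> length bs = card (powers_below (Suc k)) \<and>
     (\<forall>p\<in>powers_below (Suc k). bs ! card (powers_below p) = odd (k div p))"
  unfolding card_powers_below
  by (auto simp: powers_below_eq card_powers_below_power binary_def list_eq_iff_nth_eq bit_iff_odd)

text \<open>This has the shape of a guarded loop over all \<open>p\<close> up to \<open>k\<close>,
  which a generator can run. It holds because powers of two are met in the order of their exponents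
  and \<open>floorlog 2 n\<close> grows exactly when a power of two is reached.\<close>

lemma binary_eq_filter:
  "binary k = concat (map (\<lambda>p. if \<exists>i. p = 2 ^ i then [odd (k div p)] else []) [0..<Suc k])"
proof -
  let ?f = "\<lambda>p. if \<exists>i. p = 2 ^ i then [odd (k div p)] else []"
  \<comment> \<open>The range \<open>n\<close> of the loop is separated from \<open>k\<close>, which
    has to stay fixed during the induction.\<close>
  have *: "concat (map ?f [0..<Suc n]) = map (\<lambda>i. odd (k div 2 ^ i)) [0..<floorlog 2 n]" for n
  proof (induction n)
    case 0
    show ?case by (simp add: floorlog_eq_zero_iff)
  next
    case (Suc n)
    have c: "card (powers_below (Suc (Suc n))) = card (powers_below (Suc n)) + of_bool (\<exists>i. Suc n = 2 ^ i)"
    proof (cases "\<exists>i. Suc n = 2 ^ i")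
      case True
      then have "powers_below (Suc (Suc n)) = insert (Suc n) (powers_below (Suc n))"
        by (auto simp: powers_below_def less_Suc_eq)
      then show ?thesis using True by (simp add: powers_below_def)
    next
      case False
      then have "powers_below (Suc (Suc n)) = powers_below (Suc n)"
        by (auto simp: powers_below_def less_Suc_eq dest: sym)
      then show ?thesis using False by simp
    qed
    show ?case
    proof (cases "\<exists>i. Suc n = 2 ^ i")
      case True
      then obtain i where i: "Suc n = 2 ^ i" by blast
      have "floorlog 2 n = i" using card_powers_below_power[of i] card_powers_below[of n] i by simp
      moreover have "floorlog 2 (Suc n) = Suc (floorlog 2 n)"
        using c True by (simp add: card_powers_below)
      moreover have "concat (map ?f [0..<Suc (Suc n)]) = concat (map ?f [0..<Suc n]) @ ?f (Suc n)"
        by simp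
      ultimately show ?thesis using Suc i True by simp
    next
      case False
      have "concat (map ?f [0..<Suc (Suc n)]) = concat (map ?f [0..<Suc n]) @ ?f (Suc n)"
        by simp
      then show ?thesis using Suc False c by (simp add: card_powers_below)
    qed
  qed
  show ?thesis by (simp only: *) (simp add: binary_def bit_iff_odd)
qed

text \<open>The right-hand side uses only bounded quantifiers and divisibility, hence can be
  evaluated by an expression. For the converse, an even \<open>p\<close> is halved: odd divisors of
  the half divide \<open>p\<close> as well.\<close>

lemma power_of_two_iff:
  "(\<exists>i. p = 2 ^ i) \<longleftrightarrow> p \<noteq> 0 \<and> (\<forall>d<Suc p. d dvd p \<longrightarrow> d = 1 \<or> even d)" for p :: nat
proof
  assume "\<exists>i. p = 2 ^ i"
  then show "p \<noteq> 0 \<and> (\<forall>d<Suc p. d dvd p \<longrightarrow> d = 1 \<or> even d)"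
    by (auto simp: divides_primepow_nat dest!: divides_primepow_nat[OF two_is_prime_nat, THEN iffD1])
next
  assume *: "p \<noteq> 0 \<and> (\<forall>d<Suc p. d dvd p \<longrightarrow> d = 1 \<or> even d)"
  then show "\<exists>i. p = 2 ^ i"
  proof (induction p rule: less_induct)
    case (less p)
    show ?case
    proof (cases "p = 1")
      case True
      then show ?thesis by (intro exI[of _ 0]) simp
    next
      case False
      with less.prems have "even p" by auto
      then obtain q where q: "p = 2 * q" by blast
      have "\<exists>i. q = 2 ^ i"
        using less.prems q by (intro less.IH) (auto intro: dvd_mult)
      then obtain i where "q = 2 ^ i" by blast
      then show ?thesis using q by (intro exI[of _ "Suc i"]) simp
    qed
  qed
qed

definition Is_pow2 :: "exp \<Rightarrow> exp" where
  "Is_pow2 a = Call (Conj (Var 0) (All 2 (Add (Var 0) One)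
     (Imp (Eq (Mod (Var 0) (Var 2)) (Num 0)) (Disj (Eq (Var 2) One) (Neg (Mod (Var 2) (Num 2))))))) a One"

lemma eval_Is_pow2 [simp]: "eval x s (Is_pow2 a) = of_bool (\<exists>i. eval x s a = 2 ^ i)"
  unfolding power_of_two_iff by (simp add: Is_pow2_def eval.simps(8) dvd_eq_mod_eq_0)

definition Log2 :: "exp \<Rightarrow> exp" where
  "Log2 a = Call (Count 2 (Var 0) (Is_pow2 (Var 2))) a One"

lemma eval_Log2 [simp]: "eval x s (Log2 a) = card (powers_below (eval x s a))"
  by (simp add: Log2_def eval.simps(8) powers_below_def)

text \<open>Generators have no conditional; a loop with zero or one round plays that role.\<close>

lemma gout_GFor_guard:
  "gout x s (GFor v a (GFor w b g)) = concat (map (\<lambda>i. if eval x (s(v := i)) b \<noteq> 0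
     then gout x (s(v := i, w := 0)) g else []) [0..<eval x s a])"
  if "\<And>i. eval x (s(v := i)) b \<le> 1"
proof -
  have "gout x (s(v := i)) (GFor w b g) = (if eval x (s(v := i)) b \<noteq> 0
     then gout x (s(v := i, w := 0)) g else [])" for i
    using that[of i] by (cases "eval x (s(v := i)) b") auto
  then show ?thesis by simp
qed

definition GBinary :: "exp \<Rightarrow> gen" where
  "GBinary a = GFor 0 (Add a One) (GFor 1 (Is_pow2 (Var 0)) (GOut (Mod (Div a (Var 0)) (Num 2))))"

lemma gout_GBinary:
  assumes "\<And>s. eval x s a = k"
  shows "gout x s (GBinary a) = binary k"
  unfolding GBinary_def binary_eq_filter
  by (subst gout_GFor_guard)
    (auto simp: assms odd_iff_mod_2_eq_one simp del: upt_Suc intro!: arg_cong[of _ _ concat] map_cong)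

subsection \<open>Nested families and the simultaneous consecutive ones property\<close>

definition nested :: "'b set \<Rightarrow> ('b \<Rightarrow> 'a set) \<Rightarrow> bool" where
  "nested J F \<longleftrightarrow> (\<forall>i\<in>J. \<forall>j\<in>J. F i \<subseteq> F j \<or> F j \<subseteq> F i)"

text \<open>
  Row \<open>m\<close> is full and the last \<open>k + 1\<close> rows and columns are too many to be all touched by \<open>k\<close> flips.
  An untouched pair of them separates row \<open>m\<close> from one side, so that the ones of each of the first \<open>J\<close>
  columns extend from row \<open>m\<close> to the other side only.
\<close>

definition chain_matrix :: "nat \<Rightarrow> nat \<Rightarrow> nat \<Rightarrow> (nat \<Rightarrow> nat set) \<Rightarrow> binary_matrix" where
  "chain_matrix m J k A = mat (m + k + 2) (J + k + 1)
     (\<lambda>(i, j). if i < m then j < J \<and> i \<in> A j else if i = m then True else J \<le> j)"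

lemma dim_flip_zeros [simp]:
  "dim_row (flip_zeros M F) = dim_row M" "dim_col (flip_zeros M F) = dim_col M"
  by (simp_all add: flip_zeros_def)

lemma index_flip_zeros [simp]:
  "i < dim_row M \<Longrightarrow> j < dim_col M \<Longrightarrow> flip_zeros M F $$ (i, j) \<longleftrightarrow> (i, j) \<in> F \<or> M $$ (i, j)"
  by (simp add: flip_zeros_def)

lemma dim_chain_matrix [simp]:
  "dim_row (chain_matrix m J k A) = m + k + 2" "dim_col (chain_matrix m J k A) = J + k + 1"
  by (simp_all add: chain_matrix_def)

lemma index_chain_matrix [simp]:
  "i < m + k + 2 \<Longrightarrow> j < J + k + 1 \<Longrightarrow> chain_matrix m J k A $$ (i, j) \<longleftrightarrow>
     (if i < m then j < J \<and> i \<in> A j else if i = m then True else J \<le> j)"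
  by (simp add: chain_matrix_def)

lemma finite_zero_entries: "finite (zero_entries M)"
  by (rule finite_subset[of _ "{..<dim_row M} \<times> {..<dim_col M}"]) (auto simp: zero_entries_def)

lemma list_permutes:
  assumes "distinct xs" "set xs = {..<m}" "m \<le> n"
  shows "(\<lambda>p. if p < m then xs ! p else p) permutes {..<n}"
proof -
  have len: "length xs = m" unfolding distinct_card[OF assms(1), symmetric] assms(2) by simp
  have "bij_betw (\<lambda>p. if p < m then xs ! p else p) {..<m} {..<m} = bij_betw ((!) xs) {..<m} {..<m}"
    by (rule bij_betw_cong) simp
  also have \<dots>
    by (rule bij_betw_nth[OF assms(1)]) (simp_all only: len assms(2))
  finally have "(\<lambda>p. if p < m then xs ! p else p) permutes {..<m}"
    by (rule bij_imp_permutes) simp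
  moreover have "{..<m} \<subseteq> {..<n}" using assms(3) by auto
  ultimately show ?thesis by (rule permutes_subset)
qed

lemma pigeonhole_untouched:
  assumes "finite F" "card F \<le> k"
  obtains i where "a \<le> i" "i \<le> a + k" "i \<notin> f ` F"
proof -
  have "card (f ` F) < card {a..a + k}" using card_image_le[OF assms(1), of f] assms(2) by simp
  then have "\<not> {a..a + k} \<subseteq> f ` F"
    using card_mono[OF finite_imageI[OF assms(1)], of "{a..a + k}" f] by linarith
  then obtain i where "i \<in> {a..a + k}" "i \<notin> f ` F" by blast
  then show ?thesis using that[of i] by simp
qed

text \<open>Every \<open>G j\<close> is an interval that contains \<open>a\<close> and misses
  \<open>b\<close>. An element of \<open>S\<close> beyond \<open>b\<close> would force
  \<open>b\<close> into the interval, and none lies between the two, so the traces on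
  \<open>S\<close> lie on the far side of \<open>a\<close> and are determined by how far they extend
  from it.\<close>

lemma nested_if_anchored:
  fixes pos :: "nat \<Rightarrow> int"
  assumes inj: "inj_on pos R" and sub: "\<And>j. j \<in> J \<Longrightarrow> G j \<subseteq> R" and ab: "a \<in> R" "b \<in> R" "pos a < pos b"
    and conv: "\<And>j u v w. j \<in> J \<Longrightarrow> u \<in> G j \<Longrightarrow> w \<in> G j \<Longrightarrow> v \<in> R \<Longrightarrow> pos u < pos v \<Longrightarrow> pos v < pos w \<Longrightarrow> v \<in> G j"
    and in_out: "\<And>j. j \<in> J \<Longrightarrow> a \<in> G j \<and> b \<notin> G j"
    and between: "\<And>v. v \<in> S \<Longrightarrow> \<not> (pos a < pos v \<and> pos v < pos b)"
    and S: "S \<subseteq> R" "a \<notin> S"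
  shows "nested J (\<lambda>j. G j \<inter> S)"
proof -
  have left: "pos v < pos a" if "j \<in> J" "v \<in> G j \<inter> S" for j v
  proof (rule ccontr)
    assume "\<not> pos v < pos a"
    moreover have "pos v \<noteq> pos a" using that S ab inj using inj_onD[OF inj, of v a] by auto
    ultimately have "pos a < pos v" by simp
    moreover have "pos v \<noteq> pos b"
      using that S ab inj in_out by (metis IntD1 IntD2 inj_onD subsetD)
    ultimately have "pos b < pos v" using between[of v] that by auto
    then show False using conv[of j a v b] in_out[of j] that ab by auto
  qed
  have "v \<in> G j" if "i \<in> J" "j \<in> J" "v \<in> G i \<inter> S" "w \<in> G j \<inter> S" "pos w < pos v" for i j v w
    using conv[of j w a v] in_out[of j] left[of i v] that S by auto
  then have "v \<in> G j \<or> w \<in> G i" if "i \<in> J" "j \<in> J" "v \<in> G i \<inter> S" "w \<in> G j \<inter> S" for i j v w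
    using that inj S by (metis IntD1 IntD2 inj_onD linorder_neqE subsetD)
  then show ?thesis unfolding nested_def by blast
qed

lemma nested_if_SC1P:
  assumes A: "\<And>j. j < J \<Longrightarrow> A j \<subseteq> {..<m}" and "SC1P_by_zero_flips (chain_matrix m J k A) k"
  obtains F where "\<forall>j<J. A j \<subseteq> F j \<and> F j \<subseteq> {..<m}" "nested {..<J} F"
    "(\<Sum>j<J. card (F j)) \<le> k + (\<Sum>j<J. card (A j))"
proof -
  let ?C = "chain_matrix m J k A"
  obtain Fl where Fl: "Fl \<subseteq> zero_entries ?C" "card Fl \<le> k" "C1P_cols (flip_zeros ?C Fl)"
    using assms(2) unfolding SC1P_by_zero_flips_def SC1P_def by blast
  let ?M = "flip_zeros ?C Fl"
  have finFl: "finite Fl" using Fl(1) finite_zero_entries finite_subset by blast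
  obtain \<pi> where \<pi>: "\<pi> permutes {..<m + k + 2}"
    "\<And>j. j < J + k + 1 \<Longrightarrow> consecutive {i. i < m + k + 2 \<and> ?M $$ (\<pi> i, j)}"
    using Fl(3) unfolding C1P_cols_def by auto
  define R where "R = {..<m + k + 2}"
  define G where "G j = {v \<in> R. ?M $$ (v, j)}" for j
  define pos where "pos v = int (inv_into UNIV \<pi> v)" for v
  have inv\<pi>: "inv_into UNIV \<pi> permutes R" using \<pi>(1) permutes_inv R_def by blast
  have inj: "inj_on pos R"
    using permutes_inj[OF inv\<pi>] by (auto simp: pos_def inj_on_def dest: injD)
  have conv: "v \<in> G j" if "j < J + k + 1" "u \<in> G j" "w \<in> G j" "v \<in> R" "pos u < pos v" "pos v < pos w" for j u v w
  proof -
    have "inv_into UNIV \<pi> z \<in> {i. i < m + k + 2 \<and> ?M $$ (\<pi> i, j)} \<longleftrightarrow> z \<in> G j" for z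
      using permutes_in_image[OF inv\<pi>, of z] permutes_inverses(1)[OF \<pi>(1)] by (auto simp: G_def R_def)
    moreover have "inv_into UNIV \<pi> u < inv_into UNIV \<pi> v" "inv_into UNIV \<pi> v < inv_into UNIV \<pi> w"
      using that by (simp_all add: pos_def)
    ultimately show ?thesis
      using \<pi>(2)[OF that(1)] that(2,3) unfolding consecutive_def by blast
  qed
  obtain b where b: "m + 1 \<le> b" "b \<le> m + 1 + k" "b \<notin> fst ` Fl"
    using pigeonhole_untouched[OF finFl Fl(2)] .
  obtain c where c: "J \<le> c" "c \<le> J + k" "c \<notin> snd ` Fl"
    using pigeonhole_untouched[OF finFl Fl(2)] .
  have nb: "(b, j) \<notin> Fl" for j using b(3) image_eqI[of b fst "(b, j)" Fl] by auto
  have nc: "(v, c) \<notin> Fl" for v using c(3) image_eqI[of c snd "(v, c)" Fl] by auto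
  have mR: "m \<in> R" "b \<in> R" using b by (auto simp: R_def)
  have in_out: "m \<in> G j" "b \<notin> G j" if "j < J" for j
    using that b nb by (auto simp: G_def R_def)
  have cG: "m \<in> G c" "b \<in> G c" and cGv: "v \<notin> G c" if "v < m" for v
    using that b c nb nc by (auto simp: G_def R_def)
  \<comment> \<open>The untouched column \<open>c\<close> still has ones in rows \<open>m\<close>
    and \<open>b\<close> and zeros in all rows \<open>v < m\<close>; being consecutive, it keeps
    these rows out of the gap between \<open>m\<close> and \<open>b\<close>.\<close>
  have between: "\<not> (pos m < pos v \<and> pos v < pos b)" "\<not> (pos b < pos v \<and> pos v < pos m)" if "v < m" for v
    using conv[of c m b v] conv[of c b m v] cG[OF that] cGv[OF that] that c mR by (auto simp: R_def)
  have GR: "G j \<subseteq> R" for j by (auto simp: G_def)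
  have SR: "{..<m} \<subseteq> R" by (auto simp: R_def)
  have nest: "nested {..<J} (\<lambda>j. G j \<inter> {..<m})"
  proof (cases "pos m < pos b")
    case True
    show ?thesis
    proof (rule nested_if_anchored[OF inj _ mR True])
      show "v \<in> G j" if "j \<in> {..<J}" "u \<in> G j" "w \<in> G j" "v \<in> R" "pos u < pos v" "pos v < pos w" for j u v w
        using conv[OF _ that(2-6)] that(1) by simp
      show "m \<in> G j \<and> b \<notin> G j" if "j \<in> {..<J}" for j using in_out that by simp
      show "\<not> (pos m < pos v \<and> pos v < pos b)" if "v \<in> {..<m}" for v using between[of v] that by auto
    qed (simp_all add: GR SR)
  next
    case False
    moreover have "pos m \<noteq> pos b" using inj_onD[OF inj, of m b] mR b(1) by auto
    ultimately have lt: "- pos m < - pos b" by simp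
    \<comment> \<open>If \<open>b\<close> precedes \<open>m\<close>, reversing the order of the rows
      leads back to the first case.\<close>
    have inj': "inj_on (\<lambda>v. - pos v) R" using inj by (auto simp: inj_on_def)
    show ?thesis
    proof (rule nested_if_anchored[OF inj' _ mR lt])
      show "v \<in> G j" if "j \<in> {..<J}" "u \<in> G j" "w \<in> G j" "v \<in> R" "- pos u < - pos v" "- pos v < - pos w" for j u v w
        using conv[OF _ that(3,2,4)] that(1,5,6) by simp
      show "m \<in> G j \<and> b \<notin> G j" if "j \<in> {..<J}" for j using in_out that by simp
      show "\<not> (- pos m < - pos v \<and> - pos v < - pos b)" if "v \<in> {..<m}" for v using between[of v] that by auto
    qed (simp_all add: GR SR)
  qed
  have AG: "A j \<subseteq> G j \<inter> {..<m} \<and> G j \<inter> {..<m} \<subseteq> {..<m}" if "j < J" for j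
    using A[OF that] that by (auto simp: G_def R_def)
  have "(\<Sum>j<J. card (G j \<inter> {..<m})) \<le> k + (\<Sum>j<J. card (A j))"
  proof -
    let ?T = "\<lambda>j. {v. (v, j) \<in> Fl}"
    have finT: "finite (?T j)" for j
      by (rule finite_subset[OF _ finite_imageI[OF finFl, of fst]]) force
    have card_G: "card (G j \<inter> {..<m}) \<le> card (A j) + card (?T j)" if "j < J" for j
    proof -
      have "finite (A j)" using finite_subset[OF A[OF that]] by simp
      moreover have "G j \<inter> {..<m} \<subseteq> A j \<union> ?T j" using that by (auto simp: G_def R_def)
      ultimately have "card (G j \<inter> {..<m}) \<le> card (A j \<union> ?T j)"
        using finT by (intro card_mono) auto
      then show ?thesis using card_Un_le[of "A j" "?T j"] by linarith
    qed
    have "(\<Sum>j<J. card (?T j)) = card (SIGMA j:{..<J}. ?T j)"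
      using finT by simp
    also have "\<dots> = card ((\<lambda>(j, v). (v, j)) ` (SIGMA j:{..<J}. ?T j))"
      by (rule card_image[symmetric]) (auto simp: inj_on_def)
    also have "\<dots> \<le> card Fl" by (rule card_mono[OF finFl]) (rule image_subsetI, clarsimp)
    finally have "(\<Sum>j<J. card (?T j)) \<le> k" using Fl(2) by linarith
    moreover have "(\<Sum>j<J. card (G j \<inter> {..<m})) \<le> (\<Sum>j<J. card (A j) + card (?T j))"
      using card_G by (intro sum_mono) simp
    ultimately show ?thesis unfolding sum.distrib by linarith
  qed
  moreover have "\<forall>j<J. A j \<subseteq> G j \<inter> {..<m} \<and> G j \<inter> {..<m} \<subseteq> {..<m}" using AG by simp
  ultimately show thesis using nest by (intro that[of "\<lambda>j. G j \<inter> {..<m}"])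
qed

lemma consecutiveI:
  assumes "\<And>a b c. P a \<Longrightarrow> P c \<Longrightarrow> a < b \<Longrightarrow> b < c \<Longrightarrow> c < n \<Longrightarrow> P b"
  shows "consecutive {i. i < n \<and> P i}"
  unfolding consecutive_def
proof (intro ballI allI impI)
  fix a c b
  assume "a \<in> {i. i < n \<and> P i}" "c \<in> {i. i < n \<and> P i}" "a < b \<and> b < c"
  then show "b \<in> {i. i < n \<and> P i}" using assms[of a c b] by simp
qed

text \<open>The flips fill each \<open>A j\<close> up to \<open>F j\<close>. The first
  \<open>m\<close> rows are sorted by the number of sets containing them and the first
  \<open>J\<close> columns by the size of their set, so the ones in these parts form final segments:
  those of a column run up to the full row \<open>m\<close>, those of a row up to the last of the
  \<open>J\<close> columns.\<close>

lemma SC1P_if_nested: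
  assumes A: "\<And>j. j < J \<Longrightarrow> A j \<subseteq> F j \<and> F j \<subseteq> {..<m}" and nest: "nested {..<J} F"
    and size: "(\<Sum>j<J. card (F j)) \<le> k + (\<Sum>j<J. card (A j))"
  shows "SC1P_by_zero_flips (chain_matrix m J k A) k"
proof -
  let ?C = "chain_matrix m J k A"
  define Fl where "Fl = (\<lambda>(j, v). (v, j)) ` (SIGMA j:{..<J}. F j - A j)"
  let ?M = "flip_zeros ?C Fl"
  have Fl_iff: "(v, j) \<in> Fl \<longleftrightarrow> j < J \<and> v \<in> F j \<and> v \<notin> A j" for v j
    by (auto simp: Fl_def)
  have finF: "finite (F j)" "finite (A j)" if "j < J" for j
    using A[OF that] by (auto intro: finite_subset[OF _ finite_lessThan])
  have M: "?M $$ (i, j) \<longleftrightarrow> (if i < m then j < J \<and> i \<in> F j else if i = m then True else J \<le> j)"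
    if "i < m + k + 2" "j < J + k + 1" for i j
  proof -
    have "i < m" if "j < J" "i \<in> F j" using A[OF that(1)] that(2) by auto
    then show ?thesis using that A[of j] by (auto simp: Fl_iff)
  qed
  have "Fl \<subseteq> zero_entries ?C"
  proof
    fix e assume "e \<in> Fl"
    moreover obtain v j where e: "e = (v, j)" by (cases e)
    ultimately have "j < J" "v \<in> F j" "v \<notin> A j" by (simp_all add: Fl_iff)
    then show "e \<in> zero_entries ?C" using A[of j] by (auto simp: e zero_entries_def)
  qed
  moreover have "card Fl \<le> k"
  proof -
    have "card Fl = card (SIGMA j:{..<J}. F j - A j)"
      unfolding Fl_def by (rule card_image) (auto simp: inj_on_def)
    also have "\<dots> = (\<Sum>j<J. card (F j - A j))" using finF by simp
    also have "\<dots> + (\<Sum>j<J. card (A j)) = (\<Sum>j<J. card (F j))"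
      unfolding sum.distrib[symmetric]
    proof (rule sum.cong)
      fix j assume "j \<in> {..<J}"
      then show "card (F j - A j) + card (A j) = card (F j)"
        using A[of j] finF[of j] card_mono[of "F j" "A j"] by (simp add: card_Diff_subset)
    qed simp
    finally show ?thesis using size by linarith
  qed
  moreover have "C1P_cols ?M"
  proof -
    define \<kappa> where "\<kappa> v = card {j. j < J \<and> v \<in> F j}" for v
    define xs where "xs = sort_key \<kappa> [0..<m]"
    have xs: "distinct xs" "set xs = {..<m}" "length xs = m" by (auto simp: xs_def)
    \<comment> \<open>If \<open>w\<close> is not in \<open>F j\<close> but \<open>v\<close> is, then
      by nestedness every set containing \<open>w\<close> includes \<open>F j\<close> and thus
      contains \<open>v\<close>, so \<open>v\<close> lies in strictly more sets.\<close>
    have up: "w \<in> F j" if "j < J" "v \<in> F j" "\<kappa> v \<le> \<kappa> w" for v w j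
    proof (rule ccontr)
      assume w: "w \<notin> F j"
      have "{i. i < J \<and> w \<in> F i} \<subseteq> {i. i < J \<and> v \<in> F i}"
        using w that(1,2) nest unfolding nested_def by blast
      then have "{i. i < J \<and> w \<in> F i} \<subset> {i. i < J \<and> v \<in> F i}" using w that by blast
      then have "\<kappa> w < \<kappa> v" unfolding \<kappa>_def by (intro psubset_card_mono) auto
      then show False using that(3) by simp
    qed
    have sorted: "\<kappa> (xs ! a) \<le> \<kappa> (xs ! b)" if "a \<le> b" "b < m" for a b
      using sorted_nth_mono[of "map \<kappa> xs" a b] that xs by (simp add: xs_def)
    let ?\<pi> = "\<lambda>p. if p < m then xs ! p else p"
    have lt: "xs ! p < m" if "p < m" for p using nth_mem[of p xs] xs that by auto
    have "consecutive {i. i < m + k + 2 \<and> ?M $$ (?\<pi> i, j)}" if j: "j < J + k + 1" for j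
    proof (rule consecutiveI)
      fix a b c assume abc: "?M $$ (?\<pi> a, j)" "?M $$ (?\<pi> c, j)" "a < b" "b < c" "c < m + k + 2"
      have *: "?M $$ (?\<pi> i, j) \<longleftrightarrow> (if i < m then j < J \<and> xs ! i \<in> F j else if i = m then True else J \<le> j)"
        if "i < m + k + 2" for i
        using that j lt[of i] M[of "?\<pi> i" j] by auto
      have 1: "if a < m then j < J \<and> xs ! a \<in> F j else if a = m then True else J \<le> j"
        using abc *[of a] by simp
      have 2: "if c < m then j < J \<and> xs ! c \<in> F j else if c = m then True else J \<le> j"
        using abc *[of c] by simp
      have "if b < m then j < J \<and> xs ! b \<in> F j else if b = m then True else J \<le> j"
      proof (cases "b < m")
        case True
        then have "j < J" "xs ! a \<in> F j" using 1 abc by (auto split: if_splits)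
        then show ?thesis using up[of j "xs ! a" "xs ! b"] sorted[of a b] True abc by simp
      next
        case False
        then show ?thesis using 2 abc by (auto split: if_splits)
      qed
      then show "?M $$ (?\<pi> b, j)" using abc *[of b] by simp
    qed
    moreover have "?\<pi> permutes {..<m + k + 2}" using xs by (intro list_permutes) auto
    ultimately show ?thesis unfolding C1P_cols_def by auto
  qed
  moreover have "C1P_rows ?M"
  proof -
    define ys where "ys = sort_key (\<lambda>j. card (F j)) [0..<J]"
    have ys: "distinct ys" "set ys = {..<J}" "length ys = J" by (auto simp: ys_def)
    have up: "v \<in> F j" if "i < J" "j < J" "v \<in> F i" "card (F i) \<le> card (F j)" for v i j
    proof -
      have "F i \<subseteq> F j \<or> F j \<subseteq> F i" using nest that unfolding nested_def by simp
      then show ?thesis using card_seteq[OF finF(1)[OF that(1)] _ that(4)] that(3) by blast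
    qed
    have sorted: "card (F (ys ! a)) \<le> card (F (ys ! b))" if "a \<le> b" "b < J" for a b
      using sorted_nth_mono[of "map (\<lambda>j. card (F j)) ys" a b] that ys by (simp add: ys_def)
    let ?\<pi> = "\<lambda>p. if p < J then ys ! p else p"
    have lt: "ys ! p < J" if "p < J" for p using nth_mem[of p ys] ys that by auto
    have "consecutive {j. j < J + k + 1 \<and> ?M $$ (i, ?\<pi> j)}" if i: "i < m + k + 2" for i
    proof (rule consecutiveI)
      fix a b c assume abc: "?M $$ (i, ?\<pi> a)" "?M $$ (i, ?\<pi> c)" "a < b" "b < c" "c < J + k + 1"
      have *: "?M $$ (i, ?\<pi> j) \<longleftrightarrow> (if i < m then j < J \<and> i \<in> F (ys ! j) else if i = m then True else J \<le> j)"
        if "j < J + k + 1" for j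
        using that i lt[of j] M[of i "?\<pi> j"] by auto
      have 1: "if i < m then a < J \<and> i \<in> F (ys ! a) else if i = m then True else J \<le> a"
        using abc *[of a] by simp
      have 2: "if i < m then c < J \<and> i \<in> F (ys ! c) else if i = m then True else J \<le> c"
        using abc *[of c] by simp
      have "if i < m then b < J \<and> i \<in> F (ys ! b) else if i = m then True else J \<le> b"
      proof (cases "i < m")
        case True
        then have "c < J" "i \<in> F (ys ! a)" using 1 2 by simp_all
        then show ?thesis using up[OF lt lt, of a b i] sorted[of a b] True abc by simp
      next
        case False
        then show ?thesis using 1 abc by (auto split: if_splits)
      qed
      then show "?M $$ (i, ?\<pi> b)" using abc *[of b] by simp
    qed
    moreover have "?\<pi> permutes {..<J + k + 1}" using ys by (intro list_permutes) auto
    ultimately show ?thesis unfolding C1P_rows_def by auto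
  qed
  ultimately show ?thesis unfolding SC1P_by_zero_flips_def SC1P_def by blast
qed

subsection \<open>Independent sets and nested families\<close>

text \<open>The case \<open>u = v\<close> is included, so a loop \<open>E u u\<close> excludes
  \<open>u\<close>, and \<open>E\<close> may be asymmetric. Both freedoms are used by the conflict
  relation of records.\<close>

definition independent :: "('a \<Rightarrow> 'a \<Rightarrow> bool) \<Rightarrow> 'a set \<Rightarrow> bool" where
  "independent E S \<longleftrightarrow> (\<forall>u\<in>S. \<forall>v\<in>S. \<not> E u v)"

definition edges_in :: "('a \<Rightarrow> 'a \<Rightarrow> bool) \<Rightarrow> 'a set \<Rightarrow> ('a \<times> 'a) set" where
  "edges_in E S = {(u, v). u \<in> S \<and> v \<in> S \<and> E u v}"

lemma edges_in_subset: "edges_in E S \<subseteq> S \<times> S"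
  by (auto simp: edges_in_def)

lemma finite_edges_in: "finite S \<Longrightarrow> finite (edges_in E S)"
  by (rule finite_subset[OF edges_in_subset]) simp

text \<open>Deleting an endpoint of an edge loses one vertex and at least one edge.\<close>

lemma independent_subset_large:
  assumes "finite S"
  shows "\<exists>S'\<subseteq>S. independent E S' \<and> card S \<le> card S' + card (edges_in E S)"
  using assms
proof (induction "card S" arbitrary: S rule: less_induct)
  case less
  show ?case
  proof (cases "independent E S")
    case True
    then show ?thesis by (intro exI[of _ S]) simp
  next
    case False
    then obtain u v where uv: "u \<in> S" "v \<in> S" "E u v" unfolding independent_def by blast
    let ?T = "S - {u}"
    have c: "card S = Suc (card ?T)" using card_Suc_Diff1[OF less.prems uv(1)] by simp
    have "(u, v) \<in> edges_in E S" "(u, v) \<notin> edges_in E ?T" using uv by (simp_all add: edges_in_def)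
    moreover have "edges_in E ?T \<subseteq> edges_in E S" by (auto simp: edges_in_def)
    ultimately have "card (edges_in E ?T) < card (edges_in E S)"
      by (intro psubset_card_mono[OF finite_edges_in[OF less.prems]]) blast
    moreover have "\<exists>S'\<subseteq>?T. independent E S' \<and> card ?T \<le> card S' + card (edges_in E ?T)"
      by (rule less.hyps) (simp_all add: c less.prems)
    then obtain S' where S': "S' \<subseteq> ?T" "independent E S'" "card ?T \<le> card S' + card (edges_in E ?T)"
      by (elim exE conjE)
    ultimately have "card S \<le> card S' + card (edges_in E S)" using c by linarith
    moreover have "S' \<subseteq> S" using S'(1) by (rule order_trans) (rule Diff_subset)
    ultimately show ?thesis using S'(2) by (intro exI[of _ S'] conjI)
  qed
qed

text \<open>
  The vertices of the graph are \<open>0, \<dots>, n - 1\<close>. The remaining ones are dummies, which make a nested family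
  spend most of its sets on one set of vertices of the graph.
\<close>

definition clash :: "(nat \<Rightarrow> nat \<Rightarrow> bool) \<Rightarrow> nat \<Rightarrow> nat \<Rightarrow> nat \<Rightarrow> bool" where
  "clash E n u v \<longleftrightarrow> (if u < n \<and> v < n then E u v else u = v)"

text \<open>Column \<open>j\<close> belongs to the ordered pair of the base-\<open>m\<close> digits
  of \<open>j\<close>. A clashing pair gets an empty column instead of being dropped, which keeps
  the numbering of the columns easy to compute.\<close>

definition pair_column :: "(nat \<Rightarrow> nat \<Rightarrow> bool) \<Rightarrow> nat \<Rightarrow> nat \<Rightarrow> nat \<Rightarrow> nat set" where
  "pair_column E n m j = (if clash E n (j div m) (j mod m) then {} else {j div m, j mod m})"

locale independent_set_instance =
  fixes E :: "nat \<Rightarrow> nat \<Rightarrow> bool" and n c N m :: nat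
  assumes N: "N = n ^ 3 + n * c + 1" and m: "m = n + N"
begin

abbreviation A :: "nat \<Rightarrow> nat set" where
  "A \<equiv> pair_column E n m"

definition T :: "nat set" where
  "T = {j. j < m * m \<and> \<not> clash E n (j div m) (j mod m)}"

definition \<psi> :: "nat set \<Rightarrow> int" where
  "\<psi> S = int (card (S \<inter> {..<n})) - int (card (edges_in E (S \<inter> {..<n})))"

lemma m_pos: "0 < m"
  by (simp add: m N)

lemma finite_T: "finite T"
  by (simp add: T_def)

lemma A_T: "j \<in> T \<Longrightarrow> A j = {j div m, j mod m}"
  by (simp add: T_def pair_column_def)

lemma A_subset: "j < m * m \<Longrightarrow> A j \<subseteq> {..<m}"
  using m_pos by (auto simp: pair_column_def less_mult_imp_div_less)

text \<open>Of the ordered pairs over \<open>S\<close>, those that clash are the edges inside the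
  graph part and the diagonal pairs of the dummies in \<open>S\<close>. The latter number
  \<open>card S - card (S \<inter> {..<n})\<close>.\<close>

lemma card_T_within:
  assumes "S \<subseteq> {..<m}"
  shows "int (card {j \<in> T. A j \<subseteq> S}) = int (card S * card S) - int (card S) + \<psi> S"
proof -
  have finS: "finite S" using assms by (rule finite_subset) simp
  have card_eq: "card {j \<in> T. A j \<subseteq> S} = card ((\<lambda>j. (j div m, j mod m)) ` {j \<in> T. A j \<subseteq> S})"
  proof (rule card_image[symmetric], rule inj_onI)
    fix i j assume "(i div m, i mod m) = (j div m, j mod m)"
    then show "i = j" by (metis div_mult_mod_eq prod.inject)
  qed
  have image_eq: "(\<lambda>j. (j div m, j mod m)) ` {j \<in> T. A j \<subseteq> S} = S \<times> S - edges_in (clash E n) S"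
  proof (intro equalityI subsetI)
    fix e assume "e \<in> (\<lambda>j. (j div m, j mod m)) ` {j \<in> T. A j \<subseteq> S}"
    then obtain j where j: "e = (j div m, j mod m)" "j \<in> T" "A j \<subseteq> S" by blast
    moreover have "\<not> clash E n (j div m) (j mod m)" using j(2) by (simp add: T_def)
    ultimately show "e \<in> S \<times> S - edges_in (clash E n) S"
      using A_T[OF j(2)] by (simp add: edges_in_def)
  next
    fix e assume e: "e \<in> S \<times> S - edges_in (clash E n) S"
    then obtain u v where uv: "e = (u, v)" "u \<in> S" "v \<in> S" "\<not> clash E n u v" by (auto simp: edges_in_def)
    then have lt: "u < m" "v < m" using assms by auto
    have dm: "(u * m + v) div m = u" "(u * m + v) mod m = v" using lt(2) m_pos by simp_all
    have "u * m + v < m * m"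
    proof -
      have "u * m + v < (u + 1) * m" using lt by simp
      also have "\<dots> \<le> m * m" using lt by (intro mult_right_mono) auto
      finally show ?thesis .
    qed
    then have "u * m + v \<in> T" using uv lt by (simp add: T_def dm)
    then have "u * m + v \<in> {j \<in> T. A j \<subseteq> S}" using A_T[OF \<open>u * m + v \<in> T\<close>] uv lt by (simp add: dm)
    then show "e \<in> (\<lambda>j. (j div m, j mod m)) ` {j \<in> T. A j \<subseteq> S}"
      by (rule rev_image_eqI) (simp add: dm uv lt)
  qed
  have 1: "card {j \<in> T. A j \<subseteq> S} = card (S \<times> S) - card (edges_in (clash E n) S)"
    unfolding card_eq image_eq by (rule card_Diff_subset[OF finite_edges_in[OF finS] edges_in_subset])
  have split: "edges_in (clash E n) S = edges_in E (S \<inter> {..<n}) \<union> (\<lambda>u. (u, u)) ` (S - {..<n})"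
    by (auto simp: edges_in_def clash_def split: if_splits)
  have "card (edges_in E (S \<inter> {..<n}) \<union> (\<lambda>u. (u, u)) ` (S - {..<n})) =
      card (edges_in E (S \<inter> {..<n})) + card ((\<lambda>u. (u, u)) ` (S - {..<n}))"
    using finS by (intro card_Un_disjoint finite_edges_in) (auto simp: edges_in_def)
  moreover have "card ((\<lambda>u. (u, u)) ` (S - {..<n})) = card (S - {..<n})"
    by (rule card_image) (simp add: inj_on_def)
  ultimately have 2: "card (edges_in (clash E n) S) = card (edges_in E (S \<inter> {..<n})) + card (S - {..<n})"
    by (simp add: split)
  have 3: "card S = card (S \<inter> {..<n}) + card (S - {..<n})"
    using finS by (rule card_Int_Diff)
  have "card (edges_in (clash E n) S) \<le> card (S \<times> S)"
    using finS edges_in_subset by (intro card_mono) auto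
  with 1 2 3 show ?thesis
    by (simp add: \<psi>_def card_cartesian_product)
qed

text \<open>Layer-cake summation: it turns the total size of a family into a sum over the levels of
  a chain.\<close>

lemma sum_card_levels:
  assumes "finite T'" "\<And>j. j \<in> T' \<Longrightarrow> g j \<le> m"
  shows "(\<Sum>j\<in>T'. g j) = (\<Sum>i<m. card {j \<in> T'. i < g j})"
proof -
  have "(\<Sum>j\<in>T'. g j) = (\<Sum>j\<in>T'. \<Sum>i<m. of_bool (i < g j))"
  proof (rule sum.cong)
    fix j assume "j \<in> T'"
    then have "{..<m} \<inter> {i. i < g j} = {..<g j}" using assms(2)[of j] by auto
    then show "g j = (\<Sum>i<m. of_bool (i < g j))" by simp
  qed simp
  also have "\<dots> = (\<Sum>i<m. \<Sum>j\<in>T'. of_bool (i < g j))" by (rule sum.swap)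
  also have "\<dots> = (\<Sum>i<m. card {j \<in> T'. i < g j})"
    using assms(1) by (intro sum.cong) (simp_all add: Int_def)
  finally show ?thesis .
qed

lemma card_level:
  fixes g :: "nat \<Rightarrow> nat"
  shows "int (card {j \<in> T. i < g j}) = int (card T) - int (card {j \<in> T. g j \<le> i})"
proof -
  have "T = {j \<in> T. i < g j} \<union> {j \<in> T. g j \<le> i}" by auto
  moreover have "card ({j \<in> T. i < g j} \<union> {j \<in> T. g j \<le> i}) = card {j \<in> T. i < g j} + card {j \<in> T. g j \<le> i}"
    using finite_T by (intro card_Un_disjoint) auto
  ultimately show ?thesis by simp
qed

text \<open>A nonempty finite nested family has a largest member, which equals its union.\<close>

lemma nested_Union_small:
  assumes "finite J" "nested J F" "\<And>j. j \<in> J \<Longrightarrow> card (F j) \<le> i"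
  shows "card (\<Union>j\<in>J. F j) \<le> i"
proof -
  have "J = {} \<or> (\<exists>l\<in>J. (\<Union>j\<in>J. F j) = F l)"
    using assms(1,2)
  proof (induction J)
    case (insert x J)
    have "nested J F" using insert.prems by (simp add: nested_def)
    with insert.IH consider "J = {}" | l where "l \<in> J" "(\<Union>j\<in>J. F j) = F l" by blast
    then show ?case
    proof cases
      case 2
      have "F x \<subseteq> F l \<or> F l \<subseteq> F x" using insert.prems 2(1) by (simp add: nested_def)
      then show ?thesis using 2 by (auto simp: Un_absorb1 Un_absorb2)
    qed simp
  qed simp
  then show ?thesis using assms(3) by auto
qed

text \<open>At level \<open>i\<close>, the columns of \<open>T\<close> with
  \<open>card (F j) \<le> i\<close> all fit into the union of their sets, which by nestedness still
  has at most \<open>i\<close> elements. \<open>card_T_within\<close> then limits their number, and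
  all other columns pay one unit at this level.\<close>

lemma nested_size_ge:
  assumes F: "\<And>j. j < m * m \<Longrightarrow> A j \<subseteq> F j \<and> F j \<subseteq> {..<m}" "nested {..<m * m} F"
    and \<psi>: "\<And>S. \<psi> S \<le> b"
  shows "(\<Sum>i<m. int (card T) - (int (i * i) - int i + b)) \<le> int (\<Sum>j<m * m. card (F j))"
proof -
  have TQ: "T \<subseteq> {..<m * m}" by (auto simp: T_def)
  have le_m: "card (F j) \<le> m" if "j \<in> T" for j
    using card_mono[of "{..<m}" "F j"] F(1)[of j] that by (simp add: T_def)
  have level: "int (card T) - (int (i * i) - int i + b) \<le> int (card {j \<in> T. i < card (F j)})" for i
  proof -
    define J where "J = {j \<in> T. card (F j) \<le> i}"
    define S where "S = (\<Union>j\<in>J. F j)"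
    have J: "finite J" "J \<subseteq> T" using finite_T by (auto simp: J_def)
    have JQ: "j < m * m" if "j \<in> J" for j using J(2) TQ that by auto
    have "nested J F" using F(2) JQ by (simp add: nested_def)
    then have cS: "card S \<le> i"
      unfolding S_def using J(1) by (intro nested_Union_small) (auto simp: J_def)
    have S: "S \<subseteq> {..<m}"
      unfolding S_def by (rule UN_least) (use F(1) JQ in simp)
    have "A j \<subseteq> S" if "j \<in> J" for j
      using F(1)[OF JQ[OF that]] UN_upper[OF that, of F] unfolding S_def by (meson order_trans)
    then have "J \<subseteq> {j \<in> T. A j \<subseteq> S}" using J(2) by auto
    then have "card J \<le> card {j \<in> T. A j \<subseteq> S}" using finite_T by (intro card_mono) auto
    moreover have "int (card {j \<in> T. A j \<subseteq> S}) = int (card S * card S) - int (card S) + \<psi> S"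
      by (rule card_T_within[OF S])
    moreover have "int (card S * card S) - int (card S) \<le> int (i * i) - int i"
    proof (cases "card S = i")
      case False
      then have "Suc (card S) \<le> i" using cS by simp
      then have "Suc (card S) * card S \<le> i * (i - 1)" by (intro mult_mono) auto
      moreover have "i * (i - 1) + i = i * i" by (cases i) auto
      ultimately have "Suc (card S) * card S + i \<le> i * i" by linarith
      then have "card S * card S + i \<le> i * i + card S" by (simp add: algebra_simps)
      then show ?thesis by linarith
    qed simp
    ultimately show ?thesis
      using \<psi>[of S] card_level[of i "\<lambda>j. card (F j)"] unfolding J_def by linarith
  qed
  have "(\<Sum>i<m. int (card T) - (int (i * i) - int i + b)) \<le> (\<Sum>i<m. int (card {j \<in> T. i < card (F j)}))"
    by (intro sum_mono level)
  also have "\<dots> = int (\<Sum>j\<in>T. card (F j))"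
    using sum_card_levels[OF finite_T le_m] by simp
  also have "\<dots> \<le> int (\<Sum>j<m * m. card (F j))"
    using TQ by (intro zle_int[THEN iffD2] sum_mono2) auto
  finally show ?thesis .
qed

end

section \<open>A cheap chain from an independent set, and the budget\<close>

context independent_set_instance
begin

text \<open>The independent set comes first, then the \<open>N\<close> dummies, then the other
  vertices of the graph. Every initial segment of length between \<open>c\<close> and
  \<open>c + N\<close> therefore meets the graph in exactly \<open>S\<close>.\<close>

lemma exists_ordering:
  assumes "S \<subseteq> {..<n}" "card S = c"
  obtains pos where "bij_betw pos {..<m} {..<m}" "\<And>u. u < m \<Longrightarrow> pos u < c \<longleftrightarrow> u \<in> S"
    "\<And>u. u < m \<Longrightarrow> pos u < c + N \<longleftrightarrow> u \<in> S \<or> n \<le> u"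
proof -
  have finS: "finite S" using assms(1) by (rule finite_subset) simp
  have cn: "c \<le> n" using card_mono[OF _ assms(1)] assms(2) by simp
  obtain f where f: "bij_betw f S {0..<c}"
    using ex_bij_betw_finite_nat[OF finS] assms(2) by auto
  have "card ({..<n} - S) = n - c" using assms finS by (simp add: card_Diff_subset)
  then obtain g where g: "bij_betw g ({..<n} - S) {0..<n - c}"
    using ex_bij_betw_finite_nat[of "{..<n} - S"] by auto
  define pos where "pos u = (if u \<in> S then f u else if u < n then c + N + g u else u - n + c)" for u
  have "bij_betw (\<lambda>u. c + N + g u) ({..<n} - S) ((\<lambda>i. c + N + i) ` {0..<n - c})"
    using bij_betw_trans[OF g inj_on_imp_bij_betw[of "\<lambda>i. c + N + i"]] by (simp add: o_def)
  moreover have "(\<lambda>i. c + N + i) ` {0..<n - c} = {c + N..<m}"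
    using cn by (simp add: m add.commute)
  ultimately have g': "bij_betw (\<lambda>u. c + N + g u) ({..<n} - S) {c + N..<m}" by simp
  have d': "bij_betw (\<lambda>u. u - n + c) {n..<m} {c..<c + N}"
    by (rule bij_betw_byWitness[where f' = "\<lambda>i. i - c + n"]) (auto simp: m)
  have 1: "bij_betw pos S {0..<c}"
    using f by (rule bij_betw_cong[THEN iffD1, rotated]) (simp add: pos_def)
  have 2: "bij_betw pos {n..<m} {c..<c + N}"
    using d' by (rule bij_betw_cong[THEN iffD1, rotated]) (use assms(1) in \<open>auto simp: pos_def\<close>)
  have 3: "bij_betw pos ({..<n} - S) {c + N..<m}"
    using g' by (rule bij_betw_cong[THEN iffD1, rotated]) (auto simp: pos_def)
  have "bij_betw pos (S \<union> {n..<m} \<union> ({..<n} - S)) ({0..<c} \<union> {c..<c + N} \<union> {c + N..<m})"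
    by (intro bij_betw_combine 1 2 3) auto
  moreover have "S \<union> {n..<m} \<union> ({..<n} - S) = {..<m}" using assms(1) by (auto simp: m)
  moreover have "{0..<c} \<union> {c..<c + N} \<union> {c + N..<m} = {..<m}" using cn by (auto simp: m)
  ultimately have bij: "bij_betw pos {..<m} {..<m}" by simp
  have r: "pos u < c" if "u \<in> S" for u using bij_betwE[OF 1] that by auto
  have r2: "c \<le> pos u \<and> pos u < c + N" if "n \<le> u" "u < m" for u using bij_betwE[OF 2] that by auto
  have r3: "c + N \<le> pos u" if "u < n" "u \<notin> S" for u using bij_betwE[OF 3] that by auto
  show thesis
  proof (rule that[OF bij])
    fix u assume u: "u < m"
    consider "u \<in> S" | "n \<le> u" "u \<notin> S" | "u < n" "u \<notin> S" by linarith
    note cases = this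
    show "pos u < c \<longleftrightarrow> u \<in> S"
      using r r2[OF _ u] r3 by (cases rule: cases) force+
    show "pos u < c + N \<longleftrightarrow> u \<in> S \<or> n \<le> u"
      using r[of u] r2[OF _ u] r3[of u] by (cases rule: cases) auto
  qed
qed

text \<open>The summand is the lower bound for \<open>\<psi>\<close> along the initial segments: a
  subset of an independent set, then the whole independent set, then arbitrary vertices with the
  crude bound \<open>\<psi>_ge\<close>.\<close>

lemma sum_steps:
  assumes "c \<le> n"
  shows "(\<Sum>i<m. if i < c then 0 else if i < c + N then int c else - int (n * n)) \<ge> int (N * c) - int (n ^ 3)"
proof -
  let ?f = "\<lambda>i. if i < c then 0 else if i < c + N then int c else - int (n * n)"
  have *: "{..<m} = {..<c} \<union> ({c..<c + N} \<union> {c + N..<m})" using assms by (auto simp: m)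
  have "sum ?f {..<m} = sum ?f {..<c} + (sum ?f {c..<c + N} + sum ?f {c + N..<m})"
    unfolding * by (subst sum.union_disjoint; (subst sum.union_disjoint)?) auto
  moreover have "sum ?f {..<c} = 0" by simp
  moreover have "sum ?f {c..<c + N} = int (N * c)" by simp
  moreover have "sum ?f {c + N..<m} = - int ((n - c) * (n * n))"
    using assms by (simp add: m)
  moreover have "int ((n - c) * (n * n)) \<le> int (n ^ 3)"
    by (simp add: power3_eq_cube del: of_nat_mult)
  ultimately show ?thesis by linarith
qed

lemma edges_in_bound: "edges_in E (S \<inter> {..<n}) \<subseteq> {..<n} \<times> {..<n}"
  by (auto simp: edges_in_def)

lemma \<psi>_ge: "- int (n * n) \<le> \<psi> S"
proof -
  have "card (edges_in E (S \<inter> {..<n})) \<le> n * n"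
    using card_mono[OF _ edges_in_bound[of S]] by (simp add: card_cartesian_product)
  then show ?thesis by (simp add: \<psi>_def del: of_nat_mult)
qed

lemma \<psi>_independent: "independent E (S \<inter> {..<n}) \<Longrightarrow> \<psi> S = int (card (S \<inter> {..<n}))"
proof -
  assume "independent E (S \<inter> {..<n})"
  then have "edges_in E (S \<inter> {..<n}) = {}" by (auto simp: edges_in_def independent_def)
  then show ?thesis by (simp add: \<psi>_def)
qed

lemma exists_nested_small:
  assumes S: "S \<subseteq> {..<n}" "card S = c" "independent E S"
  obtains F where "\<forall>j<m * m. A j \<subseteq> F j \<and> F j \<subseteq> {..<m}" "nested {..<m * m} F"
    "int (\<Sum>j<m * m. card (F j)) \<le> (\<Sum>i<m. int (card T) - (int (i * i) - int i)) - int (N * c) + int (n ^ 3)"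
proof -
  have cn: "c \<le> n" using card_mono[OF _ S(1)] S(2) by simp
  obtain pos where pos: "bij_betw pos {..<m} {..<m}" "\<And>u. u < m \<Longrightarrow> pos u < c \<longleftrightarrow> u \<in> S"
    "\<And>u. u < m \<Longrightarrow> pos u < c + N \<longleftrightarrow> u \<in> S \<or> n \<le> u"
    using exists_ordering[OF S(1,2)] by blast
  define P where "P i = {u. u < m \<and> pos u < i}" for i
  have cardP: "card (P i) = i" if "i \<le> m" for i
  proof -
    have "pos ` P i = {..<i}"
    proof (intro equalityI subsetI)
      fix a assume "a \<in> {..<i}"
      then have "a \<in> pos ` {..<m}" using that pos(1) by (auto simp: bij_betw_def)
      then show "a \<in> pos ` P i" using \<open>a \<in> {..<i}\<close> by (auto simp: P_def)
    qed (auto simp: P_def)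
    moreover have "inj_on pos (P i)"
      using pos(1) by (auto simp: bij_betw_def P_def intro: inj_on_subset)
    ultimately show ?thesis using card_image[of pos "P i"] by simp
  qed
  have posm: "pos u < m" if "u < m" for u using bij_betwE[OF pos(1)] that by auto
  \<comment> \<open>The least \<open>i\<close> such that \<open>P i\<close> contains column
    \<open>j\<close>; the successor is due to the strict inequality in \<open>P\<close>. Columns
    outside \<open>T\<close> are empty and need no element.\<close>
  define \<tau> where "\<tau> j = (if j \<in> T then Suc (max (pos (j div m)) (pos (j mod m))) else 0)" for j
  define F where "F j = P (\<tau> j)" for j
  have lt: "j div m < m" "j mod m < m" if "j < m * m" for j
    using that m_pos by (auto simp: less_mult_imp_div_less)
  have \<tau>m: "\<tau> j \<le> m" if "j < m * m" for j
    using posm[OF lt(1)[OF that]] posm[OF lt(2)[OF that]] by (simp add: \<tau>_def Suc_le_eq)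
  have within: "A j \<subseteq> P i \<longleftrightarrow> \<tau> j \<le> i" if "j \<in> T" for i j
    using that lt[of j] A_T[OF that] by (auto simp: P_def \<tau>_def T_def)
  have mono: "P i \<subseteq> P i'" if "i \<le> i'" for i i' using that by (auto simp: P_def)
  show thesis
  proof (rule that[of F])
    show "\<forall>j<m * m. A j \<subseteq> F j \<and> F j \<subseteq> {..<m}"
    proof (intro allI impI)
      fix j assume j: "j < m * m"
      show "A j \<subseteq> F j \<and> F j \<subseteq> {..<m}"
      proof (cases "j \<in> T")
        case True
        then show ?thesis using within[OF True, of "\<tau> j"] by (auto simp: F_def P_def)
      next
        case False
        then have "A j = {}" using j by (simp add: T_def pair_column_def)
        then show ?thesis by (auto simp: F_def P_def)
      qed
    qed
  next
    have "F i \<subseteq> F j \<or> F j \<subseteq> F i" for i j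
      unfolding F_def using mono[of "\<tau> i" "\<tau> j"] mono[of "\<tau> j" "\<tau> i"] by linarith
    then show "nested {..<m * m} F" by (simp add: nested_def)
  next
    have TQ: "T \<subseteq> {..<m * m}" by (auto simp: T_def)
    have "(\<Sum>j<m * m. card (F j)) = (\<Sum>j<m * m. \<tau> j)"
      using \<tau>m by (intro sum.cong) (simp_all add: F_def cardP)
    also have "\<dots> = (\<Sum>j\<in>T. \<tau> j)"
      by (rule sum.mono_neutral_right) (use TQ in \<open>auto simp: \<tau>_def\<close>)
    also have "\<dots> = (\<Sum>i<m. card {j \<in> T. i < \<tau> j})"
      by (rule sum_card_levels[OF finite_T]) (use \<tau>m TQ in auto)
    finally have 1: "int (\<Sum>j<m * m. card (F j)) = (\<Sum>i<m. int (card {j \<in> T. i < \<tau> j}))" by simp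
    have \<psi>P: "(if i < c then 0 else if i < c + N then int c else - int (n * n)) \<le> \<psi> (P i)" for i
    proof -
      consider "i < c" | "c \<le> i" "i < c + N" | "c + N \<le> i" by linarith
      then show ?thesis
      proof cases
        case 1
        have "P i \<inter> {..<n} \<subseteq> S" using pos(2) 1 by (auto simp: P_def dest: order_less_trans)
        then have "independent E (P i \<inter> {..<n})" using S(3) by (auto simp: independent_def)
        from \<psi>_independent[OF this] show ?thesis using 1 by simp
      next
        case 2
        have "P i \<inter> {..<n} = S"
        proof (intro equalityI subsetI)
          fix u assume "u \<in> P i \<inter> {..<n}"
          then show "u \<in> S" using pos(3)[of u] 2 by (auto simp: P_def)
        next
          fix u assume u: "u \<in> S"
          then have "u < n" using S(1) by auto
          then have "u < m" by (simp add: m)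
          then show "u \<in> P i \<inter> {..<n}" using pos(2)[of u] u 2 \<open>u < n\<close> by (simp add: P_def)
        qed
        then show ?thesis using \<psi>_independent[of "P i"] S 2 by simp
      next
        case 3
        then show ?thesis using \<psi>_ge[of "P i"] by simp
      qed
    qed
    have "int (card {j \<in> T. i < \<tau> j}) \<le> int (card T) - (int (i * i) - int i) -
        (if i < c then 0 else if i < c + N then int c else - int (n * n))" if "i < m" for i
    proof -
      have "{j \<in> T. \<tau> j \<le> i} = {j \<in> T. A j \<subseteq> P i}" using within by auto
      moreover have "P i \<subseteq> {..<m}" by (auto simp: P_def)
      ultimately have "int (card {j \<in> T. \<tau> j \<le> i}) = int (i * i) - int i + \<psi> (P i)"
        using card_T_within[of "P i"] cardP[of i] that by simp
      then show ?thesis using card_level[of i \<tau>] \<psi>P[of i] by linarith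
    qed
    then have "(\<Sum>i<m. int (card {j \<in> T. i < \<tau> j})) \<le> (\<Sum>i<m. int (card T) - (int (i * i) - int i) -
        (if i < c then 0 else if i < c + N then int c else - int (n * n)))"
      by (intro sum_mono) simp
    also have "\<dots> = (\<Sum>i<m. int (card T) - (int (i * i) - int i)) -
        (\<Sum>i<m. if i < c then 0 else if i < c + N then int c else - int (n * n))"
      by (rule sum_subtractf)
    finally show "int (\<Sum>j<m * m. card (F j)) \<le>
        (\<Sum>i<m. int (card T) - (int (i * i) - int i)) - int (N * c) + int (n ^ 3)"
      unfolding 1 using sum_steps[OF cn] by linarith
  qed
qed

definition ones :: nat where
  "ones = (\<Sum>j<m * m. card (A j))"

text \<open>This is the size bound of \<open>exists_nested_small\<close> minus the ones already
  present in the columns.\<close>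

definition budget :: nat where
  "budget = (m * card T + n ^ 3) - ((\<Sum>i<m. i * i - i) + N * c + ones)"

text \<open>If the truncated subtraction in the budget yields 0, no nested family is allowed to add an element.\<close>

lemma not_nested_A:
  assumes "3 \<le> N"
  shows "\<not> nested {..<m * m} A"
proof
  assume nest: "nested {..<m * m} A"
  have idx: "A (u * m + v) = {u, v} \<and> u * m + v < m * m" if "n \<le> u" "u < v" "v < m" for u v
  proof -
    have "(u * m + v) div m = u" "(u * m + v) mod m = v" using that by auto
    moreover have "u * m + v < m * m"
    proof -
      have "u * m + v < (u + 1) * m" using that by simp
      also have "\<dots> \<le> m * m" using that by (intro mult_right_mono) auto
      finally show ?thesis .
    qed
    ultimately show ?thesis using that by (simp add: pair_column_def clash_def)
  qed
  \<comment> \<open>Three dummies already give two incomparable columns, hence the hypothesis on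
    \<open>N\<close>.\<close>
  have "A (n * m + (n + 1)) = {n, n + 1} \<and> n * m + (n + 1) < m * m"
    "A (n * m + (n + 2)) = {n, n + 2} \<and> n * m + (n + 2) < m * m"
    using assms by (intro idx; simp add: m)+
  then have "{n, n + 1} \<subseteq> {n, n + 2} \<or> {n, n + 2} \<subseteq> {n, n + 1}"
    using nest unfolding nested_def by (metis lessThan_iff)
  then show False by auto
qed

text \<open>By \<open>independent_subset_large\<close>, a set with \<open>\<psi> S\<close> at least
  \<open>c\<close> contains an independent set of at least \<open>c\<close> vertices, which can be
  cut down to exactly \<open>c\<close>.\<close>

lemma not_independent_bound:
  assumes "\<not> (\<exists>S\<subseteq>{..<n}. card S = c \<and> independent E S)"
  shows "\<psi> S \<le> int c - 1"
proof (rule ccontr)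
  assume *: "\<not> \<psi> S \<le> int c - 1"
  obtain S' where S': "S' \<subseteq> S \<inter> {..<n}" "independent E S'"
    "card (S \<inter> {..<n}) \<le> card S' + card (edges_in E (S \<inter> {..<n}))"
    using independent_subset_large[of "S \<inter> {..<n}" E] by auto
  then have "c \<le> card S'" using * by (simp add: \<psi>_def)
  then obtain S'' where "S'' \<subseteq> S'" "card S'' = c" using obtain_subset_with_card_n by metis
  moreover from this have "independent E S''" using S'(2) by (auto simp: independent_def)
  ultimately show False using assms S'(1) by blast
qed

lemma sum_diff_id: "int (\<Sum>i<m. i * i - i) = (\<Sum>i<m. int (i * i) - int i)"
  by (simp add: of_nat_diff)

theorem SC1P_iff_independent:
  assumes "3 \<le> N"
  shows "SC1P_by_zero_flips (chain_matrix m (m * m) budget A) budget \<longleftrightarrow>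
    (\<exists>S\<subseteq>{..<n}. card S = c \<and> independent E S)"
proof
  assume sc: "SC1P_by_zero_flips (chain_matrix m (m * m) budget A) budget"
  obtain F where F: "\<forall>j<m * m. A j \<subseteq> F j \<and> F j \<subseteq> {..<m}" "nested {..<m * m} F"
    "(\<Sum>j<m * m. card (F j)) \<le> budget + ones"
    unfolding ones_def by (rule nested_if_SC1P[OF A_subset sc])
  have finF: "finite (F j)" if "j < m * m" for j
    using F(1) that finite_subset[of "F j" "{..<m}"] by simp
  \<comment> \<open>With budget 0 the family \<open>F\<close> would coincide with \<open>A\<close>,
    which is not nested. Positivity makes the truncated subtraction in \<open>budget\<close>
    exact.\<close>
  have "0 < budget"
  proof (rule ccontr)
    assume "\<not> 0 < budget"
    then have le: "(\<Sum>j<m * m. card (F j)) \<le> (\<Sum>j<m * m. card (A j))" using F(3) by (simp add: ones_def)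
    have AF: "card (A j) \<le> card (F j)" if "j < m * m" for j
      using F(1) that finF[OF that] by (simp add: card_mono)
    have "A j = F j" if "j < m * m" for j
    proof (rule ccontr)
      assume "A j \<noteq> F j"
      then have "card (A j) < card (F j)"
        using F(1) that finF[OF that] by (simp add: psubset_card_mono psubset_eq)
      then have "(\<Sum>j<m * m. card (A j)) < (\<Sum>j<m * m. card (F j))"
        using AF that by (intro sum_strict_mono_ex1) auto
      then show False using le by simp
    qed
    then have "nested {..<m * m} A" using F(2) by (simp add: nested_def)
    then show False using not_nested_A[OF assms] by blast
  qed
  then have b: "(\<Sum>j<m * m. card (F j)) + (\<Sum>i<m. i * i - i) + N * c \<le> m * card T + n ^ 3"
    using F(3) by (simp add: budget_def)
  show "\<exists>S\<subseteq>{..<n}. card S = c \<and> independent E S"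
  proof (rule ccontr)
    assume no: "\<not> (\<exists>S\<subseteq>{..<n}. card S = c \<and> independent E S)"
    have "c \<noteq> 0"
    proof
      assume "c = 0"
      then have "{} \<subseteq> {..<n} \<and> card ({} :: nat set) = c \<and> independent E {}" by (simp add: independent_def)
      then show False using no by blast
    qed
    have "(\<Sum>i<m. int (card T) - (int (i * i) - int i + (int c - 1))) \<le> int (\<Sum>j<m * m. card (F j))"
      by (rule nested_size_ge[OF F(1)[rule_format] F(2) not_independent_bound[OF no]])
    moreover have "(\<Sum>i<m. int (card T) - (int (i * i) - int i + (int c - 1))) =
        int (m * card T) - int (\<Sum>i<m. i * i - i) - int m * (int c - 1)"
      unfolding sum_diff_id by (simp add: sum_subtractf sum.distrib algebra_simps)
    moreover have "int (\<Sum>j<m * m. card (F j)) + int (\<Sum>i<m. i * i - i) + int (N * c) \<le> int (m * card T) + int (n ^ 3)"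
      using b by linarith
    \<comment> \<open>A gain of at most \<open>c - 1\<close> on all \<open>m\<close> levels would
      require \<open>N + n \<le> n * c + n ^ 3\<close>, which the choice of \<open>N\<close> rules
      out.\<close>
    ultimately have "int (N * c) \<le> int m * (int c - 1) + int (n ^ 3)" by linarith
    also have "int m * (int c - 1) = int (N * c) + int (n * c) - int n - int N"
      by (simp add: m algebra_simps)
    finally have "int N + int n \<le> int (n * c) + int (n ^ 3)" by linarith
    then show False unfolding N by simp
  qed
next
  assume "\<exists>S\<subseteq>{..<n}. card S = c \<and> independent E S"
  then obtain S where S: "S \<subseteq> {..<n}" "card S = c" "independent E S" by blast
  obtain F where
    F: "\<forall>j<m * m. A j \<subseteq> F j \<and> F j \<subseteq> {..<m}" "nested {..<m * m} F"
    "int (\<Sum>j<m * m. card (F j)) \<le> (\<Sum>i<m. int (card T) - (int (i * i) - int i)) - int (N * c) + int (n ^ 3)"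
    by (rule exists_nested_small[OF S])
  have "(\<Sum>i<m. int (card T) - (int (i * i) - int i)) = int (m * card T) - int (\<Sum>i<m. i * i - i)"
    unfolding sum_diff_id by (simp add: sum_subtractf)
  with F(3) have "int (\<Sum>j<m * m. card (F j)) + int (\<Sum>i<m. i * i - i) + int (N * c) \<le> int (m * card T) + int (n ^ 3)"
    by linarith
  then have "(\<Sum>j<m * m. card (F j)) + (\<Sum>i<m. i * i - i) + N * c \<le> m * card T + n ^ 3"
    by linarith
  then have "(\<Sum>j<m * m. card (F j)) \<le> budget + (\<Sum>j<m * m. card (A j))"
    by (simp add: budget_def ones_def)
  from SC1P_if_nested[OF F(1)[rule_format] F(2) this]
  show "SC1P_by_zero_flips (chain_matrix m (m * m) budget A) budget" by blast
qed

end

subsection \<open>Certificates\<close>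

text \<open>\<open>P a i\<close> means that row \<open>i\<close> is placed at position
  \<open>a\<close>. Injectivity of the placement follows from surjectivity on a finite set. The
  quantifiers are bounded, so an expression can evaluate the property.\<close>

definition perm_rel :: "nat \<Rightarrow> (nat \<Rightarrow> nat \<Rightarrow> bool) \<Rightarrow> bool" where
  "perm_rel m P \<longleftrightarrow> (\<forall>a<m. \<exists>i<m. \<forall>i'<m. P a i' \<longleftrightarrow> i' = i) \<and> (\<forall>i<m. \<exists>a<m. P a i)"

definition row_convex :: "nat \<Rightarrow> nat \<Rightarrow> (nat \<Rightarrow> nat \<Rightarrow> bool) \<Rightarrow> bool" where
  "row_convex m n X \<longleftrightarrow> (\<forall>a<m. \<forall>b<n. \<forall>d<n. \<forall>c<d. b < c \<longrightarrow> X a b \<longrightarrow> X a d \<longrightarrow> X a c)"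

definition num_ones :: "nat \<Rightarrow> nat \<Rightarrow> (nat \<Rightarrow> nat \<Rightarrow> bool) \<Rightarrow> nat" where
  "num_ones m n X = (\<Sum>a<m. card {b. b < n \<and> X a b})"

definition certifies :: "nat \<Rightarrow> nat \<Rightarrow> (nat \<Rightarrow> nat \<Rightarrow> bool) \<Rightarrow> (nat \<Rightarrow> nat \<Rightarrow> bool) \<Rightarrow>
    (nat \<Rightarrow> nat \<Rightarrow> bool) \<Rightarrow> (nat \<Rightarrow> nat \<Rightarrow> bool) \<Rightarrow> bool" where
  "certifies m n M P Q X \<longleftrightarrow> perm_rel m P \<and> perm_rel n Q \<and>
     (\<forall>a<m. \<forall>i<m. \<forall>b<n. \<forall>j<n. P a i \<longrightarrow> Q b j \<longrightarrow> M i j \<longrightarrow> X a b) \<and>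
     row_convex m n X \<and> row_convex n m (\<lambda>b a. X a b)"

lemma num_ones_eq: "num_ones m n X = card {(a, b). a < m \<and> b < n \<and> X a b}"
proof -
  have "{(a, b). a < m \<and> b < n \<and> X a b} = (SIGMA a:{..<m}. {b. b < n \<and> X a b})" by auto
  then show ?thesis by (simp add: num_ones_def)
qed

lemma perm_relE:
  assumes "perm_rel m P"
  obtains \<pi> where "\<pi> permutes {..<m}" "\<And>a i. a < m \<Longrightarrow> i < m \<Longrightarrow> P a i \<longleftrightarrow> i = \<pi> a"
proof -
  have "\<forall>a. \<exists>i. a < m \<longrightarrow> i < m \<and> (\<forall>i'<m. P a i' \<longleftrightarrow> i' = i)"
    using assms unfolding perm_rel_def by blast
  then obtain f where f: "\<And>a. a < m \<Longrightarrow> f a < m \<and> (\<forall>i'<m. P a i' \<longleftrightarrow> i' = f a)"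
    using choice[of "\<lambda>a i. a < m \<longrightarrow> i < m \<and> (\<forall>i'<m. P a i' \<longleftrightarrow> i' = i)"] by auto
  define \<pi> where "\<pi> a = (if a < m then f a else a)" for a
  have "\<pi> ` {..<m} = {..<m}"
  proof (intro equalityI subsetI)
    fix i assume i: "i \<in> {..<m}"
    then obtain a where a: "a < m" "P a i" using assms unfolding perm_rel_def by auto
    then have "i = \<pi> a" using f[of a] i by (simp add: \<pi>_def)
    then show "i \<in> \<pi> ` {..<m}" using a by simp
  qed (use f in \<open>auto simp: \<pi>_def\<close>)
  then have "bij_betw \<pi> {..<m} {..<m}"
    by (simp add: bij_betw_def eq_card_imp_inj_on)
  then have "\<pi> permutes {..<m}" by (rule bij_imp_permutes) (simp add: \<pi>_def)
  then show thesis by (rule that) (use f in \<open>simp add: \<pi>_def\<close>)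
qed

lemma perm_rel_permutes:
  assumes "\<pi> permutes {..<m}"
  shows "perm_rel m (\<lambda>a i. i = \<pi> a)"
proof -
  have "\<pi> a < m" if "a < m" for a using permutes_in_image[OF assms, of a] that by simp
  moreover have "\<exists>a<m. i = \<pi> a" if "i < m" for i
    using permutes_image[OF assms] that by (auto simp: set_eq_iff image_iff)
  ultimately show ?thesis unfolding perm_rel_def by auto
qed

lemma row_convex_iff: "row_convex m n X \<longleftrightarrow> (\<forall>a<m. consecutive {b. b < n \<and> X a b})"
  unfolding row_convex_def consecutive_def by auto

lemma card_permuted_entries:
  assumes "\<pi> permutes {..<m}" "\<sigma> permutes {..<n}"
  shows "card {(a, b). a < m \<and> b < n \<and> Y (\<pi> a) (\<sigma> b)} = card {(i, j). i < m \<and> j < n \<and> Y i j}"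
proof (rule bij_betw_same_card)
  have lt: "\<pi> a < m \<longleftrightarrow> a < m" "\<sigma> b < n \<longleftrightarrow> b < n" for a b
    using permutes_in_image[OF assms(1), of a] permutes_in_image[OF assms(2), of b] by simp_all
  have "inj (map_prod \<pi> \<sigma>)"
    using assms by (intro prod.inj_map permutes_inj)
  moreover have "map_prod \<pi> \<sigma> ` {(a, b). a < m \<and> b < n \<and> Y (\<pi> a) (\<sigma> b)} = {(i, j). i < m \<and> j < n \<and> Y i j}"
  proof (intro equalityI subsetI)
    fix e assume "e \<in> {(i, j). i < m \<and> j < n \<and> Y i j}"
    then obtain i j where e: "e = (i, j)" "i < m" "j < n" "Y i j" by blast
    obtain a where "i = \<pi> a" by (rule surjE[OF permutes_surj[OF assms(1)]])
    obtain b where "j = \<sigma> b" by (rule surjE[OF permutes_surj[OF assms(2)]])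
    note ab = \<open>i = \<pi> a\<close> \<open>j = \<sigma> b\<close>
    then show "e \<in> map_prod \<pi> \<sigma> ` {(a, b). a < m \<and> b < n \<and> Y (\<pi> a) (\<sigma> b)}"
      using e lt ab by (intro image_eqI[of _ _ "(a, b)"]) simp_all
  qed (auto simp: lt)
  ultimately show "bij_betw (map_prod \<pi> \<sigma>) {(a, b). a < m \<and> b < n \<and> Y (\<pi> a) (\<sigma> b)}
      {(i, j). i < m \<and> j < n \<and> Y i j}"
    unfolding bij_betw_def using inj_on_subset[OF _ subset_UNIV] by blast
qed

text \<open>\<open>X\<close> is the flipped matrix after permuting, so its ones are consecutive as
  it stands. It dominates the permuted \<open>M\<close>, and permutations preserve the number of
  ones; hence the number of flips is a difference of two counts.\<close>

lemma SC1P_by_zero_flips_iff: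
  fixes M :: "nat \<Rightarrow> nat \<Rightarrow> bool"
  shows "SC1P_by_zero_flips (mat m n (\<lambda>(i, j). M i j)) k \<longleftrightarrow>
    (\<exists>P Q X. certifies m n M P Q X \<and> num_ones m n X \<le> num_ones m n M + k)"
proof
  let ?M = "mat m n (\<lambda>(i, j). M i j)"
  assume "SC1P_by_zero_flips ?M k"
  then obtain F where F: "F \<subseteq> zero_entries ?M" "card F \<le> k" "SC1P (flip_zeros ?M F)"
    unfolding SC1P_by_zero_flips_def by blast
  let ?Y = "\<lambda>i j. flip_zeros ?M F $$ (i, j)"
  have Y: "?Y i j \<longleftrightarrow> (i, j) \<in> F \<or> M i j" if "i < m" "j < n" for i j
    using that by (simp add: flip_zeros_def)
  obtain \<sigma> where \<sigma>: "\<sigma> permutes {..<n}" "\<forall>i<m. consecutive {j. j < n \<and> ?Y i (\<sigma> j)}"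
    using F(3) by (auto simp: SC1P_def C1P_rows_def flip_zeros_def)
  obtain \<pi> where \<pi>: "\<pi> permutes {..<m}" "\<forall>j<n. consecutive {i. i < m \<and> ?Y (\<pi> i) j}"
    using F(3) by (auto simp: SC1P_def C1P_cols_def flip_zeros_def)
  have lt: "\<pi> a < m \<longleftrightarrow> a < m" "\<sigma> b < n \<longleftrightarrow> b < n" for a b
    using permutes_in_image[OF \<pi>(1), of a] permutes_in_image[OF \<sigma>(1), of b] by simp_all
  let ?X = "\<lambda>a b. ?Y (\<pi> a) (\<sigma> b)"
  have "certifies m n M (\<lambda>a i. i = \<pi> a) (\<lambda>b j. j = \<sigma> b) ?X"
    using perm_rel_permutes \<pi> \<sigma> by (simp add: certifies_def row_convex_iff lt Y)
  moreover have "num_ones m n ?X \<le> num_ones m n M + k"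
  proof -
    have finF: "finite F"
      by (rule finite_subset[OF F(1)]) (rule finite_subset[of _ "{..<m} \<times> {..<n}"], auto simp: zero_entries_def)
    have fin: "finite {(i, j). i < m \<and> j < n \<and> M i j}"
      by (rule finite_subset[of _ "{..<m} \<times> {..<n}"]) auto
    have "num_ones m n ?X = card {(i, j). i < m \<and> j < n \<and> ?Y i j}"
      unfolding num_ones_eq by (rule card_permuted_entries[OF \<pi>(1) \<sigma>(1)])
    also have "\<dots> \<le> card ({(i, j). i < m \<and> j < n \<and> M i j} \<union> F)"
      by (rule card_mono) (use fin finF Y in auto)
    also have "\<dots> \<le> card {(i, j). i < m \<and> j < n \<and> M i j} + card F" by (rule card_Un_le)
    finally show ?thesis using F(2) by (simp add: num_ones_eq)
  qed
  ultimately show "\<exists>P Q X. certifies m n M P Q X \<and> num_ones m n X \<le> num_ones m n M + k" by blast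
next
  let ?M = "mat m n (\<lambda>(i, j). M i j)"
  assume "\<exists>P Q X. certifies m n M P Q X \<and> num_ones m n X \<le> num_ones m n M + k"
  then obtain P Q X where c: "certifies m n M P Q X" and le: "num_ones m n X \<le> num_ones m n M + k" by blast
  obtain \<pi> where \<pi>: "\<pi> permutes {..<m}" "\<And>a i. a < m \<Longrightarrow> i < m \<Longrightarrow> P a i \<longleftrightarrow> i = \<pi> a"
    using c perm_relE[of m P] by (auto simp: certifies_def)
  obtain \<sigma> where \<sigma>: "\<sigma> permutes {..<n}" "\<And>b j. b < n \<Longrightarrow> j < n \<Longrightarrow> Q b j \<longleftrightarrow> j = \<sigma> b"
    using c perm_relE[of n Q] by (auto simp: certifies_def)
  have lt: "\<pi> a < m \<longleftrightarrow> a < m" "\<sigma> b < n \<longleftrightarrow> b < n" for a b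
    using permutes_in_image[OF \<pi>(1), of a] permutes_in_image[OF \<sigma>(1), of b] by simp_all
  have MX: "X a b" if "a < m" "b < n" "M (\<pi> a) (\<sigma> b)" for a b
  proof -
    have "P a (\<pi> a)" "Q b (\<sigma> b)" "\<pi> a < m" "\<sigma> b < n" using that \<pi>(2) \<sigma>(2) lt by simp_all
    then show ?thesis using c that unfolding certifies_def by blast
  qed
  define \<pi>' \<sigma>' where "\<pi>' = inv_into UNIV \<pi>" and "\<sigma>' = inv_into UNIV \<sigma>"
  have inv: "\<pi>' (\<pi> a) = a" "\<pi> (\<pi>' a) = a" "\<sigma>' (\<sigma> b) = b" "\<sigma> (\<sigma>' b) = b" for a b
    using permutes_inverses[OF \<pi>(1)] permutes_inverses[OF \<sigma>(1)] by (simp_all add: \<pi>'_def \<sigma>'_def)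
  let ?Y = "\<lambda>i j. X (\<pi>' i) (\<sigma>' j)"
  have lt': "\<pi>' i < m \<longleftrightarrow> i < m" "\<sigma>' j < n \<longleftrightarrow> j < n" for i j
    using lt(1)[of "\<pi>' i"] lt(2)[of "\<sigma>' j"] by (simp_all add: inv)
  have MY: "?Y i j" if "i < m" "j < n" "M i j" for i j
    using MX[of "\<pi>' i" "\<sigma>' j"] that lt' by (simp add: inv)
  define F where "F = {(i, j). i < m \<and> j < n \<and> ?Y i j \<and> \<not> M i j}"
  have flip: "flip_zeros ?M F $$ (i, j) \<longleftrightarrow> ?Y i j" if "i < m" "j < n" for i j
    using that MY by (auto simp: flip_zeros_def F_def)
  have dims: "dim_row (flip_zeros ?M F) = m" "dim_col (flip_zeros ?M F) = n" by (simp_all add: flip_zeros_def)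
  have "F \<subseteq> zero_entries ?M" by (auto simp: F_def zero_entries_def)
  moreover have "card F \<le> k"
  proof -
    have fin: "finite {(i, j). i < m \<and> j < n \<and> Z i j}" for Z
      by (rule finite_subset[of _ "{..<m} \<times> {..<n}"]) auto
    have "{(i, j). i < m \<and> j < n \<and> ?Y i j} = {(i, j). i < m \<and> j < n \<and> M i j} \<union> F"
      using MY by (auto simp: F_def)
    moreover have "card ({(i, j). i < m \<and> j < n \<and> M i j} \<union> F) = card {(i, j). i < m \<and> j < n \<and> M i j} + card F"
      by (rule card_Un_disjoint) (use fin in \<open>auto simp: F_def\<close>)
    moreover have "card {(i, j). i < m \<and> j < n \<and> ?Y i j} = num_ones m n X"
      using card_permuted_entries[OF \<pi>(1) \<sigma>(1), of ?Y] by (simp add: inv num_ones_eq)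
    ultimately show ?thesis using le by (simp add: num_ones_eq)
  qed
  moreover have "C1P_rows (flip_zeros ?M F)"
  proof -
    have "consecutive {j. j < n \<and> flip_zeros ?M F $$ (i, \<sigma> j)}" if "i < m" for i
    proof -
      have "{j. j < n \<and> flip_zeros ?M F $$ (i, \<sigma> j)} = {b. b < n \<and> X (\<pi>' i) b}"
        using that by (auto simp: flip lt inv simp del: index_flip_zeros)
      then show ?thesis using c that lt' by (simp add: certifies_def row_convex_iff)
    qed
    then show ?thesis using \<sigma>(1) unfolding C1P_rows_def dims by blast
  qed
  moreover have "C1P_cols (flip_zeros ?M F)"
  proof -
    have "consecutive {i. i < m \<and> flip_zeros ?M F $$ (\<pi> i, j)}" if "j < n" for j
    proof -
      have "{i. i < m \<and> flip_zeros ?M F $$ (\<pi> i, j)} = {a. a < m \<and> X a (\<sigma>' j)}"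
        using that by (auto simp: flip lt inv simp del: index_flip_zeros)
      then show ?thesis using c that lt' by (simp add: certifies_def row_convex_iff)
    qed
    then show ?thesis using \<pi>(1) unfolding C1P_cols_def dims by blast
  qed
  ultimately show "SC1P_by_zero_flips ?M k"
    unfolding SC1P_by_zero_flips_def SC1P_def by blast
qed

subsection \<open>Membership in NP\<close>

text \<open>Positions out of range count as False, in agreement with \<open>Bit\<close>; thus
  formulas about encodings need no length conditions.\<close>

definition nthb :: "bool list \<Rightarrow> nat \<Rightarrow> bool" where
  "nthb xs i \<longleftrightarrow> i < length xs \<and> xs ! i"

lemma eval_Bit_nthb [simp]: "eval x s (Bit e) = of_bool (nthb x (eval x s e))"
  by (simp add: nthb_def)

declare eval.simps(4) [simp del]

lemma nthb_unary: "nthb (unary m @ ys) i \<longleftrightarrow> i < m \<or> m < i \<and> nthb ys (i - (m + 1))"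
proof -
  consider "i < m" | "i = m" | "m < i" by linarith
  then show ?thesis
  proof cases
    case 3
    then have "i - m = Suc (i - (m + 1))" by simp
    then show ?thesis using 3 by (auto simp: nthb_def unary_def nth_append)
  qed (simp_all add: nthb_def unary_def nth_append)
qed

lemma nthb_append: "nthb (xs @ ys) i \<longleftrightarrow> (if i < length xs then xs ! i else nthb ys (i - length xs))"
  by (auto simp: nthb_def nth_append)

lemma nthb_drop: "nthb (drop k xs) i \<longleftrightarrow> nthb xs (k + i)"
  by (auto simp: nthb_def)

lemma unary_prefix:
  assumes "\<forall>i<m. nthb xs i" "\<not> nthb xs m" "m < length xs"
  shows "xs = unary m @ drop (m + 1) xs"
proof -
  have "xs = take m xs @ xs ! m # drop (Suc m) xs" using assms(3) by (rule id_take_nth_drop)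
  moreover have "take m xs = replicate m True"
    using assms(1,3) by (intro nth_equalityI) (auto simp: nthb_def)
  moreover have "\<not> xs ! m" using assms(2,3) by (simp add: nthb_def)
  ultimately show ?thesis by (simp add: unary_def)
qed

lemma entry_list_flat: "entry_list M = map (\<lambda>q. M $$ (q div dim_col M, q mod dim_col M)) [0..<dim_row M * dim_col M]"
proof -
  let ?n = "dim_col M"
  have "concat (map (\<lambda>i. map (\<lambda>j. M $$ (i, j)) [0..<?n]) [0..<r]) =
      map (\<lambda>q. M $$ (q div ?n, q mod ?n)) [0..<r * ?n]" for r
  proof (induction r)
    case (Suc r)
    have "(r * ?n + j) div ?n = r" "(r * ?n + j) mod ?n = j" if "j < ?n" for j
      using that by simp_all
    then have "map (\<lambda>j. M $$ (r, j)) [0..<?n] = map (\<lambda>q. M $$ (q div ?n, q mod ?n)) [r * ?n..<r * ?n + ?n]"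
      by (intro nth_equalityI) (simp_all del: div_mult_self3 div_mult_self4 mod_mult_self3 mod_mult_self4)
    moreover have "[0..<Suc r * ?n] = [0..<r * ?n] @ [r * ?n..<r * ?n + ?n]"
      unfolding mult_Suc add.commute[of ?n] by (rule upt_add_eq_append) simp
    ultimately show ?case using Suc by simp
  qed simp
  then show ?thesis by (simp add: entry_list_def)
qed

lemma length_entry_list: "length (entry_list M) = dim_row M * dim_col M"
  by (simp add: entry_list_flat)

text \<open>Explicit decoding: the two unary dimensions with their terminators occupy
  \<open>m + n + 2\<close> positions, the entries the next \<open>m * n\<close>, and the rest is the
  budget.\<close>

lemma in_language_iff:
  "xs \<in> SC1P_zero_flipping \<longleftrightarrow> (\<exists>m n k. m + n + 2 + m * n \<le> length xs \<and>
     (\<forall>i<m. nthb xs i) \<and> \<not> nthb xs m \<and> (\<forall>i<n. nthb xs (m + 1 + i)) \<and> \<not> nthb xs (m + 1 + n) \<and>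
     binary k = drop (m + n + 2 + m * n) xs \<and>
     SC1P_by_zero_flips (mat m n (\<lambda>(i, j). nthb xs (m + n + 2 + i * n + j))) k)"
proof
  assume "xs \<in> SC1P_zero_flipping"
  then obtain M k where xs: "xs = encode_instance M k" and M: "SC1P_by_zero_flips M k"
    by (auto simp: SC1P_zero_flipping_def)
  let ?m = "dim_row M" and ?n = "dim_col M"
  have nth: "nthb xs (?m + 1 + i) \<longleftrightarrow> nthb (unary ?n @ entry_list M @ binary k) i" for i
    by (simp add: xs encode_instance_def nthb_unary)
  have nth2: "nthb xs (?m + ?n + 2 + i) \<longleftrightarrow> nthb (entry_list M @ binary k) i" for i
    using nth[of "?n + 1 + i"] by (simp add: nthb_unary add.assoc)
  have "mat ?m ?n (\<lambda>(i, j). nthb xs (?m + ?n + 2 + i * ?n + j)) = M"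
  proof (rule eq_matI)
    fix i j assume ij: "i < ?m" "j < ?n"
    have "i * ?n + j < (i + 1) * ?n" using ij by simp
    also have "\<dots> \<le> ?m * ?n" using ij by (intro mult_right_mono) auto
    finally have lt: "i * ?n + j < ?m * ?n" .
    have "nthb xs (?m + ?n + 2 + i * ?n + j) \<longleftrightarrow> nthb (entry_list M @ binary k) (i * ?n + j)"
      using nth2[of "i * ?n + j"] by (simp add: add.assoc)
    also have "\<dots> \<longleftrightarrow> M $$ (i, j)"
      using lt ij by (simp add: nthb_append length_entry_list) (simp add: entry_list_flat)
    finally show "mat ?m ?n (\<lambda>(i, j). nthb xs (?m + ?n + 2 + i * ?n + j)) $$ (i, j) = M $$ (i, j)"
      using ij by simp
  qed simp_all
  moreover have "?m + ?n + 2 + ?m * ?n \<le> length xs"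
    by (simp add: xs encode_instance_def length_entry_list unary_def)
  moreover have "binary k = drop (?m + ?n + 2 + ?m * ?n) xs"
    by (simp add: xs encode_instance_def length_entry_list unary_def)
  moreover have "\<forall>i<?m. nthb xs i" "\<not> nthb xs ?m"
    by (simp_all add: xs encode_instance_def nthb_unary)
  moreover have "\<forall>i<?n. nthb xs (?m + 1 + i)" "\<not> nthb xs (?m + 1 + ?n)"
    unfolding nth by (simp_all add: nthb_unary)
  ultimately show "\<exists>m n k. m + n + 2 + m * n \<le> length xs \<and>
     (\<forall>i<m. nthb xs i) \<and> \<not> nthb xs m \<and> (\<forall>i<n. nthb xs (m + 1 + i)) \<and> \<not> nthb xs (m + 1 + n) \<and>
     binary k = drop (m + n + 2 + m * n) xs \<and>
     SC1P_by_zero_flips (mat m n (\<lambda>(i, j). nthb xs (m + n + 2 + i * n + j))) k"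
    using M by (intro exI[of _ ?m] exI[of _ ?n] exI[of _ k]) simp
next
  assume "\<exists>m n k. m + n + 2 + m * n \<le> length xs \<and>
     (\<forall>i<m. nthb xs i) \<and> \<not> nthb xs m \<and> (\<forall>i<n. nthb xs (m + 1 + i)) \<and> \<not> nthb xs (m + 1 + n) \<and>
     binary k = drop (m + n + 2 + m * n) xs \<and>
     SC1P_by_zero_flips (mat m n (\<lambda>(i, j). nthb xs (m + n + 2 + i * n + j))) k"
  then obtain m n k where le: "m + n + 2 + m * n \<le> length xs" and
    m: "\<forall>i<m. nthb xs i" "\<not> nthb xs m" and n: "\<forall>i<n. nthb xs (m + 1 + i)" "\<not> nthb xs (m + 1 + n)" and
    k: "binary k = drop (m + n + 2 + m * n) xs" and
    sc: "SC1P_by_zero_flips (mat m n (\<lambda>(i, j). nthb xs (m + n + 2 + i * n + j))) k" by blast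
  let ?M = "mat m n (\<lambda>(i, j). nthb xs (m + n + 2 + i * n + j))"
  define ys where "ys = drop (m + 1) xs"
  define zs where "zs = drop (n + 1) ys"
  have xs: "xs = unary m @ ys" unfolding ys_def by (rule unary_prefix) (use m le in auto)
  have nthy: "nthb ys i \<longleftrightarrow> nthb xs (m + 1 + i)" for i by (simp add: ys_def nthb_drop)
  have ys: "ys = unary n @ zs" unfolding zs_def
    by (rule unary_prefix) (use n le in \<open>auto simp: nthy\<close>, simp add: ys_def)
  have nthz: "nthb zs i \<longleftrightarrow> nthb xs (m + n + 2 + i)" for i
    using nthy[of "n + 1 + i"] by (simp add: zs_def nthb_drop add.assoc)
  have lz: "m * n \<le> length zs" using le by (simp add: zs_def ys_def)
  have "entry_list ?M = take (m * n) zs"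
  proof (rule nth_equalityI)
    fix q assume "q < length (entry_list ?M)"
    then have q: "q < m * n" by (simp add: length_entry_list)
    then have "0 < n" by (cases n) auto
    then have qq: "q div n < m" "q mod n < n" using q by (simp_all add: less_mult_imp_div_less)
    have "m + n + 2 + q div n * n + q mod n = m + n + 2 + q" by (simp add: add.assoc)
    then have "nthb xs (m + n + 2 + q div n * n + q mod n) \<longleftrightarrow> nthb zs q" by (simp only: nthz)
    then show "entry_list ?M ! q = take (m * n) zs ! q"
      using q qq lz by (simp add: entry_list_flat nthb_def)
  qed (use lz in \<open>simp add: length_entry_list\<close>)
  moreover have "binary k = drop (m * n) zs" by (simp add: k zs_def ys_def add.assoc add.commute add.left_commute)
  ultimately have "zs = entry_list ?M @ binary k" by simp
  then have "xs = encode_instance ?M k" using xs ys by (simp add: encode_instance_def)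
  then show "xs \<in> SC1P_zero_flipping" using sc by (auto simp: SC1P_zero_flipping_def)
qed

text \<open>The last bit is the most significant one, so absence of leading zeros means that it is
  set. The witness for the converse is the Horner sum of the bits.\<close>

lemma ex_binary_iff: "(\<exists>k. binary k = bs) \<longleftrightarrow> bs = [] \<or> last bs"
proof
  assume "\<exists>k. binary k = bs"
  then obtain k where k: "bs = binary k" by blast
  show "bs = [] \<or> last bs"
  proof (cases "floorlog 2 k")
    case 0
    then show ?thesis by (simp add: k binary_def)
  next
    case (Suc l)
    have "2 ^ l \<le> k" using floorlog_le_iff[of 2 k l] Suc by simp
    moreover have "k < 2 ^ Suc l" using floorlog_le_iff[of 2 k "Suc l"] Suc by simp
    ultimately have "k div 2 ^ l = 1" by (intro div_nat_eqI) simp_all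
    then show ?thesis by (simp add: k binary_def Suc bit_iff_odd)
  qed
next
  assume bs: "bs = [] \<or> last bs"
  define k :: nat where "k = horner_sum of_bool 2 bs"
  have bit: "bit k i \<longleftrightarrow> i < length bs \<and> bs ! i" for i
    unfolding k_def bit_horner_sum_bit_iff by simp
  have "floorlog 2 k = length bs"
  proof (rule antisym)
    show "floorlog 2 k \<le> length bs"
      unfolding k_def by (rule floorlog_leI[OF horner_sum_of_bool_2_less]) simp_all
    show "length bs \<le> floorlog 2 k"
    proof (cases "bs = []")
      case False
      then have "bit k (length bs - 1)" using bs by (simp add: bit last_conv_nth)
      then have "k div 2 ^ (length bs - 1) \<noteq> 0" unfolding bit_iff_odd by (intro notI) simp
      then have "2 ^ (length bs - 1) \<le> k" by (simp add: div_eq_0_iff)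
      then show ?thesis by (intro floorlog_geI) simp_all
    qed simp
  qed
  then have "binary k = bs" by (intro nth_equalityI) (simp_all add: binary_def bit)
  then show "\<exists>k. binary k = bs" by blast
qed

lemma num_ones_cong:
  "(\<And>a b. a < m \<Longrightarrow> b < n \<Longrightarrow> X a b \<longleftrightarrow> Y a b) \<Longrightarrow> num_ones m n X = num_ones m n Y"
  unfolding num_ones_def by (intro sum.cong refl arg_cong[of _ _ card]) auto

lemma certifies_cong:
  assumes "\<And>a i. a < m \<Longrightarrow> i < m \<Longrightarrow> P a i \<longleftrightarrow> P' a i" "\<And>b j. b < n \<Longrightarrow> j < n \<Longrightarrow> Q b j \<longleftrightarrow> Q' b j"
    "\<And>a b. a < m \<Longrightarrow> b < n \<Longrightarrow> X a b \<longleftrightarrow> X' a b"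
  shows "certifies m n M P Q X \<longleftrightarrow> certifies m n M P' Q' X'"
proof -
  have "perm_rel m P \<longleftrightarrow> perm_rel m P'" "perm_rel n Q \<longleftrightarrow> perm_rel n Q'"
    using assms(1,2) by (simp_all add: perm_rel_def cong: conj_cong)
  moreover have "row_convex m n X \<longleftrightarrow> row_convex m n X'"
    "row_convex n m (\<lambda>b a. X a b) \<longleftrightarrow> row_convex n m (\<lambda>b a. X' a b)"
    using assms(3) by (simp_all add: row_convex_def)
  ultimately show ?thesis using assms by (simp add: certifies_def)
qed

definition cert_bits :: "nat \<Rightarrow> nat \<Rightarrow> (nat \<Rightarrow> nat \<Rightarrow> bool) \<Rightarrow> (nat \<Rightarrow> nat \<Rightarrow> bool) \<Rightarrow> (nat \<Rightarrow> nat \<Rightarrow> bool) \<Rightarrow> bool list" where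
  "cert_bits m n P Q X = map (\<lambda>q. P (q div m) (q mod m)) [0..<m * m] @
     map (\<lambda>q. Q (q div n) (q mod n)) [0..<n * n] @ map (\<lambda>q. X (q div n) (q mod n)) [0..<m * n]"

lemma index_less_mult: "a < m \<Longrightarrow> b < n \<Longrightarrow> a * n + b < m * n" for a b :: nat
proof -
  assume "a < m" "b < n"
  then have "a * n + b < (a + 1) * n" by simp
  also have "\<dots> \<le> m * n" using \<open>a < m\<close> by (intro mult_right_mono) auto
  finally show ?thesis .
qed

lemma nthb_map_upt: "nthb (map f [0..<k]) q \<longleftrightarrow> q < k \<and> f q"
  by (auto simp: nthb_def)

lemma nthb_cert_bits:
  "a < m \<Longrightarrow> i < m \<Longrightarrow> nthb (cert_bits m n P Q X) (a * m + i) \<longleftrightarrow> P a i"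
  "b < n \<Longrightarrow> j < n \<Longrightarrow> nthb (cert_bits m n P Q X) (m * m + (b * n + j)) \<longleftrightarrow> Q b j"
  "a < m \<Longrightarrow> b < n \<Longrightarrow> nthb (cert_bits m n P Q X) (m * m + n * n + (a * n + b)) \<longleftrightarrow> X a b"
proof -
  assume "a < m" "i < m"
  then show "nthb (cert_bits m n P Q X) (a * m + i) \<longleftrightarrow> P a i"
    using index_less_mult[of a m i m] by (simp add: cert_bits_def nthb_append)
next
  assume "b < n" "j < n"
  then show "nthb (cert_bits m n P Q X) (m * m + (b * n + j)) \<longleftrightarrow> Q b j"
    using index_less_mult[of b n j n] by (simp add: cert_bits_def nthb_append)
next
  assume "a < m" "b < n"
  then show "nthb (cert_bits m n P Q X) (m * m + n * n + (a * n + b)) \<longleftrightarrow> X a b"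
    using index_less_mult[of a m b n] by (simp add: cert_bits_def nthb_append nthb_map_upt)
qed

text \<open>Here \<open>x\<close> gives the bits of the instance, which has length \<open>N\<close>, and \<open>u\<close> those of the certificate.\<close>

definition verifies :: "nat \<Rightarrow> (nat \<Rightarrow> bool) \<Rightarrow> (nat \<Rightarrow> bool) \<Rightarrow> nat \<Rightarrow> nat \<Rightarrow> bool" where
  "verifies N x u m n \<longleftrightarrow> m + n + 2 + m * n \<le> N \<and>
     (\<forall>i<m. x i) \<and> \<not> x m \<and> (\<forall>i<n. x (m + 1 + i)) \<and> \<not> x (m + 1 + n) \<and>
     (m + n + 2 + m * n = N \<or> x (N - 1)) \<and>
     certifies m n (\<lambda>i j. x (m + n + 2 + i * n + j)) (\<lambda>a i. u (a * m + i)) (\<lambda>b j. u (m * m + (b * n + j)))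
       (\<lambda>a b. u (m * m + n * n + (a * n + b))) \<and>
     (\<forall>k<num_ones m n (\<lambda>a b. u (m * m + n * n + (a * n + b))) - num_ones m n (\<lambda>i j. x (m + n + 2 + i * n + j)).
        \<not> (N - (m + n + 2 + m * n) = card (powers_below (Suc k)) \<and>
           (\<forall>p<Suc k. (\<exists>i. p = 2 ^ i) \<longrightarrow> x (m + n + 2 + m * n + card (powers_below p)) = odd (k div p))))"

lemma verifies_bound: "verifies N x u m n \<Longrightarrow> m < N \<and> n < N"
  by (simp add: verifies_def)

lemma drop_eq_binary_iff:
  assumes "s \<le> length xs"
  shows "drop s xs = binary k \<longleftrightarrow> length xs - s = card (powers_below (Suc k)) \<and>
    (\<forall>p<Suc k. (\<exists>i. p = 2 ^ i) \<longrightarrow> nthb xs (s + card (powers_below p)) = odd (k div p))"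
proof -
  have nth: "nthb xs (s + card (powers_below p)) = drop s xs ! card (powers_below p)"
    if "length xs - s = card (powers_below (Suc k))" "p \<in> powers_below (Suc k)" for p
  proof -
    have "p < Suc k" using that(2) by (simp add: powers_below_def)
    then have "powers_below p \<subseteq> powers_below (Suc k)"
      unfolding powers_below_def using less_trans by blast
    moreover have "p \<notin> powers_below p" by (simp add: powers_below_def)
    ultimately have "powers_below p \<subset> powers_below (Suc k)" using that(2) by blast
    then have "card (powers_below p) < card (powers_below (Suc k))"
      by (intro psubset_card_mono) (simp_all add: powers_below_def)
    then have "s + card (powers_below p) < length xs" using that(1) assms by linarith
    then show ?thesis using assms by (simp add: nthb_def)
  qed
  have ball: "(\<forall>p<Suc k. (\<exists>i. p = 2 ^ i) \<longrightarrow> R p) \<longleftrightarrow> (\<forall>p\<in>powers_below (Suc k). R p)" for R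
    unfolding powers_below_def by blast
  show ?thesis
  proof (cases "length xs - s = card (powers_below (Suc k))")
    case True
    have "(\<forall>p\<in>powers_below (Suc k). nthb xs (s + card (powers_below p)) = odd (k div p)) \<longleftrightarrow>
        (\<forall>p\<in>powers_below (Suc k). drop s xs ! card (powers_below p) = odd (k div p))"
      by (rule ball_cong[OF refl]) (simp only: nth[OF True])
    then show ?thesis unfolding binary_iff length_drop ball using True by blast
  next
    case False
    then show ?thesis unfolding binary_iff length_drop by blast
  qed
qed

text \<open>\<open>verifies\<close> never mentions the value of the budget: it requires that the
  tail encodes some number and rejects those encodings that are too small.\<close>

lemma in_language_iff_verifies:
  "xs \<in> SC1P_zero_flipping \<longleftrightarrow>
    (\<exists>us. length us \<le> 3 * length xs ^ 2 \<and> (\<exists>m n. verifies (length xs) (nthb xs) (nthb us) m n))"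
proof
  assume "xs \<in> SC1P_zero_flipping"
  then obtain m n k where le: "m + n + 2 + m * n \<le> length xs" and
    m: "\<forall>i<m. nthb xs i" "\<not> nthb xs m" and n: "\<forall>i<n. nthb xs (m + 1 + i)" "\<not> nthb xs (m + 1 + n)" and
    k: "binary k = drop (m + n + 2 + m * n) xs" and
    sc: "SC1P_by_zero_flips (mat m n (\<lambda>(i, j). nthb xs (m + n + 2 + i * n + j))) k"
    unfolding in_language_iff by blast
  let ?M = "\<lambda>i j. nthb xs (m + n + 2 + i * n + j)"
  obtain P Q X where c: "certifies m n ?M P Q X" "num_ones m n X \<le> num_ones m n ?M + k"
    using sc unfolding SC1P_by_zero_flips_iff by blast
  let ?us = "cert_bits m n P Q X"
  have "drop (m + n + 2 + m * n) xs = [] \<or> last (drop (m + n + 2 + m * n) xs)"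
    unfolding ex_binary_iff[symmetric] using k by blast
  then have tail: "m + n + 2 + m * n = length xs \<or> nthb xs (length xs - 1)"
  proof (cases "m + n + 2 + m * n < length xs")
    case True
    then have "last (drop (m + n + 2 + m * n) xs)" using \<open>_ \<or> last _\<close> by simp
    then have "last xs" using True by (simp only: last_drop)
    moreover have "xs \<noteq> []" using True by auto
    ultimately show ?thesis by (simp add: nthb_def last_conv_nth)
  qed (use le in simp)
  have "certifies m n ?M (\<lambda>a i. nthb ?us (a * m + i)) (\<lambda>b j. nthb ?us (m * m + (b * n + j)))
      (\<lambda>a b. nthb ?us (m * m + n * n + (a * n + b)))"
    using c(1) by (rule certifies_cong[THEN iffD2, rotated -1]) (simp_all only: nthb_cert_bits)
  moreover have ones: "num_ones m n (\<lambda>a b. nthb ?us (m * m + n * n + (a * n + b))) = num_ones m n X"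
    by (rule num_ones_cong) (simp only: nthb_cert_bits)
  \<comment> \<open>\<open>binary\<close> is injective, so the tail, being the encoding of
    \<open>k\<close>, encodes no number below the required count of flips.\<close>
  moreover have "drop (m + n + 2 + m * n) xs \<noteq> binary k'" if "k' < num_ones m n X - num_ones m n ?M" for k'
    using that c(2) unfolding k[symmetric] binary_inject by linarith
  ultimately have "verifies (length xs) (nthb xs) (nthb ?us) m n"
    unfolding verifies_def ones drop_eq_binary_iff[OF le, symmetric] using le m n tail by simp
  \<comment> \<open>Each of the three matrices has at most \<open>length xs ^ 2\<close> entries,
    since both dimensions are written in unary.\<close>
  moreover have "length ?us \<le> 3 * length xs ^ 2"
  proof -
    have mn: "m \<le> length xs" "n \<le> length xs" using le by simp_all
    have "m * m \<le> length xs * length xs" "n * n \<le> length xs * length xs" "m * n \<le> length xs * length xs"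
      by (intro mult_mono mn; simp)+
    then show ?thesis by (simp add: cert_bits_def power2_eq_square)
  qed
  ultimately show "\<exists>us. length us \<le> 3 * length xs ^ 2 \<and> (\<exists>m n. verifies (length xs) (nthb xs) (nthb us) m n)"
    by blast
next
  assume "\<exists>us. length us \<le> 3 * length xs ^ 2 \<and> (\<exists>m n. verifies (length xs) (nthb xs) (nthb us) m n)"
  then obtain us m n where v: "verifies (length xs) (nthb xs) (nthb us) m n" by blast
  let ?M = "\<lambda>i j. nthb xs (m + n + 2 + i * n + j)"
  let ?X = "\<lambda>a b. nthb us (m * m + n * n + (a * n + b))"
  have le: "m + n + 2 + m * n \<le> length xs" using v by (simp add: verifies_def)
  have "drop (m + n + 2 + m * n) xs = [] \<or> last (drop (m + n + 2 + m * n) xs)"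
  proof (cases "m + n + 2 + m * n = length xs")
    case False
    then have "nthb xs (length xs - 1)" using v by (simp add: verifies_def)
    then have "last xs" by (cases "xs = []") (simp_all add: nthb_def last_conv_nth)
    then show ?thesis using le False by simp
  qed simp
  then have "\<exists>k. binary k = drop (m + n + 2 + m * n) xs"
    by (rule ex_binary_iff[THEN iffD2])
  then obtain k where k: "binary k = drop (m + n + 2 + m * n) xs" by (elim exE)
  have no_k: "\<forall>k'<num_ones m n ?X - num_ones m n ?M. drop (m + n + 2 + m * n) xs \<noteq> binary k'"
    using v unfolding drop_eq_binary_iff[OF le] verifies_def by (elim conjE)
  \<comment> \<open>The tail encodes \<open>k\<close>, while all encodings of numbers below the
    difference have been excluded.\<close>
  have "\<not> k < num_ones m n ?X - num_ones m n ?M"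
  proof
    assume "k < num_ones m n ?X - num_ones m n ?M"
    moreover have "k < num_ones m n ?X - num_ones m n ?M \<longrightarrow> drop (m + n + 2 + m * n) xs \<noteq> binary k"
      using no_k by (rule spec)
    ultimately show False using k by simp
  qed
  then have "num_ones m n ?X \<le> num_ones m n ?M + k" by simp
  moreover have "certifies m n ?M (\<lambda>a i. nthb us (a * m + i)) (\<lambda>b j. nthb us (m * m + (b * n + j))) ?X"
    using v by (simp add: verifies_def)
  ultimately have "SC1P_by_zero_flips (mat m n (\<lambda>(i, j). ?M i j)) k"
    unfolding SC1P_by_zero_flips_iff by blast
  moreover have "\<forall>i<m. nthb xs i" using v unfolding verifies_def by (elim conjE)
  moreover have "\<not> nthb xs m" using v unfolding verifies_def by (elim conjE)
  moreover have "\<forall>i<n. nthb xs (m + 1 + i)" using v unfolding verifies_def by (elim conjE)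
  moreover have "\<not> nthb xs (m + 1 + n)" using v unfolding verifies_def by (elim conjE)
  ultimately show "xs \<in> SC1P_zero_flipping"
    unfolding in_language_iff using le k
    by (intro exI[of _ m] exI[of _ n] exI[of _ k] conjI)
qed

subsection \<open>The verifier\<close>

text \<open>
  Variable 0 holds the length of the instance, 1 and 2 hold the dimensions of the matrix.
\<close>

definition Iff :: "exp \<Rightarrow> exp \<Rightarrow> exp" where
  "Iff a b = Conj (Imp a b) (Imp b a)"

lemma nonzero_eval:
  "eval w s (Iff a b) \<noteq> 0 \<longleftrightarrow> (eval w s a \<noteq> 0 \<longleftrightarrow> eval w s b \<noteq> 0)"
  "eval w s (Conj a b) \<noteq> 0 \<longleftrightarrow> eval w s a \<noteq> 0 \<and> eval w s b \<noteq> 0"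
  "eval w s (Imp a b) \<noteq> 0 \<longleftrightarrow> (eval w s a \<noteq> 0 \<longrightarrow> eval w s b \<noteq> 0)"
  "eval w s (Neg a) \<noteq> 0 \<longleftrightarrow> \<not> eval w s a \<noteq> 0"
  "eval w s (Disj a b) \<noteq> 0 \<longleftrightarrow> eval w s a \<noteq> 0 \<or> eval w s b \<noteq> 0"
  "eval w s (Eq a b) \<noteq> 0 \<longleftrightarrow> eval w s a = eval w s b"
  "eval w s (Le a b) \<noteq> 0 \<longleftrightarrow> eval w s a \<le> eval w s b"
  "eval w s (Lt a b) \<noteq> 0 \<longleftrightarrow> eval w s a < eval w s b"
  "eval w s (All v a b) \<noteq> 0 \<longleftrightarrow> (\<forall>i<eval w s a. eval w (s(v := i)) b \<noteq> 0)"
  "eval w s (Ex v a b) \<noteq> 0 \<longleftrightarrow> (\<exists>i<eval w s a. eval w (s(v := i)) b \<noteq> 0)"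
  "eval w s (Is_pow2 a) \<noteq> 0 \<longleftrightarrow> (\<exists>i. eval w s a = 2 ^ i)"
  by (auto simp: Iff_def)

lemmas upd_simps = fun_upd_apply eval.simps(1) rel_simps if_True if_False simp_thms

text \<open>In a pair, bit \<open>e\<close> of the instance sits at position
  \<open>2 * e + 1\<close> behind its marker, and the certificate starts at
  \<open>2 * N + 1\<close>. The guard keeps reads past the instance from hitting certificate
  bits.\<close>

definition vX :: "exp \<Rightarrow> exp" where
  "vX e = Conj (Lt e (Var 0)) (Bit (Add (Add e e) One))"

definition vU :: "exp \<Rightarrow> exp" where
  "vU e = Bit (Add (Add (Add (Var 0) (Var 0)) One) e)"

definition vOff :: exp where
  "vOff = Add (Add (Var 1) (Var 2)) (Num 2)"

definition vM :: "exp \<Rightarrow> exp \<Rightarrow> exp" where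
  "vM i j = vX (Add (Add vOff (Mul i (Var 2))) j)"

definition vP :: "exp \<Rightarrow> exp \<Rightarrow> exp" where
  "vP a i = vU (Add (Mul a (Var 1)) i)"

definition vQ :: "exp \<Rightarrow> exp \<Rightarrow> exp" where
  "vQ b j = vU (Add (Mul (Var 1) (Var 1)) (Add (Mul b (Var 2)) j))"

definition vY :: "exp \<Rightarrow> exp \<Rightarrow> exp" where
  "vY a b = vU (Add (Add (Mul (Var 1) (Var 1)) (Mul (Var 2) (Var 2))) (Add (Mul a (Var 2)) b))"

definition vPerm :: "exp \<Rightarrow> (exp \<Rightarrow> exp \<Rightarrow> exp) \<Rightarrow> exp" where
  "vPerm m P = Conj (All 3 m (Ex 4 m (All 5 m (Iff (P (Var 3) (Var 5)) (Eq (Var 5) (Var 4))))))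
     (All 4 m (Ex 3 m (P (Var 3) (Var 4))))"

definition vConvex :: "exp \<Rightarrow> exp \<Rightarrow> (exp \<Rightarrow> exp \<Rightarrow> exp) \<Rightarrow> exp" where
  "vConvex m n X = All 3 m (All 4 n (All 5 n (All 6 (Var 5) (Imp (Lt (Var 4) (Var 6))
     (Imp (X (Var 3) (Var 4)) (Imp (X (Var 3) (Var 5)) (X (Var 3) (Var 6))))))))"

definition vOnes :: "(exp \<Rightarrow> exp \<Rightarrow> exp) \<Rightarrow> exp" where
  "vOnes X = Sum 3 (Var 1) (Count 4 (Var 2) (X (Var 3) (Var 4)))"

definition vSize :: exp where
  "vSize = Add vOff (Mul (Var 1) (Var 2))"

definition vBudget :: exp where
  "vBudget = All 5 (Sub (vOnes vY) (vOnes vM)) (Neg (Conj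
     (Eq (Sub (Var 0) vSize) (Log2 (Add (Var 5) One)))
     (All 6 (Add (Var 5) One) (Imp (Is_pow2 (Var 6))
        (Iff (vX (Add vSize (Log2 (Var 6)))) (Mod (Div (Var 5) (Var 6)) (Num 2)))))))"

definition vCert :: exp where
  "vCert = Conj (vPerm (Var 1) vP) (Conj (vPerm (Var 2) vQ) (Conj
     (All 3 (Var 1) (All 4 (Var 1) (All 5 (Var 2) (All 6 (Var 2)
        (Imp (vP (Var 3) (Var 4)) (Imp (vQ (Var 5) (Var 6)) (Imp (vM (Var 4) (Var 6)) (vY (Var 3) (Var 5)))))))))
     (Conj (vConvex (Var 1) (Var 2) vY) (vConvex (Var 2) (Var 1) (\<lambda>b a. vY a b)))))"

definition vBody :: exp where
  "vBody = Conj (Le vSize (Var 0)) (Conj (All 3 (Var 1) (vX (Var 3))) (Conj (Neg (vX (Var 1)))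
     (Conj (All 3 (Var 2) (vX (Add (Add (Var 1) One) (Var 3)))) (Conj (Neg (vX (Add (Add (Var 1) One) (Var 2))))
     (Conj (Disj (Eq vSize (Var 0)) (vX (Sub (Var 0) One))) (Conj vCert vBudget))))))"

text \<open>The length of the instance is found by search: it is the only \<open>N\<close> such that
  \<open>2 * N\<close> is within the input and is the first even position holding False. The
  dimensions are smaller than this length, so they too can be searched for.\<close>

definition verifier :: exp where
  "verifier = Ex 0 Len (Conj (All 1 (Var 0) (Bit (Add (Var 1) (Var 1)))) (Conj (Neg (Bit (Add (Var 0) (Var 0))))
     (Conj (Lt (Add (Var 0) (Var 0)) Len) (Ex 1 (Var 0) (Ex 2 (Var 0) vBody)))))"

context
  fixes w :: "bool list" and N :: nat and x u :: "nat \<Rightarrow> bool"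
  assumes x: "\<And>i. x i \<longleftrightarrow> i < N \<and> nthb w (i + i + 1)" and u: "\<And>j. u j \<longleftrightarrow> nthb w (N + N + 1 + j)"
begin

lemma eval_vX: "s 0 = N \<Longrightarrow> eval w s (vX e) = of_bool (x (eval w s e))"
  by (simp add: vX_def x)

lemma eval_vU: "s 0 = N \<Longrightarrow> eval w s (vU e) = of_bool (u (eval w s e))"
  by (simp add: vU_def u)

lemma eval_vOff: "s 1 = m \<Longrightarrow> s 2 = n \<Longrightarrow> eval w s vOff = m + n + 2"
  by (simp add: vOff_def)

lemma eval_vSize: "s 1 = m \<Longrightarrow> s 2 = n \<Longrightarrow> eval w s vSize = m + n + 2 + m * n"
  by (simp add: vSize_def eval_vOff)

lemma eval_vM: "s 0 = N \<Longrightarrow> s 1 = m \<Longrightarrow> s 2 = n \<Longrightarrow>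
    eval w s (vM i j) = of_bool (x (m + n + 2 + eval w s i * n + eval w s j))"
  by (simp add: vM_def eval_vX eval_vOff)

lemma eval_vP: "s 0 = N \<Longrightarrow> s 1 = m \<Longrightarrow> s 2 = n \<Longrightarrow>
    eval w s (vP a i) = of_bool (u (eval w s a * m + eval w s i))"
  by (simp add: vP_def eval_vU)

lemma eval_vQ: "s 0 = N \<Longrightarrow> s 1 = m \<Longrightarrow> s 2 = n \<Longrightarrow>
    eval w s (vQ b j) = of_bool (u (m * m + (eval w s b * n + eval w s j)))"
  by (simp add: vQ_def eval_vU)

lemma eval_vY: "s 0 = N \<Longrightarrow> s 1 = m \<Longrightarrow> s 2 = n \<Longrightarrow>
    eval w s (vY a b) = of_bool (u (m * m + n * n + (eval w s a * n + eval w s b)))"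
  by (simp add: vY_def eval_vU)

lemma eval_vOnes:
  assumes "\<And>s a b. s 0 = N \<Longrightarrow> s 1 = m \<Longrightarrow> s 2 = n \<Longrightarrow> eval w s (X a b) = of_bool (Y (eval w s a) (eval w s b))"
    and "s 0 = N" "s 1 = m" "s 2 = n"
  shows "eval w s (vOnes X) = num_ones m n Y"
  using assms by (simp add: vOnes_def num_ones_def)

lemma eval_vBody:
  assumes s: "s 0 = N" "s 1 = m" "s 2 = n"
  shows "eval w s vBody \<noteq> 0 \<longleftrightarrow> verifies N x u m n"
proof -
  have 1: "eval w s vCert \<noteq> 0 \<longleftrightarrow> certifies m n (\<lambda>i j. x (m + n + 2 + i * n + j)) (\<lambda>a i. u (a * m + i))
      (\<lambda>b j. u (m * m + (b * n + j))) (\<lambda>a b. u (m * m + n * n + (a * n + b)))"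
    by (simp only: vCert_def certifies_def vPerm_def perm_rel_def vConvex_def row_convex_def
        nonzero_eval upd_simps s eval_vM eval_vP eval_vQ eval_vY of_bool_eq_0_iff)
  have 2: "eval w s (vOnes vY) = num_ones m n (\<lambda>a b. u (m * m + n * n + (a * n + b)))"
    "eval w s (vOnes vM) = num_ones m n (\<lambda>i j. x (m + n + 2 + i * n + j))"
    by (rule eval_vOnes; use s eval_vY eval_vM in simp)+
  have parity: "eval w s (Mod (Div b c) (Num 2)) \<noteq> 0 \<longleftrightarrow> odd (eval w s b div eval w s c)" for s b c
    by (simp add: odd_iff_mod_2_eq_one)
  have 3: "eval w s vBudget \<noteq> 0 \<longleftrightarrow>
     (\<forall>k<num_ones m n (\<lambda>a b. u (m * m + n * n + (a * n + b))) - num_ones m n (\<lambda>i j. x (m + n + 2 + i * n + j)).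
        \<not> (N - (m + n + 2 + m * n) = card (powers_below (Suc k)) \<and>
           (\<forall>p<Suc k. (\<exists>i. p = 2 ^ i) \<longrightarrow> x (m + n + 2 + m * n + card (powers_below p)) = odd (k div p))))"
    by (simp only: vBudget_def nonzero_eval upd_simps s eval.simps(2,5,6) 2 eval_vSize eval_vX of_bool_eq_0_iff
        eval_Log2 eval_Is_pow2 Suc_eq_plus1 parity)
  show ?thesis
    by (simp only: vBody_def verifies_def nonzero_eval upd_simps s 1 3 eval.simps(2,5,6) eval_vSize eval_vX
        of_bool_eq_0_iff)
qed

end

lemma length_pair_bits: "length (pair_bits xs us) = 2 * length xs + 1 + length us"
  by (induction xs) (simp_all add: pair_bits_def)

lemma nthb_pair_bits:
  "nthb (pair_bits xs us) (i + i) \<longleftrightarrow> i < length xs \<or> length xs < i \<and> nthb us (i + i - (2 * length xs + 1))"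
  "i < length xs \<Longrightarrow> nthb (pair_bits xs us) (i + i + 1) \<longleftrightarrow> nthb xs i"
  "nthb (pair_bits xs us) (length xs + length xs + 1 + j) \<longleftrightarrow> nthb us j"
proof -
  show "nthb (pair_bits xs us) (length xs + length xs + 1 + j) \<longleftrightarrow> nthb us j"
    by (induction xs) (simp_all add: pair_bits_def nthb_def)
  show "nthb (pair_bits xs us) (i + i) \<longleftrightarrow> i < length xs \<or> length xs < i \<and> nthb us (i + i - (2 * length xs + 1))"
  proof (induction xs arbitrary: i)
    case Nil
    show ?case by (cases i) (simp_all add: pair_bits_def nthb_def)
  next
    case (Cons a xs)
    show ?case
    proof (cases i)
      case (Suc i')
      then show ?thesis using Cons[of i'] by (simp add: pair_bits_def nthb_def)
    qed (simp add: pair_bits_def nthb_def)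
  qed
  show "nthb (pair_bits xs us) (i + i + 1) \<longleftrightarrow> nthb xs i" if "i < length xs"
    using that
  proof (induction xs arbitrary: i)
    case (Cons a xs)
    show ?case
    proof (cases i)
      case (Suc i')
      then show ?thesis using Cons.IH[of i'] Cons.prems by (simp add: pair_bits_def nthb_def)
    qed (simp add: pair_bits_def nthb_def)
  qed simp
qed

lemma eval_verifier:
  "eval (pair_bits xs us) s verifier \<noteq> 0 \<longleftrightarrow> (\<exists>m n. verifies (length xs) (nthb xs) (nthb us) m n)"
proof -
  let ?w = "pair_bits xs us"
  let ?N = "length xs"
  have x: "nthb xs i \<longleftrightarrow> i < ?N \<and> nthb ?w (i + i + 1)" for i
    using nthb_pair_bits(2)[of i xs us] by (auto simp: nthb_def)
  note body = eval_vBody[where x = "nthb xs" and u = "nthb us" and N = ?N and w = ?w, OF x nthb_pair_bits(3)[symmetric]]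
  have body': "eval ?w (s(0 := ?N, 1 := m, 2 := n)) vBody \<noteq> 0 \<longleftrightarrow> verifies ?N (nthb xs) (nthb us) m n" for m n
    by (rule body) simp_all
  have N_unique: "(\<forall>i<N. nthb ?w (i + i)) \<and> \<not> nthb ?w (N + N) \<and> N + N < length ?w \<longleftrightarrow> N = ?N" for N
  proof
    assume *: "(\<forall>i<N. nthb ?w (i + i)) \<and> \<not> nthb ?w (N + N) \<and> N + N < length ?w"
    have "\<not> N < ?N" using * nthb_pair_bits(1)[of xs us N] by blast
    moreover have "\<not> ?N < N" using * nthb_pair_bits(1)[of xs us ?N] by blast
    ultimately show "N = ?N" by simp
  next
    assume "N = ?N"
    then show "(\<forall>i<N. nthb ?w (i + i)) \<and> \<not> nthb ?w (N + N) \<and> N + N < length ?w"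
      by (simp add: nthb_pair_bits(1) length_pair_bits)
  qed
  have "eval ?w s verifier \<noteq> 0 \<longleftrightarrow> (\<exists>N<length ?w. ((\<forall>i<N. nthb ?w (i + i)) \<and> \<not> nthb ?w (N + N) \<and> N + N < length ?w) \<and>
      (\<exists>m<N. \<exists>n<N. eval ?w (s(0 := N, 1 := m, 2 := n)) vBody \<noteq> 0))"
    by (simp only: verifier_def nonzero_eval upd_simps eval.simps(3,5) eval_Bit_nthb of_bool_eq_0_iff conj_assoc)
  also have "\<dots> \<longleftrightarrow> (\<exists>m<?N. \<exists>n<?N. eval ?w (s(0 := ?N, 1 := m, 2 := n)) vBody \<noteq> 0)"
    unfolding N_unique by (auto simp: length_pair_bits)
  also have "\<dots> \<longleftrightarrow> (\<exists>m<?N. \<exists>n<?N. verifies ?N (nthb xs) (nthb us) m n)"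
    by (simp only: body')
  also have "\<dots> \<longleftrightarrow> (\<exists>m n. verifies ?N (nthb xs) (nthb us) m n)"
    using verifies_bound by blast
  finally show ?thesis .
qed

theorem SC1P_zero_flipping_in_NP: "SC1P_zero_flipping \<in> NP"
proof -
  define V where "V = {w. eval w (\<lambda>_. 0) verifier \<noteq> 0}"
  have "(\<lambda>w. gout w (\<lambda>_. 0) (GOut verifier)) = (\<lambda>w. [w \<in> V])"
    by (simp add: V_def)
  then have "poly_time_decidable V"
    unfolding poly_time_decidable_def using poly_time_computable_gout[of "GOut verifier"] by simp
  moreover have "xs \<in> SC1P_zero_flipping \<longleftrightarrow>
      (\<exists>us. length us \<le> poly [:0, 0, 3:] (length xs) \<and> pair_bits xs us \<in> V)" for xs
    unfolding in_language_iff_verifies V_def mem_Collect_eq eval_verifier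
    by (simp add: power2_eq_square mult.commute mult.left_commute)
  ultimately show ?thesis unfolding NP_def by blast
qed

subsection \<open>Runs of Turing machines\<close>

text \<open>Halting is turned into an idle step, so that every time step of a run obeys the same
  rule.\<close>

definition next_actions :: "turing_machine \<Rightarrow> nat \<Rightarrow> nat list \<Rightarrow> nat \<times> action list" where
  "next_actions T q ss = (if q = halt_state T then (q, map (\<lambda>s. (s, Stay)) ss) else transition T q ss)"

lemma tm_step_eq:
  "tm_step T (q, ts) = (fst (next_actions T q (reads ts)), map2 apply_action (snd (next_actions T q (reads ts))) ts)"
proof -
  have "map2 apply_action (map (\<lambda>s. (s, Stay)) (reads ts)) ts = ts"
    by (rule nth_equalityI) (simp_all add: apply_action_def read_tape_def)
  then show ?thesis
    by (auto simp: tm_step_def next_actions_def split: prod.splits)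
qed

definition local_states :: "turing_machine \<Rightarrow> (nat \<times> nat list) set" where
  "local_states T = {(q, ss). q < num_states T \<and> length ss = num_tapes T \<and> set ss \<subseteq> {..<num_symbols T}}"

lemma finite_local_states: "finite (local_states T)"
proof (rule finite_subset)
  show "local_states T \<subseteq> {..<num_states T} \<times> {ss. set ss \<subseteq> {..<num_symbols T} \<and> length ss = num_tapes T}"
    by (auto simp: local_states_def)
  show "finite ({..<num_states T} \<times> {ss. set ss \<subseteq> {..<num_symbols T} \<and> length ss = num_tapes T})"
    by (intro finite_cartesian_product finite_lists_length_eq) auto
qed

lemma next_actions_wf:
  assumes "wf_tm T" "(q, ss) \<in> local_states T"
  shows "fst (next_actions T q ss) < num_states T" "length (snd (next_actions T q ss)) = num_tapes T"
    "i < num_tapes T \<Longrightarrow> fst (snd (next_actions T q ss) ! i) < num_symbols T"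
proof -
  obtain q' as where step: "transition T q ss = (q', as)" by fastforce
  have *: "q' < num_states T \<and> length as = num_tapes T \<and> fst ` set as \<subseteq> {..<num_symbols T}"
    using assms step unfolding wf_tm_def local_states_def by blast
  have ss: "q < num_states T" "length ss = num_tapes T" "set ss \<subseteq> {..<num_symbols T}"
    using assms(2) by (auto simp: local_states_def)
  show "fst (next_actions T q ss) < num_states T" "length (snd (next_actions T q ss)) = num_tapes T"
    using * ss step by (auto simp: next_actions_def)
  show "fst (snd (next_actions T q ss) ! i) < num_symbols T" if "i < num_tapes T"
  proof (cases "q = halt_state T")
    case True
    have "i < length ss" using that ss(2) by simp
    from subsetD[OF ss(3) nth_mem[OF this]] show ?thesis using True that ss(2) by (simp add: next_actions_def)
  next
    case False
    have sub: "fst ` set as \<subseteq> {..<num_symbols T}" using * by simp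
    have "fst (as ! i) \<in> fst ` set as" using that * by simp
    from subsetD[OF sub this] have "fst (as ! i) \<in> {..<num_symbols T}" .
    then show ?thesis using False step by (simp add: next_actions_def)
  qed
qed

locale tm_run =
  fixes T :: turing_machine and w :: "bool list"
  assumes wf: "wf_tm T"
begin

definition conf :: "nat \<Rightarrow> config" where
  "conf t = (tm_step T ^^ t) (initial_config T w)"

definition state :: "nat \<Rightarrow> nat" where
  "state t = fst (conf t)"

definition content :: "nat \<Rightarrow> nat \<Rightarrow> int \<Rightarrow> nat" where
  "content t i = fst (snd (conf t) ! i)"

definition head :: "nat \<Rightarrow> nat \<Rightarrow> int" where
  "head t i = snd (snd (conf t) ! i)"

definition symbols :: "nat \<Rightarrow> nat list" where
  "symbols t = reads (snd (conf t))"

definition actions :: "nat \<Rightarrow> action list" where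
  "actions t = snd (next_actions T (state t) (symbols t))"

lemma conf_Suc: "conf (Suc t) = (fst (next_actions T (state t) (symbols t)), map2 apply_action (actions t) (snd (conf t)))"
  using tm_step_eq[of T "fst (conf t)" "snd (conf t)"]
  by (simp add: conf_def state_def symbols_def actions_def)

lemma tapes_pos: "1 \<le> num_tapes T" "3 \<le> num_symbols T"
  using wf by (simp_all add: wf_tm_def)

lemma invariant:
  "length (snd (conf t)) = num_tapes T \<and> state t < num_states T \<and> (\<forall>i<num_tapes T. \<forall>p. content t i p < num_symbols T)"
proof (induction t)
  case 0
  have "bits_on_tape w p < num_symbols T" for p
    using tapes_pos by (simp add: bits_on_tape_def)
  then show ?case
    using wf by (auto simp: conf_def initial_config_def state_def content_def wf_tm_def nth_Cons split: nat.split)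
next
  case (Suc t)
  have len_t: "length (symbols t) = num_tapes T" using Suc by (simp add: symbols_def)
  have "symbols t ! i < num_symbols T" if "i < num_tapes T" for i
    using Suc that by (simp add: symbols_def read_tape_def content_def)
  then have "set (symbols t) \<subseteq> {..<num_symbols T}"
    using len_t by (metis in_set_conv_nth lessThan_iff subsetI)
  then have "(state t, symbols t) \<in> local_states T"
    using Suc len_t by (simp add: local_states_def)
  note wf' = next_actions_wf[OF wf this, folded actions_def]
  have len: "length (snd (conf (Suc t))) = num_tapes T"
    using Suc wf'(2) by (simp add: conf_Suc)
  have "content (Suc t) i p < num_symbols T" if "i < num_tapes T" for i p
    using that Suc wf'(2) wf'(3)[OF that] by (auto simp: content_def conf_Suc apply_action_def)
  then show ?case using len wf'(1) by (simp add: state_def conf_Suc)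
qed

lemma length_conf: "length (snd (conf t)) = num_tapes T"
  using invariant by blast

lemma symbols_nth: "i < num_tapes T \<Longrightarrow> symbols t ! i = content t i (head t i)"
  by (simp add: symbols_def length_conf content_def head_def read_tape_def)

lemma length_symbols: "length (symbols t) = num_tapes T"
  by (simp add: symbols_def length_conf)

lemma local_state: "(state t, symbols t) \<in> local_states T"
  using invariant[of t] length_symbols[of t] symbols_nth[of _ t] by (auto simp: local_states_def in_set_conv_nth)

lemma length_actions: "length (actions t) = num_tapes T"
  unfolding actions_def by (rule next_actions_wf[OF wf local_state])

lemma state_Suc: "state (Suc t) = fst (next_actions T (state t) (symbols t))"
  by (simp add: state_def conf_Suc)

lemma head_Suc: "i < num_tapes T \<Longrightarrow> head (Suc t) i = head t i + move_offset (snd (actions t ! i))"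
  by (simp add: head_def conf_Suc length_actions length_conf apply_action_def)

lemma content_Suc:
  "i < num_tapes T \<Longrightarrow> content (Suc t) i p = (if p = head t i then fst (actions t ! i) else content t i p)"
  by (simp add: content_def head_def conf_Suc length_actions length_conf apply_action_def)

lemma state_0: "state 0 = start_state T"
  by (simp add: state_def conf_def initial_config_def)

lemma head_0: "i < num_tapes T \<Longrightarrow> head 0 i = 0"
  by (cases i) (simp_all add: head_def conf_def initial_config_def)

lemma content_0: "i < num_tapes T \<Longrightarrow> content 0 i p = (if i = 0 then bits_on_tape w p else 0)"
  by (cases i) (simp_all add: content_def conf_def initial_config_def)

lemma content_unvisited:
  "i < num_tapes T \<Longrightarrow> (\<And>t'. t' < t \<Longrightarrow> head t' i \<noteq> p) \<Longrightarrow> content t i p = content 0 i p"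
  by (induction t) (auto simp: content_Suc)

text \<open>This is what makes the consistency of a run a condition on pairs of times: the content
  of a cell depends on its last visit only.\<close>

lemma content_last_visit:
  assumes "i < num_tapes T" "t' < t" "head t' i = p" "\<And>t''. t' < t'' \<Longrightarrow> t'' < t \<Longrightarrow> head t'' i \<noteq> p"
  shows "content t i p = fst (actions t' ! i)"
  using assms(2,4)
proof (induction t)
  case (Suc t)
  show ?case
  proof (cases "t = t'")
    case True
    then show ?thesis using assms(1,3) by (simp add: content_Suc)
  next
    case False
    then have t: "p \<noteq> head t i" "t' < t" using Suc.prems(1) Suc.prems(2)[of t] by auto
    have "content t i p = fst (actions t' ! i)" using t(2) Suc.prems(2) by (intro Suc.IH) simp_all
    then show ?thesis using t(1) assms(1) by (simp add: content_Suc)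
  qed
qed simp

lemma head_bound: "i < num_tapes T \<Longrightarrow> \<bar>head t i\<bar> \<le> int t"
proof (induction t)
  case (Suc t)
  have "\<bar>move_offset m\<bar> \<le> 1" for m by (cases m) auto
  from this[of "snd (actions t ! i)"] show ?case using Suc by (simp add: head_Suc)
qed (simp add: head_0)

text \<open>The halting configuration is stationary, so the answer can be read from cell 0 at any
  later common time.\<close>

lemma outputs_within_single:
  assumes "outputs_within T w [b] t" "t \<le> t'"
  shows "content t' (num_tapes T - 1) 0 = (if b then 2 else 1)"
proof -
  have 1: "fst (conf t) = halt_state T" "fst (last (snd (conf t))) = bits_on_tape [b]"
    using assms(1) by (simp_all add: outputs_within_def conf_def Let_def)
  have "conf (t + d) = conf t" for d
  proof (induction d)
    case (Suc d)
    have "conf (t + Suc d) = tm_step T (conf (t + d))" by (simp add: conf_def)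
    then show ?case using Suc 1 by (simp add: tm_step_def)
  qed simp
  then have "conf t' = conf t" using assms(2) by (metis le_add_diff_inverse)
  moreover have "snd (conf t) \<noteq> []" using tapes_pos(1) length_conf[of t] by auto
  ultimately have "content t' (num_tapes T - 1) 0 = fst (last (snd (conf t))) 0"
    by (simp add: content_def last_conv_nth length_conf)
  then show ?thesis using 1 by (simp add: bits_on_tape_def)
qed

end

subsection \<open>Accepting runs as independent sets\<close>

lemma bits_on_tape_nthb: "bits_on_tape w (int j) = (if j < length w then if nthb w j then 2 else 1 else 0)"
  by (simp add: bits_on_tape_def nthb_def)

lemma bits_on_tape_neg: "p < 0 \<Longrightarrow> bits_on_tape w p = 0"
  by (simp add: bits_on_tape_def)

lemma bits_on_tape_pair:
  "j < 2 * length xs \<Longrightarrow> even j \<Longrightarrow> bits_on_tape (pair_bits xs us) (int j) = 2"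
  "j < 2 * length xs \<Longrightarrow> odd j \<Longrightarrow> bits_on_tape (pair_bits xs us) (int j) = (if nthb xs (j div 2) then 2 else 1)"
  "bits_on_tape (pair_bits xs us) (int (2 * length xs)) = 1"
  "bits_on_tape (pair_bits xs us) (int (2 * length xs + 1 + q)) = (if q < length us then if us ! q then 2 else 1 else 0)"
proof -
  show "bits_on_tape (pair_bits xs us) (int j) = 2" if "j < 2 * length xs" "even j"
  proof -
    from that(2) obtain i where "j = i + i" by (metis evenE mult_2)
    then show ?thesis using that(1) nthb_pair_bits(1)[of xs us i]
      by (simp only: bits_on_tape_nthb length_pair_bits) simp
  qed
  show "bits_on_tape (pair_bits xs us) (int j) = (if nthb xs (j div 2) then 2 else 1)" if "j < 2 * length xs" "odd j"
  proof -
    from that(2) obtain i where i: "j = 2 * i + 1" by (rule oddE)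
    then have "j = i + i + 1" "j div 2 = i" by simp_all
    then show ?thesis using that(1) i nthb_pair_bits(2)[of i xs us]
      by (simp only: bits_on_tape_nthb length_pair_bits) simp
  qed
  show "bits_on_tape (pair_bits xs us) (int (2 * length xs)) = 1"
    using nthb_pair_bits(1)[of xs us "length xs"]
    by (simp only: bits_on_tape_nthb length_pair_bits mult_2) simp
  show "bits_on_tape (pair_bits xs us) (int (2 * length xs + 1 + q)) = (if q < length us then if us ! q then 2 else 1 else 0)"
    using nthb_pair_bits(3)[of xs us q]
    by (simp only: bits_on_tape_nthb length_pair_bits mult_2) (simp add: nthb_def)
qed

text \<open>
  A vertex records, for a time and a tape, the local state (machine state and all symbols read), the head
  position, shifted by \<open>Tm\<close>, and \<open>Suc\<close> of the time of the last earlier visit to that position, or 0. Two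
  records conflict if they cannot belong to the same run. Time \<open>Tm\<close> only inspects cell 0 of the output tape.
\<close>

locale tableau =
  fixes T :: turing_machine and dec :: "nat \<Rightarrow> nat \<times> nat list" and na Tm b :: nat and xs :: "bool list"
  assumes wf: "wf_tm T" and dec: "bij_betw dec {..<na} (local_states T)" and Tm: "1 \<le> Tm"
begin

abbreviation k :: nat where "k \<equiv> num_tapes T"
abbreviation W :: nat where "W \<equiv> 2 * Tm + 1"
abbreviation base :: nat where "base \<equiv> Tm + 2 * length xs"

text \<open>The components are the digits of \<open>u\<close> in a mixed radix system with radices
  \<open>Suc Tm\<close>, \<open>k\<close>, \<open>na\<close> and \<open>W\<close>. The radix
  \<open>W\<close> accounts for the head positions from \<open>- Tm\<close> to
  \<open>Tm\<close>.\<close>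

definition time :: "nat \<Rightarrow> nat" where "time u = u mod Suc Tm"
definition tape :: "nat \<Rightarrow> nat" where "tape u = u div Suc Tm mod k"
definition act :: "nat \<Rightarrow> nat" where "act u = u div Suc Tm div k mod na"
definition pos :: "nat \<Rightarrow> nat" where "pos u = u div Suc Tm div k div na mod W"
definition vis :: "nat \<Rightarrow> nat" where "vis u = u div Suc Tm div k div na div W"

definition num_vertices :: nat where
  "num_vertices = Suc Tm * (k * (na * (W * Suc Tm)))"

definition vertex :: "nat \<Rightarrow> nat \<Rightarrow> nat \<Rightarrow> nat \<Rightarrow> nat \<Rightarrow> nat" where
  "vertex t i a h l = t + Suc Tm * (i + k * (a + na * (h + W * l)))"

definition st :: "nat \<Rightarrow> nat" where "st a = fst (dec a)"
definition sym :: "nat \<Rightarrow> nat \<Rightarrow> nat" where "sym a i = snd (dec a) ! i"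
definition nx :: "nat \<Rightarrow> nat" where "nx a = fst (next_actions T (fst (dec a)) (snd (dec a)))"
definition wr :: "nat \<Rightarrow> nat \<Rightarrow> nat" where "wr a i = fst (snd (next_actions T (fst (dec a)) (snd (dec a))) ! i)"
text \<open>Offsets are shifted by one to become natural numbers; \<open>c3\<close> compensates with
  \<open>pos v + 1\<close>.\<close>

definition mv :: "nat \<Rightarrow> nat \<Rightarrow> nat" where
  "mv a i = nat (1 + move_offset (snd (snd (next_actions T (fst (dec a)) (snd (dec a))) ! i)))"

definition cert :: "nat \<Rightarrow> bool" where
  "cert h \<longleftrightarrow> base + 1 \<le> h \<and> h < base + 1 + b"

text \<open>The shifted layout of \<open>pair_bits\<close>: position \<open>base\<close> holds the
  separator. Behind it the certificate is unknown, so a bit or a blank is allowed; that the blanks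
  form a final part is left to \<open>c10\<close>.\<close>

definition ini :: "nat \<Rightarrow> nat \<Rightarrow> nat \<Rightarrow> bool" where
  "ini i h s \<longleftrightarrow> (if i = 0 \<and> Tm \<le> h \<and> h < base + 1 + b then
     (if h < base then if even (h - Tm) then s = 2 else s = (if nthb xs ((h - Tm) div 2) then 2 else 1)
      else if h = base then s = 1 else s < 3)
   else s = 0)"

text \<open>Together with the required size \<open>Suc Tm * k\<close> this forces exactly one record
  for each time and tape.\<close>

definition c1 :: "nat \<Rightarrow> nat \<Rightarrow> bool" where
  "c1 u v \<longleftrightarrow> time u = time v \<and> tape u = tape v \<and> u \<noteq> v"
definition c2 :: "nat \<Rightarrow> nat \<Rightarrow> bool" where
  "c2 u v \<longleftrightarrow> time u = time v \<and> act u \<noteq> act v"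
text \<open>The step into time \<open>Tm\<close> is exempt, since the last record on the output tape
  is placed on cell 0 instead of the true head position.\<close>

definition c3 :: "nat \<Rightarrow> nat \<Rightarrow> bool" where
  "c3 u v \<longleftrightarrow> tape u = tape v \<and> time v = Suc (time u) \<and> time v < Tm \<and>
     (st (act v) \<noteq> nx (act u) \<or> pos v + 1 \<noteq> pos u + mv (act u) (tape u))"
definition c4 :: "nat \<Rightarrow> nat \<Rightarrow> bool" where
  "c4 u v \<longleftrightarrow> tape u = tape v \<and> time u < time v \<and> vis v = Suc (time u) \<and>
     (pos u \<noteq> pos v \<or> sym (act v) (tape v) \<noteq> wr (act u) (tape v))"
text \<open>Rules out visits after the recorded one. With \<open>vis v = 0\<close> it rules out all
  earlier visits, so the successor in \<open>vis\<close> treats both cases alike.\<close>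

definition c5 :: "nat \<Rightarrow> nat \<Rightarrow> bool" where
  "c5 u v \<longleftrightarrow> tape u = tape v \<and> time u < time v \<and> vis v < Suc (time u) \<and> pos u = pos v"
text \<open>The recorded visit must be strictly earlier, and \<open>vis\<close> holds the successor
  of its time. This and the next three conditions concern \<open>v\<close> alone, so an offending
  record conflicts with itself.\<close>

definition c6 :: "nat \<Rightarrow> bool" where
  "c6 v \<longleftrightarrow> time v < vis v"
definition c7 :: "nat \<Rightarrow> bool" where
  "c7 v \<longleftrightarrow> time v = 0 \<and> (st (act v) \<noteq> start_state T \<or> pos v \<noteq> Tm)"
definition c8 :: "nat \<Rightarrow> bool" where
  "c8 v \<longleftrightarrow> vis v = 0 \<and> \<not> ini (tape v) (pos v) (sym (act v) (tape v))"
definition c9 :: "nat \<Rightarrow> bool" where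
  "c9 v \<longleftrightarrow> time v = Tm \<and> Suc (tape v) = k \<and> (pos v \<noteq> Tm \<or> sym (act v) (tape v) \<noteq> 2)"
text \<open>A blank among the certificate cells followed by a nonblank symbol cannot come from a bit
  string. Only first visits reveal the initial content.\<close>

definition c10 :: "nat \<Rightarrow> nat \<Rightarrow> bool" where
  "c10 u v \<longleftrightarrow> tape u = 0 \<and> tape v = 0 \<and> vis u = 0 \<and> vis v = 0 \<and> pos u < pos v \<and> cert (pos u) \<and> cert (pos v) \<and>
     sym (act u) 0 = 0 \<and> sym (act v) 0 \<noteq> 0"

definition conflict :: "nat \<Rightarrow> nat \<Rightarrow> bool" where
  "conflict u v \<longleftrightarrow> c1 u v \<or> c2 u v \<or> c3 u v \<or> c4 u v \<or> c5 u v \<or> c6 v \<or> c7 v \<or> c8 v \<or> c9 v \<or> c10 u v"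

lemma k_pos: "1 \<le> k"
  using wf by (simp add: wf_tm_def)

lemma vertex_components:
  assumes "t \<le> Tm" "i < k" "a < na" "h < W"
  shows "time (vertex t i a h l) = t" "tape (vertex t i a h l) = i" "act (vertex t i a h l) = a"
    "pos (vertex t i a h l) = h" "vis (vertex t i a h l) = l"
proof -
  have d: "(a + n * m) div n = m" "(a + n * m) mod n = a" if "a < n" for a n m :: nat
    using that by simp_all
  have 1: "vertex t i a h l div Suc Tm = i + k * (a + na * (h + W * l))" "vertex t i a h l mod Suc Tm = t"
    unfolding vertex_def using assms by (simp_all only: d less_Suc_eq_le)
  show "time (vertex t i a h l) = t" "tape (vertex t i a h l) = i" "act (vertex t i a h l) = a"
    "pos (vertex t i a h l) = h" "vis (vertex t i a h l) = l"
    unfolding time_def tape_def act_def pos_def vis_def 1 using assms by (simp_all only: d)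
qed

lemma mixed_radix_less: "a < n \<Longrightarrow> m < p \<Longrightarrow> a + n * m < n * p" for a n m p :: nat
proof -
  assume "a < n" "m < p"
  then have "a + n * m < n * Suc m" by simp
  also have "\<dots> \<le> n * p" using \<open>m < p\<close> by (intro mult_le_mono2) simp
  finally show ?thesis .
qed

lemma vertex_less:
  assumes "t \<le> Tm" "i < k" "a < na" "h < W" "l \<le> Tm"
  shows "vertex t i a h l < num_vertices"
  unfolding vertex_def num_vertices_def using assms
  by (intro mixed_radix_less) simp_all

lemma components_less:
  assumes "u < num_vertices"
  shows "time u \<le> Tm" "tape u < k" "act u < na" "pos u < W"
proof -
  have "na \<noteq> 0" using assms unfolding num_vertices_def by (intro notI) simp
  then show "tape u < k" "act u < na" "pos u < W"
    using k_pos by (simp_all add: tape_def act_def pos_def)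
  show "time u \<le> Tm"
    using mod_less_divisor[of "Suc Tm" u] by (simp add: time_def)
qed

lemma ini_content:
  assumes "length us \<le> b" "i < k"
  shows "ini i h (if i = 0 then bits_on_tape (pair_bits xs us) (int h - int Tm) else 0)"
proof (cases "i = 0 \<and> Tm \<le> h")
  case True
  then obtain j where j: "h = Tm + j" using le_Suc_ex by blast
  have p: "int h - int Tm = int j" by (simp add: j)
  consider "j < 2 * length xs" "even j" | "j < 2 * length xs" "odd j" | "j = 2 * length xs"
    | q where "j = 2 * length xs + 1 + q" by (metis add.assoc less_iff_Suc_add linorder_less_linear plus_1_eq_Suc add.commute)
  then show ?thesis
  proof cases
    case 1
    then show ?thesis using True bits_on_tape_pair(1)[OF 1, of us] unfolding p by (simp add: ini_def j)
  next
    case 2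
    then show ?thesis using True bits_on_tape_pair(2)[OF 2, of us] unfolding p by (simp add: ini_def j)
  next
    case 3
    then show ?thesis using True bits_on_tape_pair(3)[of xs us, folded 3] unfolding p by (simp add: ini_def j)
  next
    case 4
    have "bits_on_tape (pair_bits xs us) (int j) = (if q < length us then if us ! q then 2 else 1 else 0)"
      unfolding 4 by (rule bits_on_tape_pair(4))
    then show ?thesis using True assms(1) unfolding p by (simp add: ini_def j 4)
  qed
next
  case False
  then show ?thesis by (auto simp: ini_def bits_on_tape_neg)
qed

text \<open>The records of the actual run form the independent set; each kind of conflict is refuted
  by a property of runs.\<close>

lemma independent_if_accepting:
  assumes us: "length us \<le> b" and acc: "tm_run.content T (pair_bits xs us) Tm (k - 1) 0 = 2"
  shows "\<exists>S\<subseteq>{..<num_vertices}. card S = Suc Tm * k \<and> independent conflict S"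
proof -
  interpret tm_run T "pair_bits xs us" by unfold_locales (rule wf)
  \<comment> \<open>On the output tape the last record looks at cell 0, wherever the head is, so
    that acceptance becomes visible in a record.\<close>
  define hd where "hd t i = (if t = Tm \<and> i = k - 1 then 0 else head t i)" for t i
  have hd_eq: "hd t i = head t i" if "t < Tm" for t i using that by (simp add: hd_def)
  define ss where "ss t = map (\<lambda>i. content t i (hd t i)) [0..<k]" for t
  have "(state t, ss t) \<in> local_states T" for t
    using invariant[of t] by (auto simp: local_states_def ss_def)
  then have "\<exists>a<na. dec a = (state t, ss t)" for t
    using dec by (metis (no_types, lifting) bij_betw_iff_bijections lessThan_iff)
  then obtain a where a: "\<And>t. a t < na" "\<And>t. dec (a t) = (state t, ss t)" by metis
  have ss_eq: "ss t = symbols t" if "t < Tm" for t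
    by (rule nth_equalityI) (simp_all add: ss_def length_symbols symbols_nth hd_eq that)
  have sym: "sym (a t) i = content t i (hd t i)" if "i < k" for t i
    using that by (simp add: sym_def a(2) ss_def)
  define h where "h t i = nat (hd t i + int Tm)" for t i
  have hd_bound: "\<bar>hd t i\<bar> \<le> int Tm" if "t \<le> Tm" "i < k" for t i
    using head_bound[OF that(2), of t] that(1) by (auto simp: hd_def)
  have h: "int (h t i) = hd t i + int Tm" "h t i < W" if "t \<le> Tm" "i < k" for t i
    using hd_bound[OF that] by (simp_all add: h_def)
  have h_eq: "h t i = h t' i \<longleftrightarrow> hd t i = hd t' i" if "t \<le> Tm" "t' \<le> Tm" "i < k" for t t' i
    using h[OF that(1,3)] h[OF that(2,3)] by linarith
  define V where "V t i = {t'. t' < t \<and> hd t' i = hd t i}" for t i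
  define l where "l t i = (if V t i = {} then 0 else Suc (Max (V t i)))" for t i
  have finV: "finite (V t i)" for t i by (simp add: V_def)
  have V_iff: "t' \<in> V t i \<longleftrightarrow> t' < t \<and> hd t' i = hd t i" for t t' i
    by (simp add: V_def)
  have Max_V: "Max (V t i) < t \<and> hd (Max (V t i)) i = hd t i" if "V t i \<noteq> {}" for t i
    using Max_in[OF finV that] unfolding V_iff .
  have l_le: "l t i \<le> t" for t i
    using Max_V[of t i] by (simp add: l_def Suc_le_eq)
  have l_0: "hd t' i \<noteq> hd t i" if "l t i = 0" "t' < t" for t t' i
    using that V_iff[of t' t i] by (auto simp: l_def split: if_splits)
  have l_Suc: "t' < t" "hd t' i = hd t i" if "l t i = Suc t'" for t t' i
    using that Max_V[of t i] by (auto simp: l_def split: if_splits)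
  have l_last: "hd t'' i \<noteq> hd t i" if "l t i < Suc t''" "t'' < t" for t t'' i
  proof
    assume "hd t'' i = hd t i"
    then have "t'' \<in> V t i" using that(2) by (simp add: V_iff)
    then have "Suc t'' \<le> l t i" using Max_ge[OF finV, of t'' t i] by (auto simp: l_def)
    then show False using that(1) by simp
  qed
  define U where "U t i = vertex t i (a t) (h t i) (l t i)" for t i
  have U: "time (U t i) = t" "tape (U t i) = i" "act (U t i) = a t" "pos (U t i) = h t i" "vis (U t i) = l t i"
    if "t \<le> Tm" "i < k" for t i
    unfolding U_def using that a(1) h(2)[OF that] by (simp_all only: vertex_components)
  define S where "S = (\<lambda>(t, i). U t i) ` ({..Tm} \<times> {..<k})"
  have "inj_on (\<lambda>(t, i). U t i) ({..Tm} \<times> {..<k})"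
  proof (rule inj_onI)
    fix x y assume xy: "x \<in> {..Tm} \<times> {..<k}" "y \<in> {..Tm} \<times> {..<k}" "(\<lambda>(t, i). U t i) x = (\<lambda>(t, i). U t i) y"
    then show "x = y" using U(1,2)[of "fst x" "snd x"] U(1,2)[of "fst y" "snd y"] by (auto split: prod.splits)
  qed
  then have "card S = Suc Tm * k" by (simp add: S_def card_image)
  moreover have "S \<subseteq> {..<num_vertices}"
  proof
    fix u assume "u \<in> S"
    then obtain t i where "u = U t i" "t \<le> Tm" "i < k" by (auto simp: S_def)
    then show "u \<in> {..<num_vertices}"
      using vertex_less[of t i "a t" "h t i" "l t i"] a(1) h(2) l_le[of t i] by (simp add: U_def)
  qed
  moreover have "independent conflict S"
    unfolding independent_def
  proof (intro ballI)
    fix u v assume "u \<in> S" "v \<in> S"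
    then obtain t' i' t i where u: "u = U t' i'" "t' \<le> Tm" "i' < k" and v: "v = U t i" "t \<le> Tm" "i < k"
      by (auto simp: S_def)
    note Us = U[OF u(2,3), folded u(1)] U[OF v(2,3), folded v(1)]
    have cont0: "content t i (hd t i) = (if i = 0 then bits_on_tape (pair_bits xs us) (int (h t i) - int Tm) else 0)"
      if "l t i = 0" "t \<le> Tm" "i < k" for t i
    proof -
      have "content t i (hd t i) = content 0 i (hd t i)"
      proof (rule content_unvisited[OF that(3)])
        fix t'' assume "t'' < t"
        then show "head t'' i \<noteq> hd t i" using l_0[OF that(1), of t''] hd_eq[of t'' i] that(2) by simp
      qed
      moreover have e: "int (h t i) - int Tm = hd t i" using h(1)[OF that(2,3)] by simp
      ultimately show ?thesis unfolding e by (simp add: content_0[OF that(3)])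
    qed
    have "\<not> c1 u v"
    proof
      assume "c1 u v"
      then have "t' = t" "i' = i" "u \<noteq> v" by (simp_all add: c1_def Us)
      then show False using u(1) v(1) by simp
    qed
    moreover have "\<not> c2 u v" by (simp add: c2_def Us)
    moreover have "\<not> c3 u v"
    proof
      assume "c3 u v"
      then have *: "i' = i" "t = Suc t'" "t < Tm" "st (a t) \<noteq> nx (a t') \<or> h t i + 1 \<noteq> h t' i + mv (a t') i"
        by (auto simp: c3_def Us)
      have "st (a t) = nx (a t')" using * by (simp add: st_def nx_def a(2) ss_eq state_Suc)
      moreover have "int (h t i + 1) = int (h t' i + mv (a t') i)"
      proof -
        have "-1 \<le> move_offset m" for m by (cases m) auto
        from this[of "snd (actions t' ! i)"] have "int (mv (a t') i) = 1 + move_offset (snd (actions t' ! i))"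
          using * by (simp add: mv_def a(2) ss_eq actions_def)
        then show ?thesis using h(1)[OF v(2,3)] h(1)[OF u(2) v(3)] * head_Suc[OF v(3), of t']
          by (simp add: hd_eq)
      qed
      ultimately show False using *(4) by linarith
    qed
    moreover have "\<not> c4 u v"
    proof
      assume "c4 u v"
      then have *: "i' = i" "t' < t" "l t i = Suc t'" "h t' i \<noteq> h t i \<or> sym (a t) i \<noteq> wr (a t') i"
        by (auto simp: c4_def Us)
      have "h t' i = h t i" using h_eq[OF u(2) v(2,3)] l_Suc[OF *(3)] by simp
      moreover have "sym (a t) i = fst (actions t' ! i)"
        unfolding sym[OF v(3)]
      proof (rule content_last_visit[OF v(3) *(2)])
        show "head t' i = hd t i" using l_Suc[OF *(3)] hd_eq[of t' i] *(2) v(2) by simp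
        fix t'' assume "t' < t''" "t'' < t"
        then show "head t'' i \<noteq> hd t i" using l_last[of t i t''] *(3) hd_eq[of t'' i] v(2) by simp
      qed
      moreover have "wr (a t') i = fst (actions t' ! i)"
        using *(2) v(2) by (simp add: wr_def a(2) ss_eq actions_def)
      ultimately show False using *(4) by simp
    qed
    moreover have "\<not> c5 u v"
      using l_last[of t i t'] h_eq[OF u(2) v(2,3)] by (auto simp: c5_def Us)
    moreover have "\<not> c6 v" using l_le[of t i] by (simp add: c6_def Us)
    moreover have "\<not> c7 v"
      using Tm state_0 head_0[OF v(3)] h(1)[OF v(2,3)] by (auto simp: c7_def Us st_def a(2) hd_eq)
    moreover have "\<not> c8 v"
    proof
      assume "c8 v"
      then have *: "l t i = 0" "\<not> ini i (h t i) (sym (a t) i)" by (simp_all add: c8_def Us)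
      then show False
        using ini_content[OF us v(3), of "h t i"] cont0[OF *(1) v(2,3)] sym[OF v(3), of t] by simp
    qed
    moreover have "\<not> c9 v"
    proof
      assume "c9 v"
      then have *: "t = Tm" "i = k - 1" "h t i \<noteq> Tm \<or> sym (a t) i \<noteq> 2" by (auto simp: c9_def Us)
      have "hd t i = 0" using * by (simp add: hd_def)
      then show False using h(1)[OF v(2,3)] sym[OF v(3), of t] * acc by simp
    qed
    moreover have "\<not> c10 u v"
    proof
      assume "c10 u v"
      then have *: "i' = 0" "i = 0" "l t' 0 = 0" "l t 0 = 0" "h t' 0 < h t 0" "cert (h t' 0)" "cert (h t 0)"
        "sym (a t') 0 = 0" "sym (a t) 0 \<noteq> 0" by (auto simp: c10_def Us)
      obtain q' where q': "h t' 0 = base + 1 + q'" using *(6) le_Suc_ex unfolding cert_def by blast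
      obtain q where q: "h t 0 = base + 1 + q" using *(7) le_Suc_ex unfolding cert_def by blast
      note q = q' q
      have p: "int (h t' 0) - int Tm = int (2 * length xs + 1 + q')" "int (h t 0) - int Tm = int (2 * length xs + 1 + q)"
        by (simp_all add: q)
      have "bits_on_tape (pair_bits xs us) (int (2 * length xs + 1 + q')) = 0"
        using *(1,3,8) cont0[of t' 0] u(2,3) sym[of 0 t'] unfolding p(1) by simp
      \<comment> \<open>A blank certificate cell lies past the end of the certificate, and so do all
        cells to its right.\<close>
      then have "\<not> q' < length us" unfolding bits_on_tape_pair by (auto split: if_splits)
      then have "\<not> q < length us" using *(5) q by simp
      then have "bits_on_tape (pair_bits xs us) (int (2 * length xs + 1 + q)) = 0" unfolding bits_on_tape_pair by simp
      then show False using *(2,4,9) cont0[of t 0] v(2,3) sym[of 0 t] unfolding p(2) by simp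
    qed
    ultimately show "\<not> conflict u v" by (simp add: conflict_def)
  qed
  ultimately show ?thesis by blast
qed

end

section \<open>From an independent set back to an accepting run\<close>

context tableau
begin

text \<open>Counting yields one record for each time and tape. The certificate is read off the first
  visits to its cells, and induction on the time shows that the records before \<open>Tm\<close>
  describe the run on this certificate.\<close>

lemma accepting_if_independent:
  assumes S: "S \<subseteq> {..<num_vertices}" "card S = Suc Tm * k" "independent conflict S"
  shows "\<exists>us. length us \<le> b \<and> tm_run.content T (pair_bits xs us) Tm (k - 1) 0 = 2"
proof -
  have free: "\<not> conflict u v" if "u \<in> S" "v \<in> S" for u v
    using S(3) that unfolding independent_def by blast
  have finS: "finite S" using S(1) by (rule finite_subset) simp
  let ?f = "\<lambda>u. (time u, tape u)"
  have inj: "inj_on ?f S"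
  proof (rule inj_onI)
    fix u v assume "u \<in> S" "v \<in> S" "?f u = ?f v"
    then show "u = v" using free[of u v] by (auto simp: conflict_def c1_def)
  qed
  have comp: "time u \<le> Tm" "tape u < k" "act u < na" if "u \<in> S" for u
    using components_less[of u] S(1) that by auto
  have "?f ` S \<subseteq> {..Tm} \<times> {..<k}" using comp by auto
  moreover have "card (?f ` S) = card ({..Tm} \<times> {..<k})"
    using card_image[OF inj] S(2) by simp
  ultimately have img: "?f ` S = {..Tm} \<times> {..<k}" by (intro card_subset_eq) simp_all
  define U where "U t i = inv_into S ?f (t, i)" for t i
  have U: "U t i \<in> S" "time (U t i) = t" "tape (U t i) = i" if "t \<le> Tm" "i < k" for t i
  proof -
    have m: "(t, i) \<in> ?f ` S" using that by (simp add: img)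
    show "U t i \<in> S" unfolding U_def by (rule inv_into_into[OF m])
    have "?f (U t i) = (t, i)" unfolding U_def by (rule f_inv_into_f[OF m])
    then show "time (U t i) = t" "tape (U t i) = i" by simp_all
  qed
  define a h l where "a t = act (U t 0)" and "h t i = pos (U t i)" and "l t i = vis (U t i)" for t i
  have cf: "\<not> conflict (U t' i') (U t i)" if "t' \<le> Tm" "i' < k" "t \<le> Tm" "i < k" for t' i' t i
    by (rule free[OF U(1)[OF that(1,2)] U(1)[OF that(3,4)]])
  have actU: "act (U t i) = a t" if "t \<le> Tm" "i < k" for t i
  proof -
    have k: "0 < k" using that(2) by simp
    have "\<not> c2 (U t 0) (U t i)" using cf[OF that(1) k that] by (simp add: conflict_def)
    then show ?thesis using U(2)[OF that(1) k] U(2)[OF that] by (simp add: c2_def a_def)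
  qed
  note Us = U(2,3) actU h_def[symmetric] l_def[symmetric]
  have step: "st (a (Suc t)) = nx (a t) \<and> h (Suc t) i + 1 = h t i + mv (a t) i" if "Suc t < Tm" "i < k" for t i
  proof -
    have "\<not> c3 (U t i) (U (Suc t) i)" using cf[of t i "Suc t" i] that by (simp add: conflict_def)
    then show ?thesis using that by (simp add: c3_def Us)
  qed
  have visit: "h t' i = h t i \<and> sym (a t) i = wr (a t') i" if "t' < t" "t \<le> Tm" "i < k" "l t i = Suc t'" for t' t i
  proof -
    have "\<not> c4 (U t' i) (U t i)" using cf[of t' i t i] that by (simp add: conflict_def)
    then show ?thesis using that by (simp add: c4_def Us)
  qed
  have no_visit: "h t' i \<noteq> h t i" if "t' < t" "t \<le> Tm" "i < k" "l t i < Suc t'" for t' t i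
  proof -
    have "\<not> c5 (U t' i) (U t i)" using cf[of t' i t i] that by (simp add: conflict_def)
    then show ?thesis using that by (simp add: c5_def Us)
  qed
  have l_le: "l t i \<le> t" if "t \<le> Tm" "i < k" for t i
  proof -
    have "\<not> c6 (U t i)" using cf[OF that that] by (simp add: conflict_def)
    then show ?thesis using that by (simp add: c6_def Us)
  qed
  have start: "st (a 0) = start_state T \<and> h 0 i = Tm" if "i < k" for i
  proof -
    have "\<not> c7 (U 0 i)" using cf[of 0 i 0 i] that by (simp add: conflict_def)
    then show ?thesis using that by (simp add: c7_def Us)
  qed
  have init: "ini i (h t i) (sym (a t) i)" if "t \<le> Tm" "i < k" "l t i = 0" for t i
  proof -
    have "\<not> c8 (U t i)" using cf[OF that(1,2) that(1,2)] by (simp add: conflict_def)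
    then show ?thesis using that by (simp add: c8_def Us)
  qed
  have final: "h Tm (k - 1) = Tm \<and> sym (a Tm) (k - 1) = 2"
  proof -
    have k: "k - 1 < k" "Suc (k - 1) = k" using k_pos by simp_all
    have "\<not> c9 (U Tm (k - 1))" using cf[of Tm "k - 1" Tm "k - 1"] k(1) by (simp add: conflict_def)
    then show ?thesis using k by (simp add: c9_def Us)
  qed
  have blank: "sym (a t) 0 = 0" if "t' \<le> Tm" "t \<le> Tm" "l t' 0 = 0" "l t 0 = 0" "h t' 0 < h t 0"
    "cert (h t' 0)" "cert (h t 0)" "sym (a t') 0 = 0" for t' t
  proof -
    have k: "0 < k" using k_pos by simp
    have "\<not> c10 (U t' 0) (U t 0)" using cf[OF that(1) k that(2) k] by (simp add: conflict_def)
    then show ?thesis using that k by (simp add: c10_def Us)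
  qed
  \<comment> \<open>Of two first visits to the same cell, the later one would violate
    \<open>no_visit\<close>. Hence the recorded initial symbol of a cell is unique.\<close>
  have once: "t' = t" if "t' \<le> Tm" "t \<le> Tm" "l t' i = 0" "l t i = 0" "h t' i = h t i" "i < k" for t' t i
  proof (rule ccontr)
    assume "t' \<noteq> t"
    then consider "t' < t" | "t < t'" by linarith
    then show False using no_visit[of t' t i] no_visit[of t t' i] that by cases simp_all
  qed

  define reads_at where "reads_at j s \<longleftrightarrow> (\<exists>t\<le>Tm. l t 0 = 0 \<and> h t 0 = base + 1 + j \<and> sym (a t) 0 = s)" for j s
  \<comment> \<open>The certificate ends at the first cell recorded as initially blank, or after
    \<open>b\<close> cells. Cells before that without a recorded first visit receive the bit False,
    which contradicts no record.\<close>
  define L where "L = (LEAST j. j = b \<or> reads_at j 0)"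
  define us where "us = map (\<lambda>j. reads_at j 2) [0..<L]"
  have L_le: "L \<le> b" unfolding L_def by (rule Least_le) simp
  have L_reads: "L = b \<or> reads_at L 0" unfolding L_def by (rule LeastI[of _ b]) simp
  have L_min: "\<not> reads_at j 0" if "j < L" for j
    using not_less_Least[OF that[unfolded L_def]] by blast
  have len: "length us = L" by (simp add: us_def)

  interpret tm_run T "pair_bits xs us" by unfold_locales (rule wf)

  have init_content: "content 0 i (int (h t i) - int Tm) = sym (a t) i" if "t \<le> Tm" "i < k" "l t i = 0" for t i
  proof (cases "i = 0 \<and> Tm \<le> h t i \<and> h t i < base + 1 + b")
    case False
    have "sym (a t) i = 0" using init[OF that] False by (auto simp: ini_def)
    moreover have "content 0 i (int (h t i) - int Tm) = 0"
    proof (cases "i = 0 \<and> Tm \<le> h t i")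
      case True
      then have "base + 1 + b \<le> h t i" using False by linarith
      then obtain q where q: "h t i = base + 1 + (b + q)" using le_Suc_ex by (metis add.assoc)
      have p: "int (h t i) - int Tm = int (2 * length xs + 1 + (b + q))" by (simp add: q)
      show ?thesis unfolding content_0[OF that(2)] p bits_on_tape_pair(4) using L_le by (simp add: len)
    next
      case False
      then show ?thesis using content_0[OF that(2)] by (auto simp: bits_on_tape_neg)
    qed
    ultimately show ?thesis by simp
  next
    case True
    then obtain j where j: "h t i = Tm + j" using le_Suc_ex by blast
    have p: "int (h t i) - int Tm = int j" by (simp add: j)
    have c0: "content 0 i (int j) = bits_on_tape (pair_bits xs us) (int j)"
      using True content_0[OF that(2)] by simp
    note ini = init[OF that, unfolded ini_def j]
    consider "j < 2 * length xs" "even j" | "j < 2 * length xs" "odd j" | "j = 2 * length xs"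
      | q where "j = 2 * length xs + 1 + q" by (metis add.assoc less_iff_Suc_add linorder_less_linear plus_1_eq_Suc add.commute)
    then show ?thesis
    proof cases
      case 1
      then show ?thesis using ini True bits_on_tape_pair(1)[OF 1, of us] unfolding p c0 by (simp add: j)
    next
      case 2
      then show ?thesis using ini True bits_on_tape_pair(2)[OF 2, of us] unfolding p c0 by (simp add: j)
    next
      case 3
      then show ?thesis using ini True bits_on_tape_pair(3)[of xs us, folded 3] unfolding p c0 by (simp add: j)
    next
      case 4
      have i0: "i = 0" using True by simp
      have q: "q < b" "h t 0 = base + 1 + q" using True j unfolding i0 4 by simp_all
      have s: "sym (a t) 0 < 3" using ini q(1) unfolding i0 4 by simp
      have l0: "l t 0 = 0" and k0: "0 < k" using that unfolding i0 by simp_all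
      have uniq: "reads_at q s \<longleftrightarrow> sym (a t) 0 = s" for s
      proof
        assume "reads_at q s"
        then obtain t' where t': "t' \<le> Tm" "l t' 0 = 0" "h t' 0 = base + 1 + q" "sym (a t') 0 = s"
          unfolding reads_at_def by blast
        then have "t' = t" using once[OF t'(1) that(1) t'(2) l0 _ k0] q(2) by simp
        then show "sym (a t) 0 = s" using t'(4) by simp
      next
        assume "sym (a t) 0 = s"
        then show "reads_at q s" unfolding reads_at_def using that(1) l0 q(2) by blast
      qed
      have "bits_on_tape (pair_bits xs us) (int j) = (if q < length us then if us ! q then 2 else 1 else 0)"
        unfolding 4 by (rule bits_on_tape_pair(4))
      also have "\<dots> = sym (a t) 0"
      proof (cases "q < L")
        case True
        then have "sym (a t) 0 \<noteq> 0" using L_min[of q] uniq[of 0] by blast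
        moreover have "us ! q \<longleftrightarrow> sym (a t) 0 = 2" using True uniq[of 2] by (simp add: us_def)
        ultimately show ?thesis using True s by (auto simp: len)
      next
        case False
        then have "L < b" using q(1) by simp
        then have "reads_at L 0" using L_reads by simp
        \<comment> \<open>Cell \<open>L\<close> was recorded as blank, and \<open>blank\<close>
          propagates this to every certificate cell further right.\<close>
        have "sym (a t) 0 = 0"
        proof (cases "q = L")
          case True
          then show ?thesis using \<open>reads_at L 0\<close> uniq[of 0] by simp
        next
          case neq: False
          obtain t' where t': "t' \<le> Tm" "l t' 0 = 0" "h t' 0 = base + 1 + L" "sym (a t') 0 = 0"
            using \<open>reads_at L 0\<close> unfolding reads_at_def by blast
          show ?thesis
            by (rule blank[OF t'(1) that(1) t'(2) l0 _ _ _ t'(4)])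
              (use False neq q \<open>L < b\<close> in \<open>simp_all add: t'(3) cert_def\<close>)
        qed
        then show ?thesis using False by (simp add: len)
      qed
      finally show ?thesis unfolding p c0 by (simp add: i0)
    qed
  qed

  have dec_mem: "dec (a t) \<in> local_states T" if "t \<le> Tm" for t
  proof -
    have "a t < na" using comp(3)[OF U(1)[OF that, of 0]] k_pos by (simp add: a_def)
    then show ?thesis using bij_betwE[OF dec] by simp
  qed

  define good where "good t \<longleftrightarrow> dec (a t) = (state t, symbols t) \<and> (\<forall>i<k. int (h t i) = head t i + int Tm)" for t

  \<comment> \<open>If all earlier records are faithful, the visit named by \<open>l t i\<close> is
    the true last one, so the symbol in the record is the one it left behind, or the initial
    one.\<close>
  have content_sym: "content t i (int (h t i) - int Tm) = sym (a t) i"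
    if "t \<le> Tm" "i < k" "\<And>t'. t' < t \<Longrightarrow> good t'" for t i
  proof (cases "l t i")
    case 0
    have "content t i (int (h t i) - int Tm) = content 0 i (int (h t i) - int Tm)"
    proof (rule content_unvisited[OF that(2)])
      fix t' assume "t' < t"
      then show "head t' i \<noteq> int (h t i) - int Tm"
        using no_visit[OF _ that(1,2), of t'] 0 that(3)[of t'] that(2) by (auto simp: good_def)
    qed
    then show ?thesis using init_content[OF that(1,2) 0] by simp
  next
    case (Suc t')
    have t': "t' < t" using l_le[OF that(1,2)] Suc by simp
    have "content t i (int (h t i) - int Tm) = fst (actions t' ! i)"
    proof (rule content_last_visit[OF that(2) t'])
      show "head t' i = int (h t i) - int Tm"
        using visit[OF t' that(1,2) Suc] that(3)[OF t'] that(2) by (auto simp: good_def)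
      fix t'' assume "t' < t''" "t'' < t"
      then show "head t'' i \<noteq> int (h t i) - int Tm"
        using no_visit[OF _ that(1,2), of t''] Suc that(3)[of t''] that(2) by (auto simp: good_def)
    qed
    also have "\<dots> = wr (a t') i" using that(3)[OF t'] by (simp add: good_def wr_def actions_def)
    also have "\<dots> = sym (a t) i" using visit[OF t' that(1,2) Suc] by simp
    finally show ?thesis .
  qed

  have good: "good t" if "t < Tm" for t
    using that
  proof (induction t rule: less_induct)
    case (less t)
    have IH: "good t'" if "t' < t" for t' using less.IH[OF that] less.prems that by simp
    have st_head: "st (a t) = state t \<and> (\<forall>i<k. int (h t i) = head t i + int Tm)"
    proof (cases t)
      case 0
      have "st (a 0) = start_state T" using start[of 0] k_pos by simp
      moreover have "int (h 0 i) = head 0 i + int Tm" if "i < k" for i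
        using start[OF that] head_0[OF that] by simp
      ultimately show ?thesis using 0 by (simp add: state_0)
    next
      case (Suc t0)
      have g: "good t0" using IH[of t0] Suc by simp
      have 1: "st (a t) = state t"
        using step[of t0 0] less.prems Suc g k_pos by (simp add: state_Suc good_def nx_def)
      have "int (h t i) = head t i + int Tm" if "i < k" for i
      proof -
        have "-1 \<le> move_offset m" for m by (cases m) auto
        from this[of "snd (actions t0 ! i)"] have "int (mv (a t0) i) = 1 + move_offset (snd (actions t0 ! i))"
          using g by (simp add: mv_def good_def actions_def)
        moreover have "h t i + 1 = h t0 i + mv (a t0) i" using step[of t0 i] less.prems Suc that by simp
        then have "int (h t i) + 1 = int (h t0 i) + int (mv (a t0) i)" by linarith
        moreover have "int (h t0 i) = head t0 i + int Tm" using g that by (simp add: good_def)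
        ultimately show ?thesis using head_Suc[OF that, of t0] Suc by simp
      qed
      then show ?thesis using 1 by simp
    qed
    have "length (snd (dec (a t))) = k"
      using dec_mem[of t] less.prems by (auto simp: local_states_def)
    then have "snd (dec (a t)) = symbols t"
    proof (rule nth_equalityI[OF trans])
      show "k = length (symbols t)" by (simp add: length_symbols)
      fix i assume "i < length (snd (dec (a t)))"
      then have i: "i < k" using \<open>length _ = k\<close> by simp
      have "content t i (int (h t i) - int Tm) = sym (a t) i"
        using content_sym[OF _ i IH] less.prems by simp
      then show "snd (dec (a t)) ! i = symbols t ! i"
        using st_head i by (simp add: symbols_nth sym_def)
    qed
    then show ?case using st_head by (simp add: good_def st_def prod_eq_iff)
  qed
  \<comment> \<open>The record at time \<open>Tm\<close> need not be faithful to state and head: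
    \<open>content_sym\<close> uses only the earlier ones, and \<open>final\<close> places the
    record on cell 0.\<close>
  have "content Tm (k - 1) 0 = 2"
    using content_sym[OF order_refl, of "k - 1"] good final k_pos by simp
  then show ?thesis using L_le len by (intro exI[of _ us]) simp
qed

theorem independent_iff_accepting:
  "(\<exists>us. length us \<le> b \<and> tm_run.content T (pair_bits xs us) Tm (k - 1) 0 = 2) \<longleftrightarrow>
    (\<exists>S\<subseteq>{..<num_vertices}. card S = Suc Tm * k \<and> independent conflict S)"
proof
  assume "\<exists>us. length us \<le> b \<and> tm_run.content T (pair_bits xs us) Tm (k - 1) 0 = 2"
  then show "\<exists>S\<subseteq>{..<num_vertices}. card S = Suc Tm * k \<and> independent conflict S"
    by (elim exE conjE) (rule independent_if_accepting)
next
  assume "\<exists>S\<subseteq>{..<num_vertices}. card S = Suc Tm * k \<and> independent conflict S"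
  then show "\<exists>us. length us \<le> b \<and> tm_run.content T (pair_bits xs us) Tm (k - 1) 0 = 2"
    by (elim exE conjE) (rule accepting_if_independent)
qed

end

subsection \<open>Computing the reduction\<close>

lemma nonzero_Cond: "eval w s (Cond c a b) \<noteq> 0 \<longleftrightarrow> (if eval w s c \<noteq> 0 then eval w s a \<noteq> 0 else eval w s b \<noteq> 0)"
  by simp

locale tableau_expressions =
  fixes T :: turing_machine and dec :: "nat \<Rightarrow> nat \<times> nat list" and na :: nat
    and eT eb :: exp and Tm b :: "bool list \<Rightarrow> nat"
  assumes wf: "wf_tm T" and dec: "bij_betw dec {..<na} (local_states T)" and Tm: "1 \<le> Tm x"
    and eval_eT: "eval x s eT = Tm x" and eval_eb: "eval x s eb = b x"
begin

sublocale tab: tableau T dec na "Tm x" "b x" x for x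
  by unfold_locales (rule wf dec Tm)+

abbreviation k :: nat where "k \<equiv> num_tapes T"

lemma k_pos: "0 < k"
  using wf by (simp add: wf_tm_def)

lemma na_pos: "0 < na"
proof (rule ccontr)
  assume "\<not> 0 < na"
  then have "local_states T = {}" using dec by (simp add: bij_betw_def)
  moreover have "(start_state T, replicate k 0) \<in> local_states T"
    using wf by (auto simp: local_states_def wf_tm_def)
  ultimately show False by simp
qed

definition eW :: exp where "eW = Add (Add eT eT) One"
definition eBase :: exp where "eBase = Add eT (Add Len Len)"
definition eTime :: "exp \<Rightarrow> exp" where "eTime u = Mod u (Add eT One)"
definition eTape :: "exp \<Rightarrow> exp" where "eTape u = Mod (Div u (Add eT One)) (Num k)"
definition eAct :: "exp \<Rightarrow> exp" where "eAct u = Mod (Div (Div u (Add eT One)) (Num k)) (Num na)"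
definition ePos :: "exp \<Rightarrow> exp" where "ePos u = Mod (Div (Div (Div u (Add eT One)) (Num k)) (Num na)) eW"
definition eVis :: "exp \<Rightarrow> exp" where "eVis u = Div (Div (Div (Div u (Add eT One)) (Num k)) (Num na)) eW"

definition eTab2 :: "(nat \<Rightarrow> nat \<Rightarrow> nat) \<Rightarrow> exp \<Rightarrow> exp \<Rightarrow> exp" where
  "eTab2 f a i = Tab (\<lambda>q. f (q div k) (q mod k)) (na * k) (Add (Mul a (Num k)) i)"

definition eCert :: "exp \<Rightarrow> exp" where
  "eCert h = Conj (Le (Add eBase One) h) (Lt h (Add (Add eBase One) eb))"

definition eIni :: "exp \<Rightarrow> exp \<Rightarrow> exp \<Rightarrow> exp" where
  "eIni i h s = Cond (Conj (Eq i (Num 0)) (Conj (Le eT h) (Lt h (Add (Add eBase One) eb))))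
     (Cond (Lt h eBase)
       (Cond (Neg (Mod (Sub h eT) (Num 2))) (Eq s (Num 2)) (Eq s (Cond (Bit (Div (Sub h eT) (Num 2))) (Num 2) One)))
       (Cond (Eq h eBase) (Eq s One) (Lt s (Num 3))))
     (Eq s (Num 0))"

lemma eval_components:
  "eval x s eW = 2 * Tm x + 1" "eval x s eBase = Tm x + 2 * length x"
  "eval x s (eTime u) = tab.time x (eval x s u)" "eval x s (eTape u) = tab.tape x (eval x s u)"
  "eval x s (eAct u) = tab.act x (eval x s u)" "eval x s (ePos u) = tab.pos x (eval x s u)"
  "eval x s (eVis u) = tab.vis x (eval x s u)"
  by (simp_all add: eW_def eBase_def eTime_def eTape_def eAct_def ePos_def eVis_def eval_eT
      tab.time_def tab.tape_def tab.act_def tab.pos_def tab.vis_def mult_2)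

lemma act_less: "tab.act x u < na"
  using na_pos by (simp add: tab.act_def)

lemma tape_less: "tab.tape x u < k"
  using k_pos by (simp add: tab.tape_def)

lemma eval_eTab2: "eval x s a < na \<Longrightarrow> eval x s i < k \<Longrightarrow> eval x s (eTab2 f a i) = f (eval x s a) (eval x s i)"
proof -
  assume *: "eval x s a < na" "eval x s i < k"
  then have "eval x s (Add (Mul a (Num k)) i) < na * k" by (simp add: index_less_mult)
  then show ?thesis unfolding eTab2_def using *(2) by (simp add: eval_Tab)
qed

lemma nonzero_eCert: "eval x s (eCert h) \<noteq> 0 \<longleftrightarrow> tab.cert x (eval x s h)"
  by (simp only: eCert_def nonzero_eval tab.cert_def eval.simps(2,5) eval_components eval_eb)

lemma nonzero_eIni: "eval x s (eIni i h a) \<noteq> 0 \<longleftrightarrow> tab.ini x (eval x s i) (eval x s h) (eval x s a)"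
proof -
  have bit: "eval x s (Cond (Bit e) (Num 2) One) = (if nthb x (eval x s e) then 2 else 1)" for e
    by simp
  show ?thesis
    by (simp only: eIni_def nonzero_eval nonzero_Cond bit tab.ini_def eval.simps(2,5,6) eval_components eval_eb eval_eT
        eval_Num eval_Mod eval_Div even_iff_mod_2_eq_zero not_not)
qed

definition eConflict :: exp where
  "eConflict = (let u = Var 0; v = Var 1; tu = eTime u; tv = eTime v; iu = eTape u; iv = eTape v;
       au = eAct u; av = eAct v; pu = ePos u; pv = ePos v; lu = eVis u; lv = eVis v;
       sv = eTab2 tab.sym av iv
     in Disj (Conj (Eq tu tv) (Conj (Eq iu iv) (Neg (Eq u v))))
       (Disj (Conj (Eq tu tv) (Neg (Eq au av)))
       (Disj (Conj (Eq iu iv) (Conj (Eq tv (Add tu One)) (Conj (Lt tv eT)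
          (Disj (Neg (Eq (Tab tab.st na av) (Tab tab.nx na au))) (Neg (Eq (Add pv One) (Add pu (eTab2 tab.mv au iu))))))))
       (Disj (Conj (Eq iu iv) (Conj (Lt tu tv) (Conj (Eq lv (Add tu One))
          (Disj (Neg (Eq pu pv)) (Neg (Eq sv (eTab2 tab.wr au iv)))))))
       (Disj (Conj (Eq iu iv) (Conj (Lt tu tv) (Conj (Lt lv (Add tu One)) (Eq pu pv))))
       (Disj (Lt tv lv)
       (Disj (Conj (Eq tv (Num 0)) (Disj (Neg (Eq (Tab tab.st na av) (Num (start_state T)))) (Neg (Eq pv eT))))
       (Disj (Conj (Eq lv (Num 0)) (Neg (eIni iv pv sv)))
       (Disj (Conj (Eq tv eT) (Conj (Eq (Add iv One) (Num k)) (Disj (Neg (Eq pv eT)) (Neg (Eq sv (Num 2))))))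
         (Conj (Eq iu (Num 0)) (Conj (Eq iv (Num 0)) (Conj (Eq lu (Num 0)) (Conj (Eq lv (Num 0)) (Conj (Lt pu pv)
           (Conj (eCert pu) (Conj (eCert pv) (Conj (Eq (eTab2 tab.sym au (Num 0)) (Num 0))
             (Neg (Eq (eTab2 tab.sym av (Num 0)) (Num 0))))))))))))))))))))"

lemma nonzero_eConflict: "eval x s eConflict \<noteq> 0 \<longleftrightarrow> tab.conflict x (s 0) (s 1)"
proof -
  have tabs: "eval x s (Tab f na (eAct u)) = f (tab.act x (eval x s u))"
    "eval x s (eTab2 g (eAct u) (eTape v)) = g (tab.act x (eval x s u)) (tab.tape x (eval x s v))"
    "eval x s (eTab2 g (eAct u) (Num 0)) = g (tab.act x (eval x s u)) 0" for f g u v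
    using k_pos by (simp_all add: eval_Tab eval_eTab2 eval_components act_less tape_less)
  show ?thesis
    by (simp only: eConflict_def Let_def nonzero_eval nonzero_eCert nonzero_eIni tabs eval_components eval_Num
        eval.simps(1,2,5) eval_eT Suc_eq_plus1 tab.conflict_def tab.c1_def tab.c2_def tab.c3_def tab.c4_def
        tab.c5_def tab.c6_def tab.c7_def tab.c8_def tab.c9_def tab.c10_def)
qed

definition eVertices :: exp where
  "eVertices = Mul (Add eT One) (Mul (Num k) (Mul (Num na) (Mul eW (Add eT One))))"

definition eVariables :: exp where
  "eVariables = Mul (Add eT One) (Num k)"

lemma eval_eVertices: "eval x s eVertices = tab.num_vertices x"
  by (simp only: eVertices_def eval_Mul eval_Num eval.simps(2,5) eval_components eval_eT tab.num_vertices_def Suc_eq_plus1)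

lemma eval_eVariables: "eval x s eVariables = Suc (Tm x) * k"
  by (simp add: eVariables_def eval_eT)

end

section \<open>Writing the matrix and the budget as output bits\<close>

definition sc1p_instance :: "(nat \<Rightarrow> nat \<Rightarrow> bool) \<Rightarrow> nat \<Rightarrow> nat \<Rightarrow> bool list" where
  "sc1p_instance E n c = (let N = n ^ 3 + n * c + 1; m = n + N; k = independent_set_instance.budget E n c N m
     in encode_instance (chain_matrix m (m * m) k (pair_column E n m)) k)"

context
  fixes eE en ec :: exp and E :: "bool list \<Rightarrow> nat \<Rightarrow> nat \<Rightarrow> bool" and n c :: "bool list \<Rightarrow> nat"
  assumes eE: "\<And>x s a b. eval x s (Call eE a b) \<noteq> 0 \<longleftrightarrow> E x (eval x s a) (eval x s b)"
    and en: "\<And>x s. eval x s en = n x" and ec: "\<And>x s. eval x s ec = c x"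
begin

definition eDummies :: exp where "eDummies = Add (Add (Mul (Mul en en) en) (Mul en ec)) One"
definition eM :: exp where "eM = Add en eDummies"
definition eMM :: exp where "eMM = Mul eM eM"

text \<open>Adjacency is reached through \<open>Call\<close>, so \<open>eE\<close> finds the two
  endpoints in variables 0 and 1 although these are also loop variables outside.\<close>

definition eClash :: "exp \<Rightarrow> exp \<Rightarrow> exp" where
  "eClash u v = Cond (Conj (Lt u en) (Lt v en)) (Call eE u v) (Eq u v)"

definition eBudget :: exp where
  "eBudget = Sub (Add (Mul eM (Count 0 eMM (Neg (eClash (Div (Var 0) eM) (Mod (Var 0) eM))))) (Mul (Mul en en) en))
     (Add (Add (Sum 0 eM (Sub (Mul (Var 0) (Var 0)) (Var 0))) (Mul eDummies ec))
       (Sum 0 eMM (Cond (eClash (Div (Var 0) eM) (Mod (Var 0) eM)) (Num 0)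
          (Cond (Eq (Div (Var 0) eM) (Mod (Var 0) eM)) One (Num 2)))))"

definition eEntry :: exp where
  "eEntry = Cond (Lt (Var 0) eM)
     (Conj (Lt (Var 1) eMM) (Conj (Neg (eClash (Div (Var 1) eM) (Mod (Var 1) eM)))
        (Disj (Eq (Var 0) (Div (Var 1) eM)) (Eq (Var 0) (Mod (Var 1) eM)))))
     (Disj (Eq (Var 0) eM) (Le eMM (Var 1)))"

definition gInstance :: gen where
  "gInstance = GSeq (GFor 0 (Add (Add eM eBudget) (Num 2)) (GOut One)) (GSeq (GOut (Num 0))
     (GSeq (GFor 0 (Add (Add eMM eBudget) One) (GOut One)) (GSeq (GOut (Num 0))
     (GSeq (GFor 0 (Add (Add eM eBudget) (Num 2)) (GFor 1 (Add (Add eMM eBudget) One) (GOut eEntry)))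
       (GBinary eBudget)))))"

lemma gout_gInstance: "gout x s gInstance = sc1p_instance (E x) (n x) (c x)"
proof -
  define N where "N = n x ^ 3 + n x * c x + 1"
  define m where "m = n x + N"
  interpret independent_set_instance "E x" "n x" "c x" N m
    by unfold_locales (simp_all add: N_def m_def)
  have D: "eval x s eDummies = N" for s
    by (simp add: eDummies_def en ec N_def power3_eq_cube)
  have M: "eval x s eM = m" for s
    by (simp add: eM_def en D m_def)
  have MM: "eval x s eMM = m * m" for s
    by (simp add: eMM_def M)
  have cl: "eval x s (eClash u v) \<noteq> 0 \<longleftrightarrow> clash (E x) (n x) (eval x s u) (eval x s v)" for s u v
    by (simp only: eClash_def nonzero_Cond nonzero_eval eE en clash_def)
  have "card (A j) = (if clash (E x) (n x) (j div m) (j mod m) then 0 else if j div m = j mod m then 1 else 2)" for j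
    by (simp add: pair_column_def)
  then have ones_eq: "ones = (\<Sum>j<m * m. if clash (E x) (n x) (j div m) (j mod m) then 0 else if j div m = j mod m then 1 else 2)"
    by (simp add: ones_def)
  have K: "eval x s eBudget = budget" for s
  proof -
    have 1: "eval x s (Count 0 eMM (Neg (eClash (Div (Var 0) eM) (Mod (Var 0) eM)))) = card T"
      by (simp only: eval_Count MM nonzero_eval cl eval_Div eval_Mod upd_simps M T_def)
    have 2: "eval x s (Sum 0 eMM (Cond (eClash (Div (Var 0) eM) (Mod (Var 0) eM)) (Num 0)
          (Cond (Eq (Div (Var 0) eM) (Mod (Var 0) eM)) One (Num 2)))) = ones"
      by (simp only: eval.simps(2,7) MM eval_Cond nonzero_eval cl eval_Div eval_Mod upd_simps M eval_Num ones_eq)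
    have 3: "eval x s (Sum 0 eM (Sub (Mul (Var 0) (Var 0)) (Var 0))) = (\<Sum>i<m. i * i - i)"
      by (simp add: M)
    show ?thesis
      by (simp only: eBudget_def eval.simps(5,6) 1 2 3 eval_Mul M D en ec budget_def power3_eq_cube)
  qed
  let ?C = "chain_matrix m (m * m) budget A"
  have entry: "eval x s eEntry \<noteq> 0 \<longleftrightarrow> ?C $$ (s 0, s 1)" if "s 0 < m + budget + 2" "s 1 < m * m + budget + 1" for s
  proof -
    have "eval x s eEntry \<noteq> 0 \<longleftrightarrow> (if s 0 < m then s 1 < m * m \<and> \<not> clash (E x) (n x) (s 1 div m) (s 1 mod m) \<and>
        (s 0 = s 1 div m \<or> s 0 = s 1 mod m) else s 0 = m \<or> m * m \<le> s 1)"
      by (simp only: eEntry_def nonzero_Cond nonzero_eval cl eval_Div eval_Mod eval.simps(1) M MM)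
    also have "\<dots> \<longleftrightarrow> ?C $$ (s 0, s 1)"
      using that by (auto simp: pair_column_def)
    finally show ?thesis .
  qed
  have un: "gout x s (GSeq (GFor 0 a (GOut One)) (GSeq (GOut (Num 0)) g)) = unary (eval x s a) @ gout x s g" for s a g
    by (simp add: unary_def map_replicate_const)
  have "gout x s (GFor 0 (Add (Add eM eBudget) (Num 2)) (GFor 1 (Add (Add eMM eBudget) One) (GOut eEntry))) =
      concat (map (\<lambda>i. map (\<lambda>j. eval x (s(0 := i, 1 := j)) eEntry \<noteq> 0) [0..<m * m + budget + 1]) [0..<m + budget + 2])"
    by (simp only: gout.simps concat_map_singleton eval.simps(2,5) eval_Num M MM K)
  also have "\<dots> = entry_list ?C"
    unfolding entry_list_def dim_chain_matrix
  proof (intro arg_cong[of _ _ concat] map_cong refl)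
    fix i j assume "i \<in> set [0..<m + budget + 2]" "j \<in> set [0..<m * m + budget + 1]"
    then have ij: "i < m + budget + 2" "j < m * m + budget + 1"
      by (simp_all only: set_upt atLeastLessThan_iff)
    have s: "(s(0 := i, 1 := j)) 0 = i" "(s(0 := i, 1 := j)) 1 = j" by simp_all
    show "(eval x (s(0 := i, 1 := j)) eEntry \<noteq> 0) = ?C $$ (i, j)"
      using entry[of "s(0 := i, 1 := j)"] unfolding s using ij by blast
  qed
  finally have el: "gout x s (GFor 0 (Add (Add eM eBudget) (Num 2)) (GFor 1 (Add (Add eMM eBudget) One) (GOut eEntry))) =
      entry_list ?C" .
  have "gout x s gInstance = encode_instance ?C budget"
    unfolding gInstance_def un gout.simps(2)[of _ _ "GFor 0 (Add (Add eM eBudget) (Num 2)) (GFor 1 (Add (Add eMM eBudget) One) (GOut eEntry))"]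
      el gout_GBinary[OF K] encode_instance_def dim_chain_matrix
    by (simp only: eval.simps(2,5) eval_Num M MM K)
  then show ?thesis
    by (simp only: sc1p_instance_def Let_def N_def m_def)
qed

lemma poly_time_sc1p_instance: "poly_time_computable (\<lambda>x. sc1p_instance (E x) (n x) (c x))"
  using poly_time_computable_gout[of gInstance] by (simp only: gout_gInstance)

end

lemma sc1p_instance_iff:
  assumes "1 \<le> n" "1 \<le> c"
  shows "sc1p_instance E n c \<in> SC1P_zero_flipping \<longleftrightarrow> (\<exists>S\<subseteq>{..<n}. card S = c \<and> independent E S)"
proof -
  define N where "N = n ^ 3 + n * c + 1"
  define m where "m = n + N"
  interpret independent_set_instance E n c N m
    by unfold_locales (simp_all add: N_def m_def)
  \<comment> \<open>Both summands of \<open>N\<close> besides the constant 1 are positive, which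
    provides the three dummies.\<close>
  have "1 \<le> n ^ 3" using assms(1) by simp
  moreover have "1 \<le> n * c" using mult_le_mono[OF assms] by simp
  ultimately have "3 \<le> N" unfolding N_def by linarith
  have "sc1p_instance E n c = encode_instance (chain_matrix m (m * m) budget A) budget"
    by (simp only: sc1p_instance_def Let_def N_def m_def)
  then have "sc1p_instance E n c \<in> SC1P_zero_flipping \<longleftrightarrow> SC1P_by_zero_flips (chain_matrix m (m * m) budget A) budget"
    by (auto simp: SC1P_zero_flipping_def encode_instance_inject)
  then show ?thesis using SC1P_iff_independent[OF \<open>3 \<le> N\<close>] by simp
qed

subsection \<open>NP-completeness\<close>

lemma poly_nat_mono: "a \<le> b \<Longrightarrow> poly p a \<le> poly p b" for p :: "nat poly"
  by (induction p) (simp_all add: add_mono mult_mono)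

lemma NP_reducible_to_SC1P:
  assumes "L \<in> NP"
  shows "poly_time_reducible L SC1P_zero_flipping"
proof -
  obtain V p where V: "poly_time_decidable V" and
    L: "\<And>xs. xs \<in> L \<longleftrightarrow> (\<exists>us. length us \<le> poly p (length xs) \<and> pair_bits xs us \<in> V)"
    using assms unfolding NP_def by blast
  obtain T P where T: "wf_tm T" "\<And>xs. outputs_within T xs [xs \<in> V] (poly P (length xs))"
    using V unfolding poly_time_decidable_def poly_time_computable_def by blast
  obtain dec where dec: "bij_betw dec {..<card (local_states T)} (local_states T)"
    using ex_bij_betw_nat_finite[OF finite_local_states] by (auto simp: atLeast0LessThan)
  obtain eb where eb: "\<And>x s. eval x s eb = poly p (eval x s Len)"
    using ex_Poly[where a = Len and p = p] by blast
  \<comment> \<open>The argument is the length of the longest input the verifier can get; adding 1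
    to the time bound ensures that \<open>Tm\<close> is positive.\<close>
  obtain eT where eT: "\<And>x s. eval x s eT = poly (P + 1) (eval x s (Add (Add (Add Len Len) One) eb))"
    using ex_Poly[where a = "Add (Add (Add Len Len) One) eb" and p = "P + 1"] by blast
  define b where "b x = poly p (length x)" for x :: "bool list"
  define Tm where "Tm x = Suc (poly P (2 * length x + 1 + b x))" for x :: "bool list"
  interpret tableau_expressions T dec "card (local_states T)" eT eb Tm b
    by unfold_locales (simp_all add: T(1) dec eb eT b_def Tm_def mult_2)
  let ?f = "\<lambda>x. sc1p_instance (tab.conflict x) (tab.num_vertices x) (Suc (Tm x) * k)"
  have call: "eval x s (Call eConflict u v) \<noteq> 0 \<longleftrightarrow> tab.conflict x (eval x s u) (eval x s v)" for x s u v
    by (simp only: eval.simps(8) nonzero_eConflict) simp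
  have "poly_time_computable ?f"
    by (rule poly_time_sc1p_instance[OF call eval_eVertices eval_eVariables])
  moreover have "xs \<in> L \<longleftrightarrow> ?f xs \<in> SC1P_zero_flipping" for xs
  proof -
    \<comment> \<open>The running time depends on the length of the certificate. Monotonicity of
      \<open>P\<close> yields one time that suffices for all admissible certificates.\<close>
    have acc: "tm_run.content T (pair_bits xs us) (Tm xs) (k - 1) 0 = (if pair_bits xs us \<in> V then 2 else 1)"
      if "length us \<le> b xs" for us
    proof -
      interpret tm_run T "pair_bits xs us" by unfold_locales (rule T(1))
      have "poly P (length (pair_bits xs us)) \<le> poly P (2 * length xs + 1 + b xs)"
        using that by (intro poly_nat_mono) (simp add: length_pair_bits)
      then show ?thesis
        using outputs_within_single[OF T(2), of "Tm xs"] by (simp add: Tm_def)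
    qed
    have "1 \<le> tab.num_vertices xs" "1 \<le> Suc (Tm xs) * k"
      unfolding tab.num_vertices_def One_nat_def Suc_le_eq nat_0_less_mult_iff using k_pos na_pos by simp_all
    then have "?f xs \<in> SC1P_zero_flipping \<longleftrightarrow>
        (\<exists>S\<subseteq>{..<tab.num_vertices xs}. card S = Suc (Tm xs) * k \<and> independent (tab.conflict xs) S)"
      by (rule sc1p_instance_iff)
    also have "\<dots> \<longleftrightarrow> (\<exists>us. length us \<le> b xs \<and> tm_run.content T (pair_bits xs us) (Tm xs) (k - 1) 0 = 2)"
      by (rule tab.independent_iff_accepting[symmetric])
    also have "\<dots> \<longleftrightarrow> (\<exists>us. length us \<le> b xs \<and> pair_bits xs us \<in> V)"
      using acc by (metis (full_types) numeral_eq_one_iff semiring_norm(85))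
    also have "\<dots> \<longleftrightarrow> xs \<in> L"
      by (simp only: L b_def)
    finally show ?thesis by simp
  qed
  ultimately show ?thesis unfolding poly_time_reducible_def by blast
qed

theorem theorem11:
  shows "NP_complete SC1P_zero_flipping"
  unfolding NP_complete_def using SC1P_zero_flipping_in_NP NP_reducible_to_SC1P by blast

end
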